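(* Let $n$ and $k$ be positive integers with $k < \log n/\log\log n$. Then there exist a multi-set $\mathcal{L}_n$ of permutations of $[n]=\{1,\dots,n\}$ and a deterministic multiple-threshold algorithm for the free order multiple-choice secretary problem such that, when the algorithm processes the elements in an order chosen uniformly at random from $\mathcal{L}_n$, it achieves an expected competitive ratio of at least $$1 - 4\sqrt{\frac{\log k}{k}}.$$ Moreover, $\mathcal{L}_n$ can be computed in deterministic time polynomial in $n$, and the uniform distribution over $\mathcal{L}_n$ has entropy $O(\log\log n)$.
   Context: Free order multiple-choice ($k$-)secretary problem: given integers $1\le k\le n$, an adversary (who knows the algorithm and the distribution of orders it uses) assigns real values $v(1),\dots,v(n)$ to the elements $1,\dots,n$. The algorithm chooses an order (a permutation $\pi$ of $[n]$), here drawn from a probability distribution on the set $\Pi_n$ of all permutations of $[n]$, and inspects the elements one by one in this order; on seeing an element it learns its value and must irrevocably accept or reject it. It must accept exactly $k$ elements (once $k$ are accepted it stops; if it has accepted $i$ elements and only $k-i$ remain, it must accept all of them). The algorithm has expected competitive ratio $\alpha$ if for every adversarial assignment the expected sum of accepted values is at least $\alpha$ times the sum of the $k$ largest values. A multiple-threshold algorithm partitions the positions of the order into consecutive phases; at the last position of each phase (a checkpoint) it computes a threshold from the values observed so far, and during the next phase it accepts elements whose value exceeds the current threshold (while fewer than $k$ elements have been accepted); "deterministic" means it uses no randomness besides the random order. The entropy of a distribution $p$ on $\Pi_n$ is $-\sum_{\pi} p(\pi)\log p(\pi)$ ($\log$ base $2$). For a multi-set $\mathcal{L}$ of permutations, choosing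 uniformly at random from $\mathcal{L}$ means each copy is chosen with probability $1/|\mathcal{L}|$.
   Formalization: Proved for k at least 2 (at k=1 the claimed ratio would be 1, which is impossible) and for non-negative values (with arbitrary real values the ratio claim fails); equal values are compared with ties broken by element label. *)

theory Defs
  imports "HOL-Probability.Probability" "HOL-Combinatorics.Multiset_Permutations"
begin

section \<open>The free order multiple-choice secretary problem\<close>

text \<open>
  An order of the elements \<open>1, \<dots>, n\<close> is a list in \<^term>\<open>permutations_of_set {1..n}\<close>; its entry
  with list index \<open>t\<close> is the element inspected in position \<open>t + 1\<close>. An assignment of values is
  a function \<open>v\<close> on labels, of which only the values on \<open>{1..n}\<close> matter.
\<close>

definition sum_k_largest :: "nat \<Rightarrow> nat \<Rightarrow> (nat \<Rightarrow> real) \<Rightarrow> real" where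
  "sum_k_largest n k v = sum_list (take k (rev (sort (map v [1..<n+1]))))"

text \<open>
  A partition of the positions \<open>1, \<dots>, n\<close> into consecutive phases is given by the set of the last
  positions of the phases.
\<close>

definition phase_ends :: "nat \<Rightarrow> nat set \<Rightarrow> bool" where
  "phase_ends n C \<longleftrightarrow> C \<subseteq> {1..n} \<and> n \<in> C"

text \<open>
  Distinct elements may have equal values, so values are compared with ties broken by the labels:
  a threshold is a real number together with a label, and the comparison is lexicographic. A
  threshold \<open>(\<tau>, i)\<close> with \<open>i \<ge> n\<close> is the plain threshold \<open>v e > \<tau>\<close>.
\<close>

type_synonym threshold = "real \<times> nat"

definition exceeds :: "(nat \<Rightarrow> real) \<Rightarrow> nat \<Rightarrow> threshold \<Rightarrow> bool" where
  "exceeds v e \<theta> \<longleftrightarrow> v e > fst \<theta> \<or> (v e = fst \<theta> \<and> e > snd \<theta>)"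

text \<open>
  The threshold rule \<open>thr\<close> maps what has been observed up to a checkpoint, i.e. the list of inspected
  elements with their values, to a threshold. In the first phase there is no threshold yet.
\<close>

type_synonym threshold_rule = "(nat \<times> real) list \<Rightarrow> threshold"

definition current_threshold ::
  "nat set \<Rightarrow> threshold_rule \<Rightarrow> (nat \<Rightarrow> real) \<Rightarrow> nat list \<Rightarrow> nat \<Rightarrow> threshold option" where
  "current_threshold C thr v ord t =
     (if {c \<in> C. c \<le> t} = {} then None
      else Some (thr (map (\<lambda>e. (e, v e)) (take (Max {c \<in> C. c \<le> t}) ord))))"

text \<open>
  The set of elements accepted among the first \<open>t\<close> inspected ones. When element \<open>ord ! t\<close> arrives,
  \<open>n - t\<close> elements remain (including it); it has to be accepted if all of them are needed in
  order to reach \<open>k\<close> accepted elements.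
\<close>

primrec accepted ::
  "nat \<Rightarrow> nat \<Rightarrow> nat set \<Rightarrow> threshold_rule \<Rightarrow> (nat \<Rightarrow> real) \<Rightarrow> nat list \<Rightarrow> nat \<Rightarrow> nat set" where
  "accepted n k C thr v ord 0 = {}"
| "accepted n k C thr v ord (Suc t) =
     (let A = accepted n k C thr v ord t; e = ord ! t in
      if card A < k \<and>
         (n - t \<le> k - card A \<or>
          (case current_threshold C thr v ord t of None \<Rightarrow> False | Some \<theta> \<Rightarrow> exceeds v e \<theta>))
      then insert e A else A)"

definition accepted_value ::
  "nat \<Rightarrow> nat \<Rightarrow> nat set \<Rightarrow> threshold_rule \<Rightarrow> (nat \<Rightarrow> real) \<Rightarrow> nat list \<Rightarrow> real" where
  "accepted_value n k C thr v ord = (\<Sum>e\<in>accepted n k C thr v ord n. v e)"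

text \<open>
  As usual for competitive ratios, the values are non-negative. The assignment \<open>v\<close> is chosen knowing
  the algorithm and the distribution \<open>p\<close> of the order, but not the order drawn.
\<close>

definition expected_ratio_at_least ::
  "nat \<Rightarrow> nat \<Rightarrow> nat set \<Rightarrow> threshold_rule \<Rightarrow> nat list pmf \<Rightarrow> real \<Rightarrow> bool" where
  "expected_ratio_at_least n k C thr p \<alpha> \<longleftrightarrow>
     (\<forall>v. (\<forall>e\<in>{1..n}. 0 \<le> v e) \<longrightarrow>
        measure_pmf.expectation p (accepted_value n k C thr v) \<ge> \<alpha> * sum_k_largest n k v)"

text \<open>
  Since \<^term>\<open>log 2 0 = 0\<close>, permutations of probability \<open>0\<close> contribute \<open>0\<close>.
\<close>

definition order_entropy :: "nat \<Rightarrow> nat list pmf \<Rightarrow> real" where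
  "order_entropy n p = - (\<Sum>ord\<in>permutations_of_set {1..n}. pmf p ord * log 2 (pmf p ord))"


section \<open>Deterministic running time\<close>

text \<open>
  Structured programs for a unit-cost random access machine. The memory consists of arrays of natural
  numbers, indexed by natural numbers and of unbounded length; a program uses only the finitely many
  arrays that it names, and a scalar variable is a cell with a constant index. The arithmetic
  operations are addition and truncated subtraction only, so that in \<open>T\<close> steps a fixed program
  produces numbers of bit length linear in \<open>T\<close> and in the input length, and polynomial time is the
  same as on Turing machines. There is a write-only output tape.
\<close>

datatype aexp =
    Num nat
  | Cell nat aexp  \<comment> \<open>array, index\<close>
  | Plus aexp aexp
  | Minus aexp aexp

datatype com =
    Assign nat aexp aexp  \<comment> \<open>array, index, new contents\<close>
  | Write aexp
  | Seq com com
  | Cond aexp com com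
  | Loop aexp com

type_synonym memory = "nat \<Rightarrow> nat \<Rightarrow> nat"

primrec aval :: "aexp \<Rightarrow> memory \<Rightarrow> nat" where
  "aval (Num c) m = c"
| "aval (Cell a i) m = m a (aval i m)"
| "aval (Plus x y) m = aval x m + aval y m"
| "aval (Minus x y) m = aval x m - aval y m"

text \<open>
  \<open>exec c (m, out) T (m', out')\<close>: started with memory \<open>m\<close> and output tape \<open>out\<close>, the program \<open>c\<close> halts
  after exactly \<open>T\<close> steps with memory \<open>m'\<close> and output tape \<open>out'\<close>. Each assignment, write and test is
  one step, which is accurate up to a constant factor that depends on the program. A test succeeds if
  the expression is non-zero.
\<close>

inductive exec :: "com \<Rightarrow> memory \<times> nat list \<Rightarrow> nat \<Rightarrow> memory \<times> nat list \<Rightarrow> bool" where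
  Assign: "exec (Assign a i x) (m, out) 1 (m(a := (m a)(aval i m := aval x m)), out)"
| Write: "exec (Write x) (m, out) 1 (m, out @ [aval x m])"
| Seq: "exec c1 s T1 s' \<Longrightarrow> exec c2 s' T2 s'' \<Longrightarrow> exec (Seq c1 c2) s (T1 + T2) s''"
| CondTrue: "aval b (fst s) \<noteq> 0 \<Longrightarrow> exec c1 s T s' \<Longrightarrow> exec (Cond b c1 c2) s (Suc T) s'"
| CondFalse: "aval b (fst s) = 0 \<Longrightarrow> exec c2 s T s' \<Longrightarrow> exec (Cond b c1 c2) s (Suc T) s'"
| LoopTrue: "aval b (fst s) \<noteq> 0 \<Longrightarrow> exec c s T1 s' \<Longrightarrow> exec (Loop b c) s' T2 s''
    \<Longrightarrow> exec (Loop b c) s (Suc (T1 + T2)) s''"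
| LoopFalse: "aval b (fst s) = 0 \<Longrightarrow> exec (Loop b c) s 1 s"

text \<open>The input is stored at the beginning of array \<open>0\<close>; all other cells are initially \<open>0\<close>.\<close>

definition input_memory :: "nat list \<Rightarrow> memory" where
  "input_memory xs = (\<lambda>a i. if a = 0 \<and> i < length xs then xs ! i else 0)"

definition computes_within :: "com \<Rightarrow> nat list \<Rightarrow> nat list \<Rightarrow> nat \<Rightarrow> bool" where
  "computes_within c xs ys bound \<longleftrightarrow>
     (\<exists>T m. T \<le> bound \<and> exec c (input_memory xs, []) T (m, ys))"

text \<open>
  A multiset of orders is output by writing its members one after another, in some sequence. As all of
  them have length \<open>n\<close>, the concatenation determines the multiset.
\<close>

definition computes_orders_within :: "com \<Rightarrow> nat list \<Rightarrow> nat list multiset \<Rightarrow> nat \<Rightarrow> bool" where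
  "computes_orders_within c xs L bound \<longleftrightarrow>
     (\<exists>ords. mset ords = L \<and> computes_within c xs (concat ords) bound)"

end

theory Submission
  imports Defs "HOL-Computational_Algebra.Computational_Algebra"
begin

text \<open>
  Every element gets a key in \<open>{0..<p}\<close>, where \<open>p\<close> is a prime that is polynomial in \<open>log n\<close>, and
  the elements are inspected by increasing keys. The bits of an element are the coefficients of a
  polynomial, which is evaluated at a random point; the elements of the \<open>k\<^sup>2\<close> largest values are then
  separated with high probability. A random polynomial of degree less than \<open>6\<close> turns the hash values
  into \<open>6\<close>-wise independent ones. Counters, one per hash value, make the keys of all elements almost
  equidistributed, so that the position of an element determines its key up to an error of one and the
  thresholds do not depend on the seed. The seed consists of \<open>7\<close> residues modulo \<open>p\<close>, whence the
  entropy \<open>O(log log n)\<close>.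

  After a fraction \<open>t\<close> of the elements, the algorithm accepts an element that is among the
  \<open>k t - sqrt (k t log k)\<close> largest ones seen so far. An element among the \<open>k\<close> largest ones is rejected
  only if it comes in the initial phase, if it does not pass the threshold, or if \<open>k\<close> elements have been
  accepted before. The second event is controlled by second and fourth moments, and the third one by the
  expected number of accepted elements of rank at least \<open>k\<close>. The resulting bound is strong enough for
  \<open>k \<ge> 109\<close>; for smaller \<open>k\<close> the claimed ratio is not positive.
\<close>

section \<open>Primes between \<open>N\<close> and \<open>N\<^sup>2\<close>\<close>

text \<open>At k = 109 the claimed ratio is barely positive, so every estimate has to come with a
  good constant. The number 6 arises as 2 + 4: to bound the acceptances of elements outside the k
  best, the keys of two elements are prescribed, and a fourth moment of the others is taken. A
  variance bound would not do there, since it decays only like 1/g in the distance g of the rank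
  from k, which is not summable. A threshold rule sees positions, while independence is a statement
  about keys. The counters bridge the two at no cost: a counter depends on the hash alone, and
  adding a constant permutes the residues. With l the bit length of n, at most k^4 l of the p hash
  points produce a collision among the k^2 largest elements. Since k <= l and l^8 < p, this fraction
  is less than the 1/(8k) that the loss estimate leaves spare. For the entropy any polynomial upper
  bound on p is good enough, so a weak substitute for Bertrand's postulate suffices.\<close>

lemma mult_binomial_dvd_Lcm:
  assumes "1 \<le> k" "k \<le> n"
  shows "k * (n choose k) dvd Lcm {1..n}"
  using assms
proof (induction k arbitrary: n rule: dec_induct)
  case base
  then show ?case by (auto intro!: dvd_Lcm)
next
  case (step k n')
  then obtain n where n': "n' = Suc n" by (cases n') auto
  have kn: "1 \<le> k" "k \<le> n" using step n' by simp_all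
  define D where "D = Lcm {1..n'}"
  have "k * (n' choose k) dvd D" unfolding D_def by (rule step.IH) (use kn n' in simp)
  then obtain u where u: "D = k * (n' choose k) * u" by (rule dvdE)
  have "k * (n choose k) dvd Lcm {1..n}" by (rule step.IH) (use kn in simp)
  also have "\<dots> dvd D" unfolding D_def n' by (rule Lcm_subset) auto
  finally obtain w where w: "D = k * (n choose k) * w" by (rule dvdE)
  define c where "c = n choose k"
  define b where "b = n' choose k"
  have a: "Suc k * (n' choose Suc k) = n' * c"
    unfolding n' c_def by (rule Suc_times_binomial)
  have "(n' - k) * b = n' * c"
    using binomial_absorb_comp[of n' k] unfolding n' c_def b_def by (simp only: diff_Suc_1)
  hence B: "int (n' - k) * int b = int n' * int c" by (simp only: flip: of_nat_mult)
  have bu: "int b * int u = int c * int w"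
    using u w kn unfolding b_def[symmetric] c_def[symmetric]
    by (metis mult.assoc mult_cancel1 not_one_le_zero of_nat_mult)
  have "int c * (int w * int (n' - k)) = int (n' - k) * int b * int u"
    using bu by (simp add: mult.commute mult.left_commute)
  also have "\<dots> = int c * (int n' * int u)" unfolding B by simp
  finally have "int w * int (n' - k) = int n' * int u"
    using kn unfolding c_def by simp
  \<comment> \<open>Behind this is the recurrence of the Leibniz harmonic triangle, 1/((k+1)
    C(n+1,k+1)) = 1/(k C(n,k)) - 1/(k C(n+1,k)), so the cofactor sought is \<open>w - u\<close>. The
    integers keep this difference from being truncated.\<close>
  hence *: "int n' * (int w - int u) = int k * int w"
    using kn n' by (simp add: algebra_simps of_nat_diff)
  have "int (Suc k * (n' choose Suc k)) * (int w - int u) = int c * (int n' * (int w - int u))"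
    unfolding a by simp
  also have "\<dots> = int D" unfolding * w c_def by simp
  finally have "int (Suc k * (n' choose Suc k)) dvd int D" by (metis dvd_triv_left)
  thus ?case unfolding D_def by (simp only: int_dvd_int_iff)
qed

text \<open>The lcm is a product of one prime power per prime. Each of these is at most
  \<open>X\<close>, and the hypothesis leaves at most \<open>N\<close> primes.\<close>

lemma Lcm_atLeastAtMost_le:
  assumes "\<And>p. prime p \<Longrightarrow> p \<le> X \<Longrightarrow> p \<le> N" and "1 \<le> X"
  shows "Lcm {1..X} \<le> (X::nat) ^ N"
proof -
  define P where "P = {p. prime p \<and> p \<le> X}"
  define e where "e p = Max {e. p ^ e \<le> X}" for p
  have fin: "finite {e. p ^ e \<le> X}" if "p \<in> P" for p
  proof -
    have "2 \<le> p" using that by (auto simp: P_def prime_ge_2_nat)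
    have "e \<le> X" if "p ^ e \<le> X" for e
    proof -
      have "e < 2 ^ e" by simp
      also have "(2::nat) ^ e \<le> p ^ e" using \<open>2 \<le> p\<close> by (rule power_mono) simp
      finally show ?thesis using that by simp
    qed
    hence "{e. p ^ e \<le> X} \<subseteq> {..X}" by blast
    thus ?thesis by (rule finite_subset) simp
  qed
  have e: "p ^ e p \<le> X" if "p \<in> P" for p
  proof -
    have "0 \<in> {e. p ^ e \<le> X}" using assms(2) by simp
    hence "e p \<in> {e. p ^ e \<le> X}" unfolding e_def by (intro Max_in[OF fin[OF that]]) blast
    thus ?thesis by simp
  qed
  have finP: "finite P" unfolding P_def by simp
  have "Lcm {1..X} dvd (\<Prod>p\<in>P. p ^ e p)"
  proof (rule Lcm_least)
    fix j assume j: "j \<in> {1..X}"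
    have "j = (\<Prod>p\<in>prime_factors j. p ^ multiplicity p j)"
      using j by (intro prime_factorization_nat) auto
    also have "\<dots> dvd (\<Prod>p\<in>P. p ^ e p)"
    proof (rule prod_dvd_prod_subset2[OF finP])
      show sub: "prime_factors j \<subseteq> P"
      proof
        fix x assume "x \<in> prime_factors j"
        hence "prime x" "x dvd j" by (simp_all add: in_prime_factors_iff)
        moreover from this j have "x \<le> j" by (intro dvd_imp_le) simp_all
        ultimately show "x \<in> P" using j unfolding P_def by simp
      qed
      fix p assume p: "p \<in> prime_factors j"
      have "p ^ multiplicity p j dvd j" by (rule multiplicity_dvd)
      hence "p ^ multiplicity p j \<le> j" using j by (intro dvd_imp_le) simp_all
      hence "p ^ multiplicity p j \<le> X" using j by simp
      hence "multiplicity p j \<le> e p" unfolding e_def using fin sub p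
        by (intro Max_ge) blast+
      thus "p ^ multiplicity p j dvd p ^ e p" by (rule le_imp_power_dvd)
    qed
    finally show "j dvd (\<Prod>p\<in>P. p ^ e p)" .
  qed
  moreover have "(\<Prod>p\<in>P. p ^ e p) > 0"
    by (intro prod_pos) (auto simp: P_def prime_gt_0_nat)
  ultimately have "Lcm {1..X} \<le> (\<Prod>p\<in>P. p ^ e p)" by (rule dvd_imp_le)
  also have "\<dots> \<le> (\<Prod>p\<in>P. X)" by (intro prod_mono) (use e in auto)
  also have "\<dots> = X ^ card P" by simp
  also have "\<dots> \<le> X ^ N"
  proof (rule power_increasing[OF _ assms(2)])
    have "P \<subseteq> {1..N}" 
    proof
      fix p assume "p \<in> P"
      hence "prime p" "p \<le> X" by (simp_all add: P_def)
      thus "p \<in> {1..N}" using assms(1)[of p] prime_ge_1_nat[of p] by simp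
    qed
    from card_mono[OF _ this] show "card P \<le> N" by simp
  qed
  finally show ?thesis .
qed

lemma square_le_two_power: "6 \<le> n \<Longrightarrow> Suc n ^ 2 \<le> (2::nat) ^ n"
proof (induction n rule: dec_induct)
  case base
  show ?case by simp
next
  case (step n)
  have "6 * n \<le> n * n" using step(1) by (rule mult_right_mono) simp
  hence "2 \<le> n * n" using step(1) by linarith
  hence "Suc (Suc n) ^ 2 \<le> 2 * Suc n ^ 2" by (simp add: power2_eq_square)
  also have "\<dots> \<le> 2 * 2 ^ n" using step.IH by simp
  finally show ?case by simp
qed

text \<open>Nair's argument: \<open>4 ^ m\<close> is at most 2m C(2m,m), and m C(2m,m) divides the
  lcm of the numbers up to 2m. Without primes between N and N^2 that lcm would be at most (2m)^N,
  which is too small for 2m close to N^2.\<close>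

lemma prime_between_square:
  assumes "7 \<le> N"
  shows "\<exists>p::nat. prime p \<and> N < p \<and> p \<le> N ^ 2"
proof (rule ccontr)
  assume no: "\<not> ?thesis"
  define m where "m = N ^ 2 div 2"
  have N2: "N ^ 2 \<ge> 49" using power_mono[OF assms, of 2] by simp
  hence m: "m \<ge> 1" "2 * m \<le> N ^ 2" "N ^ 2 \<le> 2 * m + 1" by (auto simp: m_def)
  have "(4::real) ^ m \<le> 2 * real m * real ((2 * m) choose m)"
    using central_binomial_lower_bound[of m] m by (simp add: field_simps)
  hence "real (4 ^ m) \<le> real (2 * (m * ((2 * m) choose m)))" by simp
  hence "4 ^ m \<le> 2 * (m * ((2 * m) choose m))" by (simp only: of_nat_le_iff)
  also have "m * ((2 * m) choose m) \<le> Lcm {1..2 * m}"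
    using m by (intro dvd_imp_le mult_binomial_dvd_Lcm) (auto intro!: Nat.gr0I)
  also have "Lcm {1..2 * m} \<le> (2 * m) ^ N"
    using no m by (intro Lcm_atLeastAtMost_le) (auto simp: not_less)
  \<comment> \<open>Because 2m <= N^2 <= 2^(N-1), both sides become powers of two. Comparing
    exponents gives N^2 - 1 <= 2m <= 1 + (N-1) N, which is false for N > 2.\<close>
  also have "(2 * m) ^ N \<le> (2 ^ (N - 1)) ^ N"
  proof (rule power_mono)
    have "Suc (N - 1) ^ 2 \<le> 2 ^ (N - 1)" by (rule square_le_two_power) (use assms in simp)
    moreover have "Suc (N - 1) = N" using assms by simp
    ultimately show "2 * m \<le> 2 ^ (N - 1)" using m(2) by simp
  qed simp
  finally have "(4::nat) ^ m \<le> 2 * (2 ^ (N - 1)) ^ N" by simp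
  moreover have "(4::nat) ^ m = 2 ^ (2 * m)" by (simp only: power_mult) simp
  moreover have "2 * (2 ^ (N - 1)) ^ N = (2::nat) ^ Suc ((N - 1) * N)"
    by (simp only: power_mult power_Suc)
  ultimately have "(2::nat) ^ (2 * m) \<le> 2 ^ Suc ((N - 1) * N)" by (simp only:)
  hence "2 * m \<le> Suc ((N - 1) * N)" by (rule power_le_imp_le_exp[of 2, rotated]) simp
  moreover have "(N - 1) * N + N = N ^ 2" using assms
    by (simp add: power2_eq_square algebra_simps)
  ultimately show False using m assms by linarith
qed

section \<open>Polynomial hashing modulo a prime\<close>

text \<open>The factor theorem modulo a prime, carried out over the integers: q(x) - q(r) = (x - r)
  s(x), and p does not divide the difference of two distinct residues, so s keeps all roots except
  r. The coefficients of q are then combinations of those of s and q(r).\<close>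

lemma prime_dvd_coeff_of_many_roots:
  fixes q :: "int poly" and p :: int
  assumes "prime p" "degree q < m" "R \<subseteq> {0..<p}" "m \<le> card R"
    and "\<And>x. x \<in> R \<Longrightarrow> p dvd poly q x"
  shows "p dvd coeff q j"
  using assms(2-)
proof (induction m arbitrary: q R j)
  case 0
  then show ?case by simp
next
  case (Suc m)
  have finR: "finite R" using Suc.prems(2) by (rule finite_subset) simp
  obtain r where r: "r \<in> R" using Suc.prems(3) by fastforce
  show ?case
  proof (cases "degree q = 0")
    case True
    then obtain c where q: "q = [:c:]" by (rule degree_eq_zeroE)
    have "p dvd c" using Suc.prems(4)[OF r] q by simp
    thus ?thesis unfolding q by (cases j) simp_all
  next
    case False
    define s where "s = synthetic_div q r"
    have eq: "q + smult r s = pCons (poly q r) s"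
      unfolding s_def by (rule synthetic_div_correct)
    have deg: "degree s < m" using False Suc.prems(1) unfolding s_def by (simp add: degree_synthetic_div)
    have "p dvd coeff s i" for i
    proof (rule Suc.IH[of s "R - {r}"])
      show "m \<le> card (R - {r})" using Suc.prems(3) finR r by simp
      fix x assume x: "x \<in> R - {r}"
      have "poly q x + r * poly s x = poly q r + x * poly s x"
        using arg_cong[OF eq, of "\<lambda>f. poly f x"] by simp
      hence "(x - r) * poly s x = poly q x - poly q r" by (simp add: algebra_simps)
      moreover have "p dvd poly q x - poly q r" using Suc.prems(4) x r by (intro dvd_diff) auto
      ultimately have "p dvd (x - r) * poly s x" by simp
      hence "p dvd x - r \<or> p dvd poly s x" using assms(1) by (simp add: prime_dvd_mult_iff)
      moreover have "\<not> p dvd x - r"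
      proof
        assume "p dvd x - r"
        hence "\<bar>p\<bar> \<le> \<bar>x - r\<bar>" by (rule dvd_imp_le_int[rotated]) (use x in simp)
        moreover have "x \<in> {0..<p}" "r \<in> {0..<p}" using x r Suc.prems(2) by blast+
        ultimately show False unfolding atLeastLessThan_iff by linarith
      qed
      ultimately show "p dvd poly s x" by simp
    qed (use deg Suc.prems(2) in auto)
    moreover have "coeff q j = coeff (pCons (poly q r) s) j - r * coeff s j"
      using arg_cong[OF eq, of "\<lambda>f. coeff f j"] by simp
    moreover have "p dvd coeff (pCons (poly q r) s) j"
      using calculation(1) Suc.prems(4)[OF r] by (cases j) auto
    ultimately show ?thesis by (auto intro!: dvd_diff)
  qed
qed

lemma prime_dvd_of_many_roots:
  fixes f :: "nat \<Rightarrow> int"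
  assumes "prime p" "R \<subseteq> {..<p}" "w \<le> card R" "j < w"
    and "\<And>x. x \<in> R \<Longrightarrow> int p dvd (\<Sum>j<w. f j * int x ^ j)"
  shows "int p dvd f j"
proof -
  define q where "q = (\<Sum>j<w. monom (f j) j)"
  have "degree (monom (f i) i) \<le> w - 1" if "i < w" for i
  proof -
    have "degree (monom (f i) i) \<le> i" by (rule degree_monom_le)
    thus ?thesis using that by linarith
  qed
  hence "degree q \<le> w - 1" unfolding q_def by (intro degree_sum_le) simp_all
  hence "degree q < w" using assms(4) by simp
  moreover have ev: "poly q x = (\<Sum>j<w. f j * x ^ j)" for x
    unfolding q_def by (simp add: poly_sum poly_monom)
  ultimately have "int p dvd coeff q j"
  proof (intro prime_dvd_coeff_of_many_roots[of "int p" q w "int ` R"])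
    show "w \<le> card (int ` R)" using assms(3) by (simp add: card_image)
    show "int ` R \<subseteq> {0..<int p}" using assms(2) by fastforce
    fix x assume "x \<in> int ` R"
    thus "int p dvd poly q x" unfolding ev using assms(5) by blast
  qed (use assms(1) in simp_all)
  moreover have "coeff q j = f j" using assms(4) unfolding q_def by (simp add: coeff_sum)
  ultimately show ?thesis by simp
qed

lemma int_dvd_diff_small_eq:
  assumes "int p dvd int a - int b" "a < p" "b < p"
  shows "a = b"
proof -
  have "int a mod int p = int b mod int p" using assms(1) by (simp add: mod_eq_dvd_iff)
  thus ?thesis using assms by simp
qed

definition peval :: "nat \<Rightarrow> (nat \<Rightarrow> nat) \<Rightarrow> nat \<Rightarrow> nat" where
  "peval w a h = (\<Sum>j<w. a j * h ^ j)"

text \<open>The default value 0 outside the index range makes the set finite and agrees with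
  untouched memory cells, so a seed can be read off directly from an array of the machine.\<close>

abbreviation coefs :: "nat \<Rightarrow> nat \<Rightarrow> (nat \<Rightarrow> nat) set" where
  "coefs p w \<equiv> PiE_dflt {..<w} 0 (\<lambda>_. {..<p})"

lemma finite_coefs: "finite (coefs p w)" by (intro finite_PiE_dflt) auto

lemma card_coefs: "card (coefs p w) = p ^ w" by (subst card_PiE_dflt) auto

text \<open>Interpolation by counting: polynomials of degree below w that agree modulo p at w points
  coincide, and both sides have \<open>p ^ w\<close> elements.\<close>

lemma bij_betw_peval:
  assumes p: "prime p" and Y: "Y \<subseteq> {..<p}" "card Y = w"
  shows "bij_betw (\<lambda>a. \<lambda>y\<in>Y. peval w a y mod p) (coefs p w) (Y \<rightarrow>\<^sub>E {..<p})"
proof -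
  have finY: "finite Y" using Y(1) by (rule finite_subset) simp
  let ?F = "\<lambda>a. \<lambda>y\<in>Y. peval w a y mod p"
  have inj: "inj_on ?F (coefs p w)"
  proof (rule inj_onI)
    fix a b assume ab: "a \<in> coefs p w" "b \<in> coefs p w" "?F a = ?F b"
    have dvd: "int p dvd int (a j) - int (b j)" if "j < w" for j
    proof (rule prime_dvd_of_many_roots[OF p Y(1) _ that])
      fix y assume y: "y \<in> Y"
      have "peval w a y mod p = peval w b y mod p"
        using fun_cong[OF ab(3), of y] y by simp
      hence "int (peval w a y) mod int p = int (peval w b y) mod int p" by (metis zmod_int)
      hence "int p dvd int (peval w a y) - int (peval w b y)" by (simp add: mod_eq_dvd_iff)
      also have "int (peval w a y) - int (peval w b y) = (\<Sum>j<w. (int (a j) - int (b j)) * int y ^ j)"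
        by (simp add: peval_def sum_subtractf left_diff_distrib)
      finally show "int p dvd \<dots>" .
    qed (use Y in simp)
    show "a = b"
    proof
      fix j
      show "a j = b j"
      proof (cases "j < w")
        case True
        with ab dvd[OF True] show ?thesis
          by (intro int_dvd_diff_small_eq) (auto simp: PiE_dflt_def)
      next
        case False
        with ab show ?thesis by (simp add: PiE_dflt_def)
      qed
    qed
  qed
  have "p > 0" using p by (rule prime_gt_0_nat)
  hence "?F ` coefs p w \<subseteq> (Y \<rightarrow>\<^sub>E {..<p})" by auto
  moreover have "card (?F ` coefs p w) = card (Y \<rightarrow>\<^sub>E {..<p})"
    using inj Y finY by (simp add: card_image card_coefs card_PiE)
  ultimately have "?F ` coefs p w = (Y \<rightarrow>\<^sub>E {..<p})"
    by (intro card_subset_eq) (auto intro!: finite_PiE finY)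
  thus ?thesis using inj by (simp add: bij_betw_def)
qed

text \<open>This is w-wise independence of the values of a random polynomial, multiplied out to an
  equation of naturals. \<open>Y\<close> is padded to exactly w points, the new ones being
  unconstrained, and the bijection of \<open>bij_betw_peval\<close> turns the count into the size of
  a product set.\<close>

lemma card_peval_in:
  assumes p: "prime p" and Y: "Y \<subseteq> {..<p}" "card Y \<le> w" and w: "w \<le> p"
    and S: "\<And>y. y \<in> Y \<Longrightarrow> S y \<subseteq> {..<p}"
  shows "card {a \<in> coefs p w. \<forall>y\<in>Y. peval w a y mod p \<in> S y} * p ^ card Y
       = p ^ w * (\<Prod>y\<in>Y. card (S y))"
proof -
  obtain Y' where Y': "Y \<subseteq> Y'" "Y' \<subseteq> {..<p}" "card Y' = w"
    using exists_subset_between[of Y w "{..<p}"] Y w by auto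
  have finY': "finite Y'" using Y'(2) by (rule finite_subset) simp
  define S' where "S' y = (if y \<in> Y then S y else {..<p})" for y
  let ?F = "\<lambda>a. \<lambda>y\<in>Y'. peval w a y mod p"
  let ?A = "{a \<in> coefs p w. \<forall>y\<in>Y. peval w a y mod p \<in> S y}"
  have bij: "bij_betw ?F (coefs p w) (Y' \<rightarrow>\<^sub>E {..<p})" by (rule bij_betw_peval[OF p Y'(2,3)])
  have p0: "p > 0" using p by (rule prime_gt_0_nat)
  have "?F ` ?A = (\<Pi>\<^sub>E y\<in>Y'. S' y)"
  proof (intro equalityI subsetI)
    fix g assume "g \<in> ?F ` ?A"
    thus "g \<in> (\<Pi>\<^sub>E y\<in>Y'. S' y)" using p0 by (auto simp: S'_def)
  next
    fix g assume g: "g \<in> (\<Pi>\<^sub>E y\<in>Y'. S' y)"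
    have "S' y \<subseteq> {..<p}" for y using S by (auto simp: S'_def)
    hence "g \<in> (Y' \<rightarrow>\<^sub>E {..<p})" using g by (meson PiE_mono subsetD)
    then obtain a where a: "a \<in> coefs p w" "g = ?F a"
      using bij unfolding bij_betw_def by blast
    have "peval w a y mod p \<in> S y" if "y \<in> Y" for y
    proof -
      have "g y \<in> S' y" using g that Y'(1) by (auto simp: PiE_def Pi_def)
      thus ?thesis using a(2) that Y'(1) by (auto simp: S'_def)
    qed
    thus "g \<in> ?F ` ?A" using a by blast
  qed
  moreover have "inj_on ?F ?A"
    by (rule inj_on_subset[OF bij_betw_imp_inj_on[OF bij]]) blast
  from card_image[OF this] have "card (?F ` ?A) = card ?A" .
  ultimately have "card ?A = card (\<Pi>\<^sub>E y\<in>Y'. S' y)" by (simp only:)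
  also have "\<dots> = (\<Prod>y\<in>Y'. card (S' y))" using finY' by (rule card_PiE)
  also have "\<dots> = (\<Prod>y\<in>Y. card (S' y)) * (\<Prod>y\<in>Y' - Y. card (S' y))"
    using prod.subset_diff[OF Y'(1) finY', of "\<lambda>y. card (S' y)"] by (simp add: mult.commute)
  also have "(\<Prod>y\<in>Y. card (S' y)) = (\<Prod>y\<in>Y. card (S y))" by (simp add: S'_def)
  also have "(\<Prod>y\<in>Y' - Y. card (S' y)) = p ^ (w - card Y)"
    using Y' finY' by (simp add: S'_def card_Diff_subset finite_subset)
  finally have "card ?A * p ^ card Y = (\<Prod>y\<in>Y. card (S y)) * (p ^ (w - card Y) * p ^ card Y)"
    by simp
  also have "p ^ (w - card Y) * p ^ card Y = p ^ w" using Y(2) by (simp flip: power_add)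
  finally show ?thesis by simp
qed

text \<open>Horner's rule applied to the binary digits of the label. The recursion fixes no digit
  length, and read upwards it fills a table of all labels with one multiplication for every two
  entries.\<close>

fun bit_hash :: "nat \<Rightarrow> nat \<Rightarrow> nat \<Rightarrow> nat" where
  "bit_hash p c x = (if x = 0 then 0 else (c * bit_hash p c (x div 2) + x mod 2) mod p)"

declare bit_hash.simps[simp del]

lemma bit_hash_eq:
  "x < 2 ^ L \<Longrightarrow> bit_hash p c x = (\<Sum>j<L. (x div 2 ^ j mod 2) * c ^ j) mod p"
proof (induction L arbitrary: x)
  case 0
  thus ?case by (simp add: bit_hash.simps)
next
  case (Suc L)
  show ?case
  proof (cases "x = 0")
    case True
    thus ?thesis by (simp add: bit_hash.simps)
  next
    case False
    have "x div 2 < 2 ^ L" using Suc.prems by auto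
    note IH = Suc.IH[OF this]
    have "(\<Sum>j<Suc L. (x div 2 ^ j mod 2) * c ^ j)
      = x mod 2 + (\<Sum>j<L. (x div 2 ^ Suc j mod 2) * c ^ Suc j)"
      by (subst sum.lessThan_Suc_shift) simp
    also have "(\<Sum>j<L. (x div 2 ^ Suc j mod 2) * c ^ Suc j)
      = c * (\<Sum>j<L. (x div 2 div 2 ^ j mod 2) * c ^ j)"
      by (simp add: sum_distrib_left div_mult2_eq mult_ac)
    finally have "(\<Sum>j<Suc L. (x div 2 ^ j mod 2) * c ^ j) mod p
      = (c * (\<Sum>j<L. (x div 2 div 2 ^ j mod 2) * c ^ j) + x mod 2) mod p"
      by (simp add: add.commute)
    also have "\<dots> = (c * bit_hash p c (x div 2) + x mod 2) mod p"
      unfolding IH by (intro mod_add_cong refl mod_mult_right_eq[symmetric])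
    finally show ?thesis using False by (subst bit_hash.simps) simp
  qed
qed

lemma eq_of_bits_eq:
  "x < 2 ^ L \<Longrightarrow> y < 2 ^ L \<Longrightarrow> (\<And>j. j < L \<Longrightarrow> x div 2 ^ j mod 2 = y div 2 ^ j mod (2::nat)) \<Longrightarrow> x = y"
proof (induction L arbitrary: x y)
  case (Suc L)
  have "x div 2 = y div 2"
  proof (rule Suc.IH)
    fix j assume "j < L"
    with Suc.prems(3)[of "Suc j"] show "x div 2 div 2 ^ j mod 2 = y div 2 div 2 ^ j mod 2"
      by (simp add: div_mult2_eq)
  qed (use Suc.prems in auto)
  moreover have "x mod 2 = y mod 2" using Suc.prems(3)[of 0] by simp
  ultimately show ?case by (metis div_mod_decomp)
qed simp

text \<open>Collisions at L points are L roots of a difference polynomial of degree below L. Its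
  coefficients are differences of bits, so if p divides them they vanish and the two labels are
  equal.\<close>

lemma card_bit_hash_collisions:
  assumes p: "prime p" and "x < 2 ^ L" "y < 2 ^ L" "x \<noteq> y"
  shows "card {c \<in> {..<p}. bit_hash p c x = bit_hash p c y} \<le> L"
proof (rule ccontr)
  let ?R = "{c \<in> {..<p}. bit_hash p c x = bit_hash p c y}"
  assume "\<not> ?thesis"
  hence R: "L \<le> card ?R" by simp
  let ?f = "\<lambda>j. int (x div 2 ^ j mod 2) - int (y div 2 ^ j mod 2)"
  have "x = y"
  proof (rule eq_of_bits_eq[OF assms(2,3)])
    fix j assume j: "j < L"
    have "int p dvd ?f j"
    proof (rule prime_dvd_of_many_roots[OF p _ R j])
      fix c assume "c \<in> ?R"
      hence "(\<Sum>j<L. (x div 2 ^ j mod 2) * c ^ j) mod p = (\<Sum>j<L. (y div 2 ^ j mod 2) * c ^ j) mod p"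
        by (simp add: bit_hash_eq[OF assms(2)] bit_hash_eq[OF assms(3)])
      hence "int (\<Sum>j<L. (x div 2 ^ j mod 2) * c ^ j) mod int p
        = int (\<Sum>j<L. (y div 2 ^ j mod 2) * c ^ j) mod int p" by (metis zmod_int)
      hence "int p dvd int (\<Sum>j<L. (x div 2 ^ j mod 2) * c ^ j) - int (\<Sum>j<L. (y div 2 ^ j mod 2) * c ^ j)"
        by (simp add: mod_eq_dvd_iff)
      also have "int (\<Sum>j<L. (x div 2 ^ j mod 2) * c ^ j) - int (\<Sum>j<L. (y div 2 ^ j mod 2) * c ^ j)
        = (\<Sum>j<L. ?f j * int c ^ j)"
        by (simp only: of_nat_sum of_nat_mult of_nat_power left_diff_distrib sum_subtractf)
      finally show "int p dvd (\<Sum>j<L. ?f j * int c ^ j)" .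
    qed auto
    moreover have less: "z mod 2 < p" for z :: nat
    proof -
      have "z mod 2 < 2" by simp
      thus ?thesis using prime_ge_2_nat[OF p] by linarith
    qed
    ultimately show "x div 2 ^ j mod 2 = y div 2 ^ j mod 2"
      by (intro int_dvd_diff_small_eq less)
  qed
  thus False using assms(4) by simp
qed

lemma bit_hash_less: "p > 0 \<Longrightarrow> bit_hash p c x < p"
  by (subst bit_hash.simps) simp

section \<open>Moments from limited independence\<close>

lemma binomial_real_absorb:
  "real (n choose r) * real n = real r * real (n choose r) + real (Suc r) * real (n choose Suc r)"
  using gbinomial_mult_1[of "real n" r] by (simp add: binomial_gbinomial mult.commute)

lemma binomial_real_1: "real (n choose 1) = real n" by simp

lemma binomial_real_2: "real (n choose 2) = real n * (real n - 1) / 2"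
  using binomial_real_absorb[of n 1] by (simp add: numeral_2_eq_2 algebra_simps)

lemma binomial_real_3: "real (n choose 3) = real n * (real n - 1) * (real n - 2) / 6"
proof -
  have "Suc 2 = 3" by simp
  thus ?thesis using binomial_real_absorb[of n 2] unfolding binomial_real_2
    by (simp add: field_simps)
qed

lemma binomial_real_4: "real (n choose 4) = real n * (real n - 1) * (real n - 2) * (real n - 3) / 24"
proof -
  have "Suc 3 = 4" by simp
  thus ?thesis using binomial_real_absorb[of n 3] unfolding binomial_real_3
    by (simp add: field_simps)
qed

text \<open>The binomial coefficient counts the r-subsets of \<open>D\<close> all of whose members
  have the property; exchanging the sums leaves joint events of r elements. The weights are not
  normalised: they will encode that some keys have prescribed values, so that no conditional
  probabilities have to be formed.\<close>

lemma weighted_factorial_moment: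
  fixes W :: "'w \<Rightarrow> real"
  assumes fin: "finite \<Omega>" "finite D"
    and ind: "\<And>R. R \<subseteq> D \<Longrightarrow> card R \<le> b \<Longrightarrow> (\<Sum>\<omega> | \<omega> \<in> \<Omega> \<and> (\<forall>z\<in>R. A z \<omega>). W \<omega>) = w * \<theta> ^ card R"
    and r: "r \<le> b"
  shows "(\<Sum>\<omega>\<in>\<Omega>. W \<omega> * real (card {z \<in> D. A z \<omega>} choose r)) = w * \<theta> ^ r * real (card D choose r)"
proof -
  let ?S = "{R. R \<subseteq> D \<and> card R = r}"
  have finS: "finite ?S" using fin(2) by auto
  have "real (card {z \<in> D. A z \<omega>} choose r) = (\<Sum>R\<in>?S. if \<forall>z\<in>R. A z \<omega> then 1 else 0)" for \<omega>
  proof -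
    have "card {z \<in> D. A z \<omega>} choose r = card {R. R \<subseteq> {z \<in> D. A z \<omega>} \<and> card R = r}"
      using fin(2) by (simp add: n_subsets)
    also have "{R. R \<subseteq> {z \<in> D. A z \<omega>} \<and> card R = r} = {R \<in> ?S. \<forall>z\<in>R. A z \<omega>}" by auto
    finally show ?thesis using finS by (simp add: sum.If_cases Int_def)
  qed
  hence "(\<Sum>\<omega>\<in>\<Omega>. W \<omega> * real (card {z \<in> D. A z \<omega>} choose r))
       = (\<Sum>\<omega>\<in>\<Omega>. \<Sum>R\<in>?S. if \<forall>z\<in>R. A z \<omega> then W \<omega> else 0)"
    by (simp add: sum_distrib_left if_distrib cong: if_cong)
  also have "\<dots> = (\<Sum>R\<in>?S. \<Sum>\<omega>\<in>\<Omega>. if \<forall>z\<in>R. A z \<omega> then W \<omega> else 0)" by (rule sum.swap)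
  also have "\<dots> = (\<Sum>R\<in>?S. w * \<theta> ^ r)"
  proof (rule sum.cong[OF refl])
    fix R assume R: "R \<in> ?S"
    have "(\<Sum>\<omega>\<in>\<Omega>. if \<forall>z\<in>R. A z \<omega> then W \<omega> else 0) = (\<Sum>\<omega> | \<omega> \<in> \<Omega> \<and> (\<forall>z\<in>R. A z \<omega>). W \<omega>)"
      using fin(1) by (simp add: sum.If_cases Int_def)
    also have "\<dots> = w * \<theta> ^ r" using ind[of R] R r by simp
    finally show "(\<Sum>\<omega>\<in>\<Omega>. if \<forall>z\<in>R. A z \<omega> then W \<omega> else 0) = w * \<theta> ^ r" .
  qed
  also have "\<dots> = w * \<theta> ^ r * real (card D choose r)"
    using fin(2) by (simp add: n_subsets)
  finally show ?thesis .
qed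

text \<open>\<open>w\<close> is the total mass of the weights, that is the probability of the
  condition encoded in them; \<open>\<theta>\<close> is the chance of each counted element under
  that condition, and \<open>b\<close> is the order of independence.\<close>

locale weighted_counts =
  fixes \<Omega> :: "'w set" and D :: "'z set" and A :: "'z \<Rightarrow> 'w \<Rightarrow> bool" and W :: "'w \<Rightarrow> real"
    and w \<theta> :: real and b :: nat
  assumes fin: "finite \<Omega>" "finite D"
    and ind: "\<And>R. R \<subseteq> D \<Longrightarrow> card R \<le> b \<Longrightarrow> (\<Sum>\<omega> | \<omega> \<in> \<Omega> \<and> (\<forall>z\<in>R. A z \<omega>). W \<omega>) = w * \<theta> ^ card R"
    and theta: "0 \<le> \<theta>" "\<theta> \<le> 1" and w: "0 \<le> w" and W: "\<And>\<omega>. \<omega> \<in> \<Omega> \<Longrightarrow> 0 \<le> W \<omega>"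
begin

abbreviation N :: "'w \<Rightarrow> real" where "N \<omega> \<equiv> real (card {z \<in> D. A z \<omega>})"
abbreviation m :: real where "m \<equiv> real (card D)"

lemma moment: "r \<le> b \<Longrightarrow> (\<Sum>\<omega>\<in>\<Omega>. W \<omega> * real (card {z \<in> D. A z \<omega>} choose r)) = w * \<theta> ^ r * real (card D choose r)"
  by (rule weighted_factorial_moment[OF fin ind])

lemma second_moment:
  assumes "2 \<le> b"
  shows "(\<Sum>\<omega>\<in>\<Omega>. W \<omega> * (N \<omega> - m * \<theta>) ^ 2) \<le> w * (m * \<theta>)"
proof -
  \<comment> \<open>Expansion in binomial coefficients, x^2 = 2 C(x,2) + C(x,1), since these are
    what \<open>moment\<close> evaluates.\<close>
  have "W \<omega> * (N \<omega> - m * \<theta>) ^ 2 = 2 * (W \<omega> * real (card {z \<in> D. A z \<omega>} choose 2))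
      + (1 - 2 * (m * \<theta>)) * (W \<omega> * real (card {z \<in> D. A z \<omega>} choose 1))
      + (m * \<theta>) ^ 2 * (W \<omega> * real (card {z \<in> D. A z \<omega>} choose 0))" for \<omega>
    unfolding binomial_real_2 binomial_real_1 by (simp add: field_simps power2_eq_square)
  hence "(\<Sum>\<omega>\<in>\<Omega>. W \<omega> * (N \<omega> - m * \<theta>) ^ 2)
      = 2 * (w * \<theta> ^ 2 * real (card D choose 2)) + (1 - 2 * (m * \<theta>)) * (w * \<theta> ^ 1 * real (card D choose 1))
        + (m * \<theta>) ^ 2 * (w * \<theta> ^ 0 * real (card D choose 0))"
    using assms by (simp only: sum.distrib moment flip: sum_distrib_left)
  also have "\<dots> = w * (m * \<theta>) * (1 - \<theta>)"
    unfolding binomial_real_2 binomial_real_1 by (simp add: field_simps power2_eq_square)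
  also have "\<dots> \<le> w * (m * \<theta>) * 1" using theta w by (intro mult_left_mono) auto
  finally show ?thesis by simp
qed

lemma fourth_moment:
  assumes "4 \<le> b"
  shows "(\<Sum>\<omega>\<in>\<Omega>. W \<omega> * (N \<omega> - m * \<theta>) ^ 4) \<le> w * (3 * (m * \<theta>) ^ 2 + m * \<theta>)"
proof -
  define u where "u = m * \<theta>"
  \<comment> \<open>Here x^4 = 24 C(x,4) + 36 C(x,3) + 14 C(x,2) + C(x,1) and x^3 = 6 C(x,3) + 6
    C(x,2) + C(x,1); the coefficients are factorials times Stirling numbers of the second
    kind.\<close>
  have "W \<omega> * (N \<omega> - u) ^ 4 = 24 * (W \<omega> * real (card {z \<in> D. A z \<omega>} choose 4))
      + (36 - 24 * u) * (W \<omega> * real (card {z \<in> D. A z \<omega>} choose 3))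
      + (14 - 24 * u + 12 * u ^ 2) * (W \<omega> * real (card {z \<in> D. A z \<omega>} choose 2))
      + (1 - 4 * u + 6 * u ^ 2 - 4 * u ^ 3) * (W \<omega> * real (card {z \<in> D. A z \<omega>} choose 1))
      + u ^ 4 * (W \<omega> * real (card {z \<in> D. A z \<omega>} choose 0))" for \<omega>
    unfolding binomial_real_4 binomial_real_3 binomial_real_2 binomial_real_1
    by (simp add: field_simps power2_eq_square power3_eq_cube power4_eq_xxxx)
  hence "(\<Sum>\<omega>\<in>\<Omega>. W \<omega> * (N \<omega> - u) ^ 4)
      = 24 * (w * \<theta> ^ 4 * real (card D choose 4))
      + (36 - 24 * u) * (w * \<theta> ^ 3 * real (card D choose 3))
      + (14 - 24 * u + 12 * u ^ 2) * (w * \<theta> ^ 2 * real (card D choose 2))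
      + (1 - 4 * u + 6 * u ^ 2 - 4 * u ^ 3) * (w * \<theta> ^ 1 * real (card D choose 1))
      + u ^ 4 * (w * \<theta> ^ 0 * real (card D choose 0))"
    using assms by (simp only: sum.distrib moment flip: sum_distrib_left)
  \<comment> \<open>The central fourth moment of the binomial distribution, which four-wise
    independence already determines.\<close>
  also have "\<dots> = w * (u * (1 - \<theta>) * (1 + (3 * u - 6 * \<theta>) * (1 - \<theta>)))"
    unfolding binomial_real_4 binomial_real_3 binomial_real_2 binomial_real_1 u_def
    by (simp add: field_simps power2_eq_square power3_eq_cube power4_eq_xxxx)
  also have "\<dots> \<le> w * (u * 1 * (1 + 3 * u))"
  proof (rule mult_left_mono[OF _ w])
    have u: "0 \<le> u" using theta by (simp add: u_def)
    have "(3 * u - 6 * \<theta>) * (1 - \<theta>) \<le> 3 * u * (1 - \<theta>)" using theta by (intro mult_right_mono) auto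
    also have "\<dots> \<le> 3 * u * 1" using theta u by (intro mult_left_mono) auto
    finally have "u * (1 - \<theta>) * (1 + (3 * u - 6 * \<theta>) * (1 - \<theta>)) \<le> u * (1 - \<theta>) * (1 + 3 * u)"
      using theta u by (intro mult_left_mono) auto
    also have "\<dots> \<le> u * 1 * (1 + 3 * u)"
      using theta u by (intro mult_right_mono mult_left_mono) auto
    finally show "u * (1 - \<theta>) * (1 + (3 * u - 6 * \<theta>) * (1 - \<theta>)) \<le> u * 1 * (1 + 3 * u)" .
  qed
  finally show ?thesis unfolding u_def by (simp add: algebra_simps power2_eq_square)
qed

text \<open>Markov's inequality for an even power of the deviation. \<open>P\<close> merely has to
  force a large deviation, so one-sided events about thresholds can be plugged in as they
  are.\<close>

lemma even_moment_tail:
  assumes M: "(\<Sum>\<omega>\<in>\<Omega>. W \<omega> * (N \<omega> - m * \<theta>) ^ e) \<le> w * B" and e: "even e" and d: "0 < d"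
    and P: "\<And>\<omega>. \<omega> \<in> \<Omega> \<Longrightarrow> P \<omega> \<Longrightarrow> d \<le> \<bar>N \<omega> - m * \<theta>\<bar>"
  shows "(\<Sum>\<omega> | \<omega> \<in> \<Omega> \<and> P \<omega>. W \<omega>) \<le> w * B / d ^ e"
proof -
  have "(\<Sum>\<omega> | \<omega> \<in> \<Omega> \<and> P \<omega>. W \<omega>) * d ^ e = (\<Sum>\<omega> | \<omega> \<in> \<Omega> \<and> P \<omega>. W \<omega> * d ^ e)"
    by (rule sum_distrib_right)
  also have "\<dots> \<le> (\<Sum>\<omega> | \<omega> \<in> \<Omega> \<and> P \<omega>. W \<omega> * (N \<omega> - m * \<theta>) ^ e)"
  proof (rule sum_mono)
    fix \<omega> assume "\<omega> \<in> {\<omega>. \<omega> \<in> \<Omega> \<and> P \<omega>}"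
    hence \<omega>: "\<omega> \<in> \<Omega>" "P \<omega>" by auto
    have "d ^ e \<le> \<bar>N \<omega> - m * \<theta>\<bar> ^ e" using P[OF \<omega>] d by (intro power_mono) auto
    also have "\<dots> = (N \<omega> - m * \<theta>) ^ e" using e by (rule power_even_abs)
    finally show "W \<omega> * d ^ e \<le> W \<omega> * (N \<omega> - m * \<theta>) ^ e" using W[OF \<omega>(1)] by (rule mult_left_mono)
  qed
  also have "\<dots> \<le> (\<Sum>\<omega>\<in>\<Omega>. W \<omega> * (N \<omega> - m * \<theta>) ^ e)"
    using fin(1) W e by (intro sum_mono2) (auto intro!: mult_nonneg_nonneg zero_le_even_power)
  also note M
  finally show ?thesis using d by (simp add: field_simps)
qed

lemmas tail2 = even_moment_tail[OF second_moment]
lemmas tail4 = even_moment_tail[OF fourth_moment]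

end

section \<open>Threshold algorithms based on ranks\<close>

abbreviation beats :: "(nat \<Rightarrow> real) \<Rightarrow> nat \<Rightarrow> nat \<Rightarrow> bool" where
  "beats v x y \<equiv> exceeds v x (v y, y)"

lemma beats_irrefl: "\<not> beats v x x"
  by (simp add: exceeds_def)

lemma beats_trans: "beats v x y \<Longrightarrow> beats v y z \<Longrightarrow> beats v x z"
  by (auto simp: exceeds_def)

lemma beats_total: "x \<noteq> y \<Longrightarrow> beats v x y \<or> beats v y x"
  by (auto simp: exceeds_def)

lemma card_beats_less:
  assumes "finite S" "x \<in> S" "beats v x y"
  shows "card {z \<in> S. beats v z x} < card {z \<in> S. beats v z y}"
proof (rule psubset_card_mono)
  have "x \<in> {z \<in> S. beats v z y}" "x \<notin> {z \<in> S. beats v z x}"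
    using assms beats_irrefl by auto
  moreover have "{z \<in> S. beats v z x} \<subseteq> {z \<in> S. beats v z y}"
    using beats_trans assms(3) by blast
  ultimately show "{z \<in> S. beats v z x} \<subset> {z \<in> S. beats v z y}" by blast
qed (use assms(1) in simp)

lemma bij_betw_card_beats:
  assumes "finite S"
  shows "bij_betw (\<lambda>x. card {z \<in> S. beats v z x}) S {..<card S}"
proof -
  let ?r = "\<lambda>x. card {z \<in> S. beats v z x}"
  have inj: "inj_on ?r S"
  proof (rule inj_onI, rule ccontr)
    fix x y assume xy: "x \<in> S" "y \<in> S" "?r x = ?r y" "x \<noteq> y"
    from beats_total[OF xy(4), of v] show False
      using card_beats_less[OF assms xy(1), of v y] card_beats_less[OF assms xy(2), of v x] xy(3) by auto
  qed
  have "?r ` S \<subseteq> {..<card S}"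
  proof
    fix j assume "j \<in> ?r ` S"
    then obtain x where x: "x \<in> S" "j = ?r x" by blast
    have "{z \<in> S. beats v z x} \<subset> S" using x(1) beats_irrefl[of v x] by blast
    thus "j \<in> {..<card S}" using x(2) assms by (simp add: psubset_card_mono)
  qed
  moreover have "card (?r ` S) = card {..<card S}" using inj by (simp add: card_image)
  ultimately have "?r ` S = {..<card S}" by (intro card_subset_eq) auto
  with inj show ?thesis by (simp add: bij_betw_def)
qed

definition rank_of :: "nat \<Rightarrow> (nat \<Rightarrow> real) \<Rightarrow> nat \<Rightarrow> nat" where
  "rank_of n v x = card {z \<in> {1..n}. beats v z x}"

lemma bij_betw_rank_of: "bij_betw (rank_of n v) {1..n} {..<n}"
  using bij_betw_card_beats[of "{1..n}" v] by (simp add: rank_of_def[abs_def])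

lemma rank_of_less_iff:
  assumes "x \<in> {1..n}" "y \<in> {1..n}"
  shows "rank_of n v x < rank_of n v y \<longleftrightarrow> beats v x y"
proof
  assume less: "rank_of n v x < rank_of n v y"
  hence "x \<noteq> y" by auto
  moreover have "\<not> beats v y x"
    using card_beats_less[of "{1..n}" y v x] assms less unfolding rank_of_def by auto
  ultimately show "beats v x y" using beats_total by blast
next
  assume "beats v x y"
  thus "rank_of n v x < rank_of n v y" unfolding rank_of_def
    using assms by (intro card_beats_less) auto
qed

lemma card_rank_of_less: "j \<le> n \<Longrightarrow> card {x \<in> {1..n}. rank_of n v x < j} = j"
proof -
  assume "j \<le> n"
  have bij: "bij_betw (rank_of n v) {1..n} {..<n}" by (rule bij_betw_rank_of)
  have "rank_of n v ` {x \<in> {1..n}. rank_of n v x < j} = {..<j}"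
  proof (intro equalityI subsetI)
    fix i assume "i \<in> {..<j}"
    hence "i \<in> rank_of n v ` {1..n}" using bij \<open>j \<le> n\<close> by (simp add: bij_betw_def)
    then show "i \<in> rank_of n v ` {x \<in> {1..n}. rank_of n v x < j}" using \<open>i \<in> {..<j}\<close> by auto
  qed auto
  moreover have "inj_on (rank_of n v) {x \<in> {1..n}. rank_of n v x < j}"
    by (rule inj_on_subset[OF bij_betw_imp_inj_on[OF bij]]) blast
  ultimately show ?thesis by (metis card_image card_lessThan)
qed

text \<open>Listing the values by increasing rank is the sorted list read backwards. From here on
  the optimum is a sum over a definite set of elements, even if values coincide.\<close>

lemma sum_k_largest_eq: "sum_k_largest n k v = (\<Sum>x | x \<in> {1..n} \<and> rank_of n v x < k. v x)"
proof -
  define e where "e = the_inv_into {1..n} (rank_of n v)"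
  have bij: "bij_betw (rank_of n v) {1..n} {..<n}" by (rule bij_betw_rank_of)
  have e: "bij_betw e {..<n} {1..n}" unfolding e_def by (rule bij_betw_the_inv_into[OF bij])
  have re: "rank_of n v (e j) = j" if "j < n" for j
    unfolding e_def using bij that by (intro f_the_inv_into_f_bij_betw) auto
  have er: "e (rank_of n v x) = x" if "x \<in> {1..n}" for x
    unfolding e_def using bij that by (intro the_inv_into_f_f) (auto simp: bij_betw_def)
  have ein: "e j \<in> {1..n}" if "j < n" for j using e that by (auto simp: bij_betw_def)
  define xs where "xs = map e [0..<n]"
  have inj: "inj_on e (set [0..<n])" using e by (auto simp: bij_betw_def inj_on_def)
  have "distinct xs" unfolding xs_def distinct_map using inj by simp
  moreover have "set xs = set [1..<n + 1]"
  proof -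
    have "set xs = e ` {..<n}" by (simp add: xs_def atLeast0LessThan)
    also have "\<dots> = {1..n}" using e by (simp add: bij_betw_def)
    also have "\<dots> = set [1..<n + 1]" by auto
    finally show ?thesis .
  qed
  ultimately have m: "mset xs = mset [1..<n + 1]"
    using set_eq_iff_mset_eq_distinct[of xs "[1..<n + 1]"] by simp
  have "sort (map v [1..<n + 1]) = rev (map v xs)"
  proof (rule properties_for_sort)
    show "mset (rev (map v xs)) = mset (map v [1..<n + 1])" using m by (simp only: mset_rev mset_map)
    have "sorted_wrt (\<ge>) (map v xs)"
      unfolding sorted_wrt_iff_nth_less
    proof (intro allI impI)
      fix i j assume ij: "i < j" "j < length (map v xs)"
      hence "i < n" "j < n" by (auto simp: xs_def)
      hence "beats v (e i) (e j)"
        using rank_of_less_iff[of "e i" n "e j" v] ein re ij by simp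
      thus "map v xs ! j \<le> map v xs ! i"
        using \<open>i < n\<close> \<open>j < n\<close> by (auto simp: exceeds_def xs_def)
    qed
    thus "sorted (rev (map v xs))" by (simp add: sorted_wrt_rev)
  qed
  hence "sum_k_largest n k v = sum_list (map (\<lambda>j. v (e j)) [0..<min n k])"
    unfolding sum_k_largest_def xs_def
    by (cases "k \<le> n") (simp_all add: take_map comp_def min_def del: upt_Suc)
  also have "\<dots> = (\<Sum>j<min n k. v (e j))"
    by (simp add: interv_sum_list_conv_sum_set_nat atLeast0LessThan)
  also have "\<dots> = (\<Sum>x | x \<in> {1..n} \<and> rank_of n v x < k. v x)"
  proof (rule sum.reindex_bij_witness[of _ "rank_of n v" e])
    fix j assume "j \<in> {..<min n k}"
    thus "e j \<in> {x. x \<in> {1..n} \<and> rank_of n v x < k}" "rank_of n v (e j) = j" using re ein by auto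
  next
    fix x assume x: "x \<in> {x. x \<in> {1..n} \<and> rank_of n v x < k}"
    thus "e (rank_of n v x) = x" using er by auto
    have "rank_of n v x \<in> {..<n}" using bij x by (auto simp: bij_betw_def)
    thus "rank_of n v x \<in> {..<min n k}" using x by auto
  qed auto
  finally show ?thesis .
qed

text \<open>
  After \<open>t\<close> observations the threshold is the \<open>Q t\<close>-th largest value seen so far; this makes sense
  only if \<open>1 \<le> Q t \<le> t\<close>.
\<close>

definition rank_threshold :: "(nat \<Rightarrow> nat) \<Rightarrow> threshold_rule" where
  "rank_threshold Q hist = (SOME \<theta>. \<exists>e u. (e, u) \<in> set hist \<and> \<theta> = (u, e) \<and>
     Suc (card {(e', u') \<in> set hist. u' > u \<or> (u' = u \<and> e' > e)}) = Q (length hist))"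

text \<open>The choice in \<open>rank_threshold\<close> has a unique outcome, because ranks within
  the observed elements are a bijection onto an initial segment. This lemma turns passing a
  threshold into a pure rank condition.\<close>

lemma exceeds_rank_threshold:
  assumes xs: "distinct xs" "x \<notin> set xs" and Q: "1 \<le> Q (length xs)" "Q (length xs) \<le> length xs"
  shows "exceeds v x (rank_threshold Q (map (\<lambda>e. (e, v e)) xs)) \<longleftrightarrow>
    card {z \<in> set xs. beats v z x} < Q (length xs)"
proof -
  let ?h = "map (\<lambda>e. (e, v e)) xs" and ?q = "Q (length xs)"
  have above: "card {(e', u') \<in> set ?h. u' > v e \<or> (u' = v e \<and> e' > e)} = card {z \<in> set xs. beats v z e}" for e
  proof -
    have "{(e', u') \<in> set ?h. u' > v e \<or> (u' = v e \<and> e' > e)} = (\<lambda>z. (z, v z)) ` {z \<in> set xs. beats v z e}"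
      by (auto simp: exceeds_def)
    moreover have "inj_on (\<lambda>z. (z, v z)) {z \<in> set xs. beats v z e}" by (auto simp: inj_on_def)
    ultimately show ?thesis by (simp add: card_image)
  qed
  have "?q - 1 \<in> {..<card (set xs)}" using Q xs(1) by (simp add: distinct_card)
  also have "\<dots> = (\<lambda>x. card {z \<in> set xs. beats v z x}) ` set xs"
    using bij_betw_card_beats[of "set xs" v] by (simp add: bij_betw_def)
  finally obtain y where y: "y \<in> set xs" "card {z \<in> set xs. beats v z y} = ?q - 1" by force
  have "\<exists>\<theta> e u. (e, u) \<in> set ?h \<and> \<theta> = (u, e) \<and>
      Suc (card {(e', u') \<in> set ?h. u' > u \<or> (u' = u \<and> e' > e)}) = Q (length ?h)"
  proof (intro exI conjI)
    show "(y, v y) \<in> set ?h" using y(1) by auto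
    show "Suc (card {(e', u') \<in> set ?h. u' > v y \<or> (u' = v y \<and> e' > y)}) = Q (length ?h)"
      unfolding above using y(2) Q by simp
  qed (rule refl)
  from someI_ex[OF this] obtain e u where e: "(e, u) \<in> set ?h" "rank_threshold Q ?h = (u, e)"
    "Suc (card {(e', u') \<in> set ?h. u' > u \<or> (u' = u \<and> e' > e)}) = Q (length ?h)"
    unfolding rank_threshold_def by blast
  hence u: "u = v e" "e \<in> set xs" by auto
  have q: "Suc (card {z \<in> set xs. beats v z e}) = ?q" using e(3) unfolding u(1) above by simp
  have "x \<noteq> e" using u xs by auto
  show ?thesis
  proof (cases "beats v x e")
    case True
    have "card {z \<in> set xs. beats v z x} \<le> card {z \<in> set xs. beats v z e}"
      using beats_trans True by (intro card_mono) auto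
    thus ?thesis using True q e(2) u(1) by simp
  next
    case False
    hence "beats v e x" using beats_total[OF \<open>x \<noteq> e\<close>] by blast
    hence "card {z \<in> set xs. beats v z e} < card {z \<in> set xs. beats v z x}"
      using u by (intro card_beats_less) auto
    thus ?thesis using False q e(2) u(1) by simp
  qed
qed

locale threshold_run =
  fixes n k c0 :: nat and Q :: "nat \<Rightarrow> nat" and v :: "nat \<Rightarrow> real" and ord :: "nat list"
  assumes ord: "distinct ord" "set ord = {1..n}"
    and c0: "1 \<le> c0" and Q: "\<And>t. c0 \<le> t \<Longrightarrow> t < n \<Longrightarrow> 1 \<le> Q t \<and> Q t \<le> t"
begin

text \<open>From \<open>c0\<close> on every phase is a single position, so the threshold is renewed
  after each element. Adding \<open>n\<close> closes the last phase even if
  \<open>c0 > n\<close>.\<close>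

definition "C = {c0..n} \<union> {n}"

definition passes :: "nat \<Rightarrow> bool" where
  "passes t \<longleftrightarrow> c0 \<le> t \<and> card {z \<in> set (take t ord). beats v z (ord ! t)} < Q t"

abbreviation acc :: "nat \<Rightarrow> nat set" where
  "acc \<equiv> accepted n k C (rank_threshold Q) v ord"

lemma length_ord: "length ord = n"
  using distinct_card[OF ord(1)] ord(2) by simp

lemma current_threshold_eq:
  assumes "t < n"
  shows "(case current_threshold C (rank_threshold Q) v ord t of None \<Rightarrow> False | Some \<theta> \<Rightarrow> exceeds v (ord ! t) \<theta>)
    \<longleftrightarrow> passes t"
proof (cases "c0 \<le> t")
  case True
  hence eq: "{c \<in> C. c \<le> t} = {c0..t}" using assms by (auto simp: C_def)
  have Max: "Max {c0..t} = t" using True by (intro Max_eqI) auto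
  have len: "length (take t ord) = t" using assms length_ord by simp
  have "ord ! t \<notin> set (take t ord)"
  proof
    assume "ord ! t \<in> set (take t ord)"
    then obtain i where "i < t" "ord ! i = ord ! t" using len by (auto simp: in_set_conv_nth)
    thus False using ord(1) assms length_ord by (simp add: nth_eq_iff_index_eq)
  qed
  from exceeds_rank_threshold[OF distinct_take[OF ord(1)] this, of Q v]
  show ?thesis using True Q[OF True assms] unfolding current_threshold_def eq Max passes_def len by simp
next
  case False
  hence "{c \<in> C. c \<le> t} = {}" using assms by (auto simp: C_def)
  thus ?thesis using False by (simp add: current_threshold_def passes_def)
qed

lemma acc_Suc:
  assumes "t < n"
  shows "acc (Suc t) = (if card (acc t) < k \<and> (n - t \<le> k - card (acc t) \<or> passes t)
    then insert (ord ! t) (acc t) else acc t)"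
  using current_threshold_eq[OF assms] by (simp add: Let_def)

lemma acc_mono: "s \<le> t \<Longrightarrow> acc s \<subseteq> acc t"
  by (induction t rule: dec_induct) (auto simp: Let_def)

lemma acc_subset: "t \<le> n \<Longrightarrow> acc t \<subseteq> set (take t ord)"
proof (induction t)
  case (Suc t)
  hence t: "t < n" and IH: "acc t \<subseteq> set (take t ord)" by auto
  have "acc (Suc t) \<subseteq> insert (ord ! t) (acc t)" unfolding acc_Suc[OF t] by auto
  also have "\<dots> \<subseteq> insert (ord ! t) (set (take t ord))" using IH by blast
  also have "\<dots> = set (take (Suc t) ord)" using t length_ord by (simp add: take_Suc_conv_app_nth)
  finally show ?case .
qed simp

lemma finite_acc: "t \<le> n \<Longrightarrow> finite (acc t)"
  by (rule finite_subset[OF acc_subset]) simp_all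

text \<open>As soon as an element is accepted only because all the remaining ones are needed, everything
  that follows is accepted as well.\<close>

lemma acc_passes_or_forced:
  "t \<le> n \<Longrightarrow> acc t \<subseteq> (\<lambda>s. ord ! s) ` {s. s < t \<and> passes s} \<or> n - t \<le> k - card (acc t)"
proof (induction t)
  case (Suc t)
  hence t: "t < n" "t \<le> n" by auto
  have notin: "ord ! t \<notin> acc t"
  proof
    assume "ord ! t \<in> acc t"
    hence "ord ! t \<in> set (take t ord)" using acc_subset[OF t(2)] by blast
    then obtain i where "i < t" "ord ! i = ord ! t" using t length_ord by (auto simp: in_set_conv_nth)
    thus False using ord(1) t length_ord by (simp add: nth_eq_iff_index_eq)
  qed
  show ?case
  proof (cases "n - t \<le> k - card (acc t)")
    case True
    hence "acc (Suc t) = insert (ord ! t) (acc t)" using acc_Suc[OF t(1)] t(1) by auto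
    hence "card (acc (Suc t)) = Suc (card (acc t))" using notin finite_acc[OF t(2)] by simp
    thus ?thesis using True by linarith
  next
    case False
    hence sub: "acc t \<subseteq> (\<lambda>s. ord ! s) ` {s. s < t \<and> passes s}" using Suc.IH t by blast
    have "acc (Suc t) \<subseteq> (\<lambda>s. ord ! s) ` {s. s < Suc t \<and> passes s}"
    proof (cases "passes t")
      case True
      have "acc (Suc t) \<subseteq> insert (ord ! t) (acc t)" unfolding acc_Suc[OF t(1)] by auto
      thus ?thesis using sub True by (auto simp: less_Suc_eq)
    next
      case np: False
      hence "acc (Suc t) = acc t" using False unfolding acc_Suc[OF t(1)] by simp
      thus ?thesis using sub by (auto simp: less_Suc_eq)
    qed
    thus ?thesis ..
  qed
qed simp

text \<open>A passing element is turned away only when k elements have been accepted. At that moment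
  no further element is required, so no acceptance has been forced, and
  \<open>acc_passes_or_forced\<close> shows that all k accepted elements have passed a
  threshold.\<close>

lemma capacity_exhausted:
  assumes t: "t < n" "passes t" and na: "ord ! t \<notin> acc n"
  shows "k \<le> card {s. s < t \<and> passes s}"
proof -
  have "ord ! t \<notin> acc (Suc t)" using acc_mono[of "Suc t" n] na t by auto
  hence full: "k \<le> card (acc t)" using acc_Suc[OF t(1)] t(2) by (auto split: if_splits)
  hence "\<not> n - t \<le> k - card (acc t)" using t by auto
  hence "acc t \<subseteq> (\<lambda>s. ord ! s) ` {s. s < t \<and> passes s}" using acc_passes_or_forced[of t] t by auto
  hence "card (acc t) \<le> card ((\<lambda>s. ord ! s) ` {s. s < t \<and> passes s})" by (intro card_mono) auto
  also have "\<dots> \<le> card {s. s < t \<and> passes s}" by (rule card_image_le) auto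
  finally show ?thesis using full by simp
qed

lemma accepted_value_ge:
  assumes "\<And>x. x \<in> {1..n} \<Longrightarrow> 0 \<le> v x" "X \<subseteq> {1..n}"
  shows "(\<Sum>x\<in>X. if x \<in> acc n then v x else 0) \<le> accepted_value n k C (rank_threshold Q) v ord"
proof -
  have sub: "acc n \<subseteq> {1..n}" using acc_subset[of n] ord length_ord by simp
  have "(\<Sum>x\<in>X. if x \<in> acc n then v x else 0) = (\<Sum>x\<in>X \<inter> acc n. v x)"
    using assms(2) finite_subset[OF assms(2)] by (simp add: sum.inter_restrict)
  also have "\<dots> \<le> (\<Sum>x\<in>acc n. v x)" using sub assms(1) finite_acc[of n] by (intro sum_mono2) auto
  finally show ?thesis unfolding accepted_value_def .
qed

end

lemma accepted_value_nonneg: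
  assumes ord: "set ord = {1..n}" "length ord = n" and v: "\<And>x. x \<in> {1..n} \<Longrightarrow> 0 \<le> v x"
  shows "0 \<le> accepted_value n k C thr v ord"
proof -
  have "t \<le> n \<Longrightarrow> accepted n k C thr v ord t \<subseteq> {1..n}" for t
  proof (induction t)
    case (Suc t)
    have "ord ! t \<in> {1..n}" using Suc.prems ord nth_mem[of t ord] by simp
    with Suc show ?case by (auto simp: Let_def)
  qed simp
  from this[of n] v show ?thesis unfolding accepted_value_def by (intro sum_nonneg) auto
qed

section \<open>Orders given by equidistributed keys\<close>

text \<open>A counting sort with ties broken by the labels; this form is literally the double loop
  of \<open>write_order\<close>.\<close>

definition key_order :: "nat \<Rightarrow> nat \<Rightarrow> (nat \<Rightarrow> nat) \<Rightarrow> nat list" where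
  "key_order p n T = concat (map (\<lambda>t. filter (\<lambda>x. T x = t) [1..<n + 1]) [0..<p])"

lemma set_key_order: "(\<And>x. x \<in> {1..n} \<Longrightarrow> T x < p) \<Longrightarrow> set (key_order p n T) = {1..n}"
  by (auto simp: key_order_def)

lemma distinct_concat_filter:
  "distinct (concat (map (\<lambda>t. filter (\<lambda>x. T x = t) xs) [0..<q])) \<longleftrightarrow> distinct (filter (\<lambda>x. T x < q) xs)"
  if "distinct xs" for xs :: "nat list"
  using that
proof (induction q)
  case (Suc q)
  thus ?case by auto
qed simp

lemma distinct_key_order: "distinct (key_order p n T)"
  unfolding key_order_def by (subst distinct_concat_filter) simp_all

lemma sorted_key_order: "sorted (map T (key_order p n T))"
proof -
  have "sorted (map T (concat (map (\<lambda>t. filter (\<lambda>x. T x = t) xs) [0..<q])))" for q and xs :: "nat list"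
  proof (induction q)
    case (Suc q)
    have "map T (filter (\<lambda>x. T x = q) xs) = replicate (length (filter (\<lambda>x. T x = q) xs)) q"
      by (induction xs) auto
    with Suc show ?case by (auto simp: sorted_append)
  qed simp
  thus ?thesis unfolding key_order_def .
qed

lemma key_order_in_permutations:
  "(\<And>x. x \<in> {1..n} \<Longrightarrow> T x < p) \<Longrightarrow> key_order p n T \<in> permutations_of_set {1..n}"
  unfolding permutations_of_set_def using set_key_order[of n T p] distinct_key_order by blast

locale keyed_order =
  fixes p n :: nat and T :: "nat \<Rightarrow> nat"
  assumes T: "\<And>x. x \<in> {1..n} \<Longrightarrow> T x < p"
begin

abbreviation "ord \<equiv> key_order p n T"

lemma set_ord: "set ord = {1..n}"
  by (rule set_key_order) (rule T)

lemma length_ord: "length ord = n"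
  using distinct_card[OF distinct_key_order[of p n T]] set_ord by simp

lemma nth_in: "i < n \<Longrightarrow> ord ! i \<in> {1..n}"
  using nth_mem[of i ord] set_ord length_ord by simp

lemma T_mono: "i \<le> j \<Longrightarrow> j < n \<Longrightarrow> T (ord ! i) \<le> T (ord ! j)"
  using sorted_nth_mono[OF sorted_key_order[of T p n], of i j] length_ord by simp

lemma card_nth: "i \<le> n \<Longrightarrow> card ((\<lambda>s. ord ! s) ` {..<i}) = i"
proof -
  assume "i \<le> n"
  hence "inj_on (\<lambda>s. ord ! s) {..<i}"
    using distinct_key_order[of p n T] length_ord by (auto simp: inj_on_def nth_eq_iff_index_eq)
  thus ?thesis by (simp add: card_image)
qed

text \<open>Sorting by keys places every element with a smaller key earlier, while everything up to
  position i has a key at most that of \<open>ord ! i\<close>. Hence the distribution function of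
  the keys locates positions.\<close>

lemma position_bounds:
  assumes "i < n"
  shows "card {y \<in> {1..n}. T y < T (ord ! i)} \<le> i" "Suc i \<le> card {y \<in> {1..n}. T y < Suc (T (ord ! i))}"
proof -
  have "{y \<in> {1..n}. T y < T (ord ! i)} \<subseteq> (\<lambda>s. ord ! s) ` {..<i}"
  proof
    fix y assume y: "y \<in> {y \<in> {1..n}. T y < T (ord ! i)}"
    hence "y \<in> set ord" using set_ord by simp
    then obtain s where s: "s < n" "y = ord ! s" using length_ord by (auto simp: in_set_conv_nth)
    have "\<not> i \<le> s" using T_mono[of i s] s y by auto
    thus "y \<in> (\<lambda>s. ord ! s) ` {..<i}" using s by auto
  qed
  hence "card {y \<in> {1..n}. T y < T (ord ! i)} \<le> card ((\<lambda>s. ord ! s) ` {..<i})" by (intro card_mono) auto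
  thus "card {y \<in> {1..n}. T y < T (ord ! i)} \<le> i" using card_nth assms by simp
  have "(\<lambda>s. ord ! s) ` {..<Suc i} \<subseteq> {y \<in> {1..n}. T y < Suc (T (ord ! i))}"
  proof
    fix y assume "y \<in> (\<lambda>s. ord ! s) ` {..<Suc i}"
    then obtain s where "s \<in> {..<Suc i}" "y = ord ! s" by blast
    hence s: "s \<le> i" "y = ord ! s" by simp_all
    show "y \<in> {y \<in> {1..n}. T y < Suc (T (ord ! i))}"
      using nth_in[of s] T_mono[OF s(1) assms] s assms by simp
  qed
  hence "card ((\<lambda>s. ord ! s) ` {..<Suc i}) \<le> card {y \<in> {1..n}. T y < Suc (T (ord ! i))}"
    by (intro card_mono) auto
  thus "Suc i \<le> card {y \<in> {1..n}. T y < Suc (T (ord ! i))}" using card_nth[of "Suc i"] assms by simp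
qed

end

text \<open>A block of p consecutive numbers meets every residue exactly once, whatever the shift
  \<open>c\<close> is.\<close>

lemma card_shifted_residues_block:
  fixes p :: nat
  assumes "q \<le> p"
  shows "card {j \<in> {..<p * m}. (c + j) mod p < q} = m * q"
proof (cases "p = 0")
  case True
  thus ?thesis using assms by simp
next
  case p: False
  show ?thesis
  proof (induction m)
    case (Suc m)
    let ?f = "\<lambda>j. (c + j) mod p"
    have inj: "inj_on ?f {p * m..<p * m + p}"
    proof (rule linorder_inj_onI)
      fix i j assume ij: "i < j" "i \<in> {p * m..<p * m + p}" "j \<in> {p * m..<p * m + p}"
      show "?f i \<noteq> ?f j"
      proof
        assume "?f i = ?f j"
        hence "p dvd (c + j) - (c + i)" using ij(1) by (subst (asm) eq_commute) (simp add: mod_eq_dvd_iff_nat)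
        hence "p dvd j - i" by simp
        hence "p \<le> j - i" using ij(1) by (intro dvd_imp_le) auto
        thus False using ij by auto
      qed
    qed (auto simp: total_on_def)
    have "?f ` {p * m..<p * m + p} \<subseteq> {..<p}" using p by auto
    moreover have "card (?f ` {p * m..<p * m + p}) = card {..<p}" using inj by (simp add: card_image)
    ultimately have surj: "?f ` {p * m..<p * m + p} = {..<p}" by (intro card_subset_eq) auto
    have im: "?f ` {j \<in> {p * m..<p * m + p}. ?f j < q} = {..<q}"
    proof (intro equalityI subsetI)
      fix u assume "u \<in> {..<q}"
      hence "u \<in> ?f ` {p * m..<p * m + p}" using assms unfolding surj by simp
      thus "u \<in> ?f ` {j \<in> {p * m..<p * m + p}. ?f j < q}" using \<open>u \<in> {..<q}\<close> by auto
    qed auto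
    have "inj_on ?f {j \<in> {p * m..<p * m + p}. ?f j < q}" by (rule inj_on_subset[OF inj]) auto
    from card_image[OF this] have "card {j \<in> {p * m..<p * m + p}. ?f j < q} = q" unfolding im by simp
    moreover have "{j \<in> {..<p * Suc m}. ?f j < q} = {j \<in> {..<p * m}. ?f j < q} \<union> {j \<in> {p * m..<p * m + p}. ?f j < q}"
      by auto
    moreover have "card ({j \<in> {..<p * m}. ?f j < q} \<union> {j \<in> {p * m..<p * m + p}. ?f j < q})
      = card {j \<in> {..<p * m}. ?f j < q} + card {j \<in> {p * m..<p * m + p}. ?f j < q}"
      by (intro card_Un_disjoint) auto
    ultimately show ?case using Suc by simp
  qed simp
qed

text \<open>\<open>b\<close> lies between two neighbouring multiples of p, for which the count is
  exact. The factor p on both sides replaces a division.\<close>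

lemma card_shifted_residues:
  fixes p :: nat
  assumes "q \<le> p" "0 < p"
  shows "p * card {j \<in> {..<b}. (c + j) mod p < q} \<le> b * q + p * q"
    "b * q \<le> p * card {j \<in> {..<b}. (c + j) mod p < q} + p * q"
proof -
  define m where "m = b div p"
  have "b = p * m + b mod p" by (simp add: m_def)
  moreover have "b mod p < p" using assms(2) by simp
  ultimately have m: "p * m \<le> b" "b \<le> p * Suc m" by simp_all
  have "card {j \<in> {..<b}. (c + j) mod p < q} \<le> card {j \<in> {..<p * Suc m}. (c + j) mod p < q}"
    using m(2) by (intro card_mono) auto
  hence "card {j \<in> {..<b}. (c + j) mod p < q} \<le> Suc m * q"
    unfolding card_shifted_residues_block[OF assms(1)] .
  hence "p * card {j \<in> {..<b}. (c + j) mod p < q} \<le> p * (Suc m * q)" by (rule mult_le_mono2)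
  also have "\<dots> = (p * m) * q + p * q" by (simp add: algebra_simps)
  also have "\<dots> \<le> b * q + p * q" using m(1) by (intro add_mono mult_le_mono1) auto
  finally show "p * card {j \<in> {..<b}. (c + j) mod p < q} \<le> b * q + p * q" .
  have "card {j \<in> {..<p * m}. (c + j) mod p < q} \<le> card {j \<in> {..<b}. (c + j) mod p < q}"
    using m(1) by (intro card_mono) auto
  hence "m * q \<le> card {j \<in> {..<b}. (c + j) mod p < q}"
    unfolding card_shifted_residues_block[OF assms(1)] .
  hence "p * (m * q) \<le> p * card {j \<in> {..<b}. (c + j) mod p < q}" by (rule mult_le_mono2)
  moreover have "b * q \<le> p * Suc m * q" using m(2) by (rule mult_le_mono1)
  moreover have "p * Suc m * q = p * (m * q) + p * q" by (simp add: algebra_simps)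
  ultimately show "b * q \<le> p * card {j \<in> {..<b}. (c + j) mod p < q} + p * q" by linarith
qed

text \<open>
  Adding to a hashed key the number of earlier elements with the same hash value makes the keys almost
  equidistributed, whatever the hash function is.
\<close>

definition spread_key :: "nat \<Rightarrow> (nat \<Rightarrow> nat) \<Rightarrow> (nat \<Rightarrow> nat) \<Rightarrow> nat \<Rightarrow> nat" where
  "spread_key p f h x = (f (h x) + card {y \<in> {1..<x}. h y = h x}) mod p"

lemma bij_betw_earlier:
  fixes B :: "nat set"
  assumes "finite B"
  shows "bij_betw (\<lambda>x. card {y \<in> B. y < x}) B {..<card B}"
proof -
  let ?r = "\<lambda>x. card {y \<in> B. y < x}"
  have mono: "?r x < ?r x'" if "x \<in> B" "x' \<in> B" "x < x'" for x x'
    using that assms by (intro psubset_card_mono) auto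
  have inj: "inj_on ?r B"
  proof (rule inj_onI, rule ccontr)
    fix x y assume xy: "x \<in> B" "y \<in> B" "?r x = ?r y" "x \<noteq> y"
    thus False using mono[of x y] mono[of y x] by (cases "x < y") auto
  qed
  have "?r x < card B" if "x \<in> B" for x
    using that assms by (intro psubset_card_mono) auto
  hence "?r ` B \<subseteq> {..<card B}" by auto
  moreover have "card (?r ` B) = card {..<card B}" using inj by (simp add: card_image)
  ultimately have "?r ` B = {..<card B}" by (intro card_subset_eq) auto
  with inj show ?thesis by (simp add: bij_betw_def)
qed

text \<open>Within a bucket of equal hash values the counters are 0, 1, 2, and so on, so its keys
  are consecutive residues starting at \<open>f u\<close>. The rounding error is at most
  \<open>p * q\<close> per bucket and adds up over p buckets, however unequal they are.\<close>

lemma card_spread_key: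
  fixes n p :: nat
  assumes h: "\<And>x. x \<in> {1..n} \<Longrightarrow> h x < p" and q: "q \<le> p" and p: "0 < p"
  shows "p * card {x \<in> {1..n}. spread_key p f h x < q} \<le> n * q + p ^ 2 * q"
    "n * q \<le> p * card {x \<in> {1..n}. spread_key p f h x < q} + p ^ 2 * q"
proof -
  let ?T = "spread_key p f h"
  define B where "B u = {x \<in> {1..n}. h x = u}" for u
  have finB: "finite (B u)" for u by (simp add: B_def)
  have bucket: "card {x \<in> B u. ?T x < q} = card {j \<in> {..<card (B u)}. (f u + j) mod p < q}" for u
  proof (rule bij_betw_same_card)
    let ?r = "\<lambda>x. card {y \<in> B u. y < x}"
    have T: "?T x = (f u + ?r x) mod p" if "x \<in> B u" for x
    proof -
      have "{y \<in> {1..<x}. h y = h x} = {y \<in> B u. y < x}" using that by (auto simp: B_def)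
      thus ?thesis using that by (simp add: spread_key_def B_def)
    qed
    have bij: "bij_betw ?r (B u) {..<card (B u)}" by (rule bij_betw_earlier[OF finB])
    have "?r ` {x \<in> B u. ?T x < q} = {j \<in> {..<card (B u)}. (f u + j) mod p < q}"
    proof (intro equalityI subsetI)
      fix j assume j: "j \<in> {j \<in> {..<card (B u)}. (f u + j) mod p < q}"
      then obtain x where "x \<in> B u" "j = ?r x" using bij unfolding bij_betw_def by blast
      thus "j \<in> ?r ` {x \<in> B u. ?T x < q}" using T j by auto
    next
      fix j assume "j \<in> ?r ` {x \<in> B u. ?T x < q}"
      then obtain x where x: "x \<in> B u" "?T x < q" "j = ?r x" by blast
      have "?r x \<in> {..<card (B u)}" using bij x(1) unfolding bij_betw_def by blast
      thus "j \<in> {j \<in> {..<card (B u)}. (f u + j) mod p < q}" using x T by simp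
    qed
    moreover have "inj_on ?r {x \<in> B u. ?T x < q}"
      by (rule inj_on_subset[OF bij_betw_imp_inj_on[OF bij]]) blast
    ultimately show "bij_betw ?r {x \<in> B u. ?T x < q} {j \<in> {..<card (B u)}. (f u + j) mod p < q}"
      by (simp add: bij_betw_def)
  qed
  have "card (\<Union>u\<in>{..<p}. B u) = (\<Sum>u<p. card (B u))"
    by (intro card_UN_disjoint) (auto simp: B_def)
  moreover have "(\<Union>u\<in>{..<p}. B u) = {1..n}" using h by (auto simp: B_def)
  ultimately have tot: "(\<Sum>u<p. card (B u)) = n" by simp
  have "card (\<Union>u\<in>{..<p}. {x \<in> B u. ?T x < q}) = (\<Sum>u<p. card {x \<in> B u. ?T x < q})"
    by (intro card_UN_disjoint) (auto simp: B_def)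
  moreover have "(\<Union>u\<in>{..<p}. {x \<in> B u. ?T x < q}) = {x \<in> {1..n}. ?T x < q}" using h by (auto simp: B_def)
  ultimately have eq: "p * card {x \<in> {1..n}. ?T x < q} = (\<Sum>u<p. p * card {x \<in> B u. ?T x < q})"
    by (simp add: sum_distrib_left)
  have pp: "(\<Sum>u<p. p * q) = p ^ 2 * q" by (simp add: power2_eq_square)
  have nq: "(\<Sum>u<p. card (B u) * q) = n * q" by (simp flip: tot sum_distrib_right)
  have "(\<Sum>u<p. p * card {x \<in> B u. ?T x < q}) \<le> (\<Sum>u<p. card (B u) * q + p * q)"
    unfolding bucket by (intro sum_mono card_shifted_residues[OF q p])
  thus "p * card {x \<in> {1..n}. ?T x < q} \<le> n * q + p ^ 2 * q" unfolding eq sum.distrib pp nq .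
  have "(\<Sum>u<p. card (B u) * q) \<le> (\<Sum>u<p. p * card {x \<in> B u. ?T x < q} + p * q)"
    unfolding bucket by (intro sum_mono card_shifted_residues[OF q p])
  thus "n * q \<le> p * card {x \<in> {1..n}. ?T x < q} + p ^ 2 * q" unfolding eq sum.distrib pp nq .
qed

text \<open>The position of an element determines its key up to an error of one.\<close>

definition level :: "nat \<Rightarrow> nat \<Rightarrow> nat \<Rightarrow> nat" where
  "level p n t = (t + p ^ 2) * p div n"

lemma level_mono: "s \<le> t \<Longrightarrow> level p n s \<le> level p n t"
  unfolding level_def by (intro div_le_mono mult_le_mono1 add_right_mono)

text \<open>Position i is n/p times the key up to an error. The summand \<open>p ^ 2\<close> in
  \<open>level\<close> makes this error one-sided, so the level never falls below the key, and
  \<open>2 * p ^ 3 < n\<close> keeps the overshoot to at most one key.\<close>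

lemma level_key_order:
  fixes n p :: nat and f h :: "nat \<Rightarrow> nat"
  assumes h: "\<And>x. x \<in> {1..n} \<Longrightarrow> h x < p" and p: "0 < p" and big: "2 * p ^ 3 < n" and i: "i < n"
  defines "T \<equiv> spread_key p f h"
  shows "T (key_order p n T ! i) \<le> level p n i" "level p n i \<le> Suc (T (key_order p n T ! i))"
proof -
  have Tp: "T x < p" for x using p by (simp add: T_def spread_key_def)
  interpret keyed_order p n T by standard (rule Tp)
  define K where "K = T (key_order p n T ! i)"
  have K: "K < p" unfolding K_def by (rule Tp)
  have "n * K \<le> p * card {x \<in> {1..n}. T x < K} + p ^ 2 * K"
    unfolding T_def using K by (intro card_spread_key h p) auto
  also have "\<dots> \<le> p * i + p ^ 2 * p"
    using position_bounds(1)[OF i] K unfolding K_def by (intro add_mono mult_le_mono) auto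
  also have "\<dots> = (i + p ^ 2) * p" by (simp add: algebra_simps)
  finally have "K * n \<le> (i + p ^ 2) * p" by (simp add: mult.commute)
  thus "T (key_order p n T ! i) \<le> level p n i"
    unfolding level_def K_def using big by (simp add: less_eq_div_iff_mult_less_eq)
  have "p * Suc i \<le> p * card {x \<in> {1..n}. T x < Suc K}"
    using position_bounds(2)[OF i] unfolding K_def by (rule mult_le_mono2)
  also have "\<dots> \<le> n * Suc K + p ^ 2 * Suc K"
    unfolding T_def using K by (intro card_spread_key h p) auto
  also have "\<dots> \<le> n * Suc K + p ^ 2 * p" using K by (intro add_left_mono mult_le_mono2) auto
  finally have "(i + p ^ 2) * p \<le> n * Suc K + 2 * p ^ 3"
    by (simp add: algebra_simps power2_eq_square power3_eq_cube)
  also have "\<dots> < Suc (Suc K) * n" using big by (simp add: algebra_simps)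
  finally show "level p n i \<le> Suc (T (key_order p n T ! i))"
    unfolding level_def K_def[symmetric] by (simp add: less_mult_imp_div_less less_Suc_eq_le[symmetric])
qed

definition top_set :: "nat \<Rightarrow> (nat \<Rightarrow> real) \<Rightarrow> nat \<Rightarrow> nat set" where
  "top_set n v j = {x \<in> {1..n}. rank_of n v x < j}"

text \<open>The counter of x depends on h alone, and adding it permutes the residues. Elements with
  distinct hash values therefore inherit the independence of the polynomial values.\<close>

lemma card_spread_key_in:
  assumes p: "prime p" and w: "w \<le> p" and h: "\<And>x. h x < p" and X: "inj_on h X" "finite X" "card X \<le> w"
    and S: "\<And>x. x \<in> X \<Longrightarrow> S x \<subseteq> {..<p}"
  shows "card {a \<in> coefs p w. \<forall>x\<in>X. spread_key p (peval w a) h x \<in> S x} * p ^ card X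
       = p ^ w * (\<Prod>x\<in>X. card (S x))"
proof -
  have p0: "p > 0" using p by (rule prime_gt_0_nat)
  define d where "d x = card {y \<in> {1..<x}. h y = h x}" for x
  define g where "g = the_inv_into X h"
  have g: "g (h x) = x" if "x \<in> X" for x
    unfolding g_def using X(1) that by (rule the_inv_into_f_f)
  define S' where "S' u = {r \<in> {..<p}. (r + d (g u)) mod p \<in> S (g u)}" for u
  have "{a \<in> coefs p w. \<forall>x\<in>X. spread_key p (peval w a) h x \<in> S x}
      = {a \<in> coefs p w. \<forall>u\<in>h ` X. peval w a u mod p \<in> S' u}"
    using p0 by (auto simp: S'_def g spread_key_def d_def mod_add_left_eq)
  moreover have "card {a \<in> coefs p w. \<forall>u\<in>h ` X. peval w a u mod p \<in> S' u} * p ^ card (h ` X)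
      = p ^ w * (\<Prod>u\<in>h ` X. card (S' u))"
    using X h w by (intro card_peval_in[OF p]) (auto simp: card_image S'_def)
  moreover have "(\<Prod>u\<in>h ` X. card (S' u)) = (\<Prod>x\<in>X. card (S' (h x)))"
    using X(1) by (simp add: prod.reindex)
  moreover have "card (S' (h x)) = card (S x)" if x: "x \<in> X" for x
  proof -
    let ?f = "\<lambda>r. (r + d x) mod p"
    have inj: "inj_on ?f {..<p}"
    proof (rule inj_onI)
      fix r r' assume r: "r \<in> {..<p}" "r' \<in> {..<p}" "?f r = ?f r'"
      hence "int (r + d x) mod int p = int (r' + d x) mod int p" by (metis zmod_int)
      hence "int p dvd int r - int r'" by (simp add: mod_eq_dvd_iff)
      thus "r = r'" using r by (intro int_dvd_diff_small_eq) auto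
    qed
    have "?f ` {..<p} \<subseteq> {..<p}" using p0 by auto
    moreover have "card (?f ` {..<p}) = card {..<p}" using inj by (simp add: card_image)
    ultimately have surj: "?f ` {..<p} = {..<p}" by (intro card_subset_eq) auto
    have im: "?f ` S' (h x) = S x"
    proof (intro equalityI subsetI)
      fix s assume s: "s \<in> S x"
      hence "s \<in> ?f ` {..<p}" using S[OF x] unfolding surj by blast
      thus "s \<in> ?f ` S' (h x)" using s unfolding S'_def g[OF x] by blast
    qed (auto simp: S'_def g[OF x])
    have "inj_on ?f (S' (h x))" by (rule inj_on_subset[OF inj]) (auto simp: S'_def)
    from card_image[OF this] show ?thesis unfolding im by simp
  qed
  ultimately show ?thesis using X(1) by (simp add: card_image)
qed

section \<open>Rejection of one of the largest elements\<close>

text \<open>\<open>\<mu>\<close> will be sqrt(log k), and \<open>K0 / p\<close> is roughly the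
  initial fraction 9/4 log k / k without thresholds. The last condition says that after it at least
  9/4 \<mu>^2 of the k best elements are expected to have been seen, which makes the quota below
  positive and increasing. Distinct hash values are demanded only of the k^2 best elements, since
  these are the only ones whose keys are analysed.\<close>

locale secretary_params =
  fixes p n k K0 :: nat and \<mu> :: real and v :: "nat \<Rightarrow> real" and h :: "nat \<Rightarrow> nat"
  assumes p: "prime p" "6 \<le> p" and n: "2 * p ^ 3 < n" and h: "\<And>x. h x < p"
    and k: "2 \<le> k" "2 * k \<le> p" "k ^ 2 \<le> n" and inj: "inj_on h (top_set n v (k ^ 2))"
    and K0: "2 \<le> K0" "K0 \<le> p" and mu: "2 \<le> \<mu>" "6 \<le> \<mu> ^ 2" "9 / 4 * \<mu> ^ 2 \<le> real k * real (K0 - 1) / real p"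
begin

abbreviation "T a \<equiv> spread_key p (peval 6 a) h"
abbreviation "ord a \<equiv> key_order p n (T a)"
abbreviation "rk \<equiv> rank_of n v"
abbreviation "best \<equiv> top_set n v"

definition quota :: "real \<Rightarrow> real" where "quota r = r - \<mu> * sqrt r - 1"
text \<open>\<open>k * Suc l / p\<close> is the expected number of the k best elements with a key in
  0, ..., l. The quota is attached to levels, which follow from the position, and so does not depend
  on the seed.\<close>

definition q :: "nat \<Rightarrow> nat" where "q l = nat \<lfloor>quota (real k * real (Suc l) / real p)\<rfloor>"
definition Q :: "nat \<Rightarrow> nat" where "Q t = q (level p n t)"
definition c0 :: nat where "c0 = (LEAST t. K0 \<le> level p n t)"

lemma p0: "0 < p" using p(2) by simp

lemma T_less: "T a x < p" using p0 by (simp add: spread_key_def)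

text \<open>In terms of s = sqrt r the quota is s^2 - \<mu> s - 1, which increases beyond s =
  \<mu>/2.\<close>

lemma quota_mono:
  assumes "9 / 4 * \<mu> ^ 2 \<le> r" "r \<le> r'"
  shows "quota r \<le> quota r'"
proof -
  have r0: "0 \<le> r" using assms(1) by (rule order.trans[rotated]) simp
  have "3 / 2 * \<mu> \<le> sqrt r"
    using assms(1) by (intro real_le_rsqrt) (simp add: power2_eq_square)
  moreover have "sqrt r \<le> sqrt r'" using assms(2) by simp
  ultimately have "0 \<le> (sqrt r' - sqrt r) * (sqrt r' + sqrt r - \<mu>)"
    using mu(1) by (intro mult_nonneg_nonneg) linarith+
  also have "\<dots> = sqrt r' ^ 2 - sqrt r ^ 2 - \<mu> * (sqrt r' - sqrt r)"
    by (simp add: algebra_simps power2_eq_square)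
  also have "\<dots> = r' - r - \<mu> * (sqrt r' - sqrt r)" using r0 assms(2) by simp
  finally show ?thesis by (simp add: quota_def algebra_simps)
qed

lemma ratio_ge: "K0 - 1 \<le> l \<Longrightarrow> 9 / 4 * \<mu> ^ 2 \<le> real k * real l / real p"
proof -
  assume "K0 - 1 \<le> l"
  hence "real k * real (K0 - 1) / real p \<le> real k * real l / real p"
    by (intro divide_right_mono mult_left_mono) auto
  with mu(3) show ?thesis by (rule order.trans)
qed

lemma ratio_ge': "K0 - 1 \<le> l \<Longrightarrow> 13 \<le> real k * real l / real p"
  using ratio_ge[of l] mu(2) by linarith

lemma q_mono: "K0 - 1 \<le> l \<Longrightarrow> l \<le> l' \<Longrightarrow> q l \<le> q l'"
  unfolding q_def using ratio_ge[of "Suc l"] p0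
  by (intro nat_mono floor_mono quota_mono divide_right_mono mult_left_mono) auto

lemma quota_ge_1:
  assumes "9 / 4 * \<mu> ^ 2 \<le> r"
  shows "1 \<le> quota r"
proof -
  have r0: "0 \<le> r" using assms(1) by (rule order.trans[rotated]) simp
  have s: "3 / 2 * \<mu> \<le> sqrt r"
    using assms(1) by (intro real_le_rsqrt) (simp add: power2_eq_square)
  have "3 / 2 * \<mu> * (1 / 2 * \<mu>) \<le> sqrt r * (sqrt r - \<mu>)"
    using s mu(1) by (intro mult_mono) linarith+
  also have "sqrt r * (sqrt r - \<mu>) = sqrt r ^ 2 - \<mu> * sqrt r" by (simp add: algebra_simps power2_eq_square)
  also have "\<dots> = r - \<mu> * sqrt r" using r0 by simp
  finally show ?thesis using mu(2) by (simp add: quota_def power2_eq_square)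
qed

lemma q_ge_1: "K0 - 1 \<le> l \<Longrightarrow> 1 \<le> q l"
  using quota_ge_1[OF ratio_ge[of "Suc l"]] unfolding q_def by (simp add: le_nat_iff le_floor_iff)

lemma real_q_le: "K0 - 1 \<le> l \<Longrightarrow> real (q l) \<le> quota (real k * real (Suc l) / real p)"
  using quota_ge_1[OF ratio_ge[of "Suc l"]] unfolding q_def by simp

lemma real_q_ge: "K0 - 1 \<le> l \<Longrightarrow> quota (real k * real (Suc l) / real p) - 1 \<le> real (q l)"
  using quota_ge_1[OF ratio_ge[of "Suc l"]] unfolding q_def by linarith

lemma q_le_k:
  assumes "K0 - 1 \<le> l" "l \<le> p"
  shows "q l \<le> k"
proof -
  have "real k * real (Suc l) / real p \<le> real k * (real p + 1) / real p"
    using assms(2) by (intro divide_right_mono mult_left_mono) auto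
  also have "\<dots> = real k + real k / real p" using p0 by (simp add: field_simps)
  also have "\<dots> \<le> real k + 1" using k(2) p0 by (simp add: divide_le_eq_1)
  finally have "quota (real k * real (Suc l) / real p) \<le> real k"
    unfolding quota_def using mu(1) by (smt (verit) mult_nonneg_nonneg real_sqrt_ge_zero of_nat_0_le_iff divide_nonneg_nonneg)
  thus ?thesis using real_q_le[OF assms(1)] by linarith
qed

lemma level_ge_iff: "K0 \<le> level p n t \<longleftrightarrow> c0 \<le> t"
proof -
  have "p * n \<le> (n + p ^ 2) * p" by (simp add: algebra_simps)
  hence "p \<le> level p n n" unfolding level_def using n by (simp add: less_eq_div_iff_mult_less_eq)
  hence ex: "K0 \<le> level p n n" using K0(2) by simp
  hence "K0 \<le> level p n c0" unfolding c0_def by (rule LeastI)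
  thus ?thesis unfolding c0_def using level_mono Least_le by (metis (lifting) order.trans)
qed

lemma level_index:
  assumes "i < n"
  shows "T a (ord a ! i) \<le> level p n i" "level p n i \<le> Suc (T a (ord a ! i))"
  using level_key_order[OF h p0 n assms, of "peval 6 a"] by auto

lemma Q_bounds:
  assumes "c0 \<le> t" "t < n"
  shows "1 \<le> Q t \<and> Q t \<le> t"
proof -
  have l: "K0 \<le> level p n t" using assms(1) level_ge_iff by simp
  \<comment> \<open>The bound by p does not mention a seed; it is obtained from an arbitrary one,
    for which \<open>undefined\<close> stands.\<close>
  have "level p n t \<le> Suc (T undefined (ord undefined ! t))" by (rule level_index[OF assms(2)])
  also have "\<dots> \<le> p" using T_less by (simp add: Suc_leI)
  finally have lp: "level p n t \<le> p" .
  \<comment> \<open>A positive level forces t + p^2 >= n/p > 2 p^2. So more than p^2 >= k elements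
    have been seen, enough for a threshold of rank at most k.\<close>
  have "1 \<le> level p n t" using l K0 by simp
  hence "1 * n \<le> (t + p ^ 2) * p" unfolding level_def using n
    by (subst (asm) less_eq_div_iff_mult_less_eq) simp_all
  hence "2 * p ^ 3 < (t + p ^ 2) * p" using n by simp
  hence "(2 * p ^ 2) * p < (t + p ^ 2) * p" by (simp add: power3_eq_cube power2_eq_square mult.assoc)
  hence "p ^ 2 \<le> t" by simp
  moreover have "k \<le> p ^ 2" using k(2) self_le_power[of p 2] p0 by simp
  moreover have "K0 - 1 \<le> level p n t" using l by simp
  ultimately show ?thesis unfolding Q_def
    using q_le_k[of "level p n t"] q_ge_1[of "level p n t"] lp by linarith
qed

lemma threshold_run: "threshold_run n c0 Q (ord a)"
proof
  show "set (ord a) = {1..n}" by (rule set_key_order) (rule T_less)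
  have "level p n 0 = 0"
  proof -
    have "(0 + p ^ 2) * p < n" using n by (simp add: power3_eq_cube power2_eq_square)
    thus ?thesis unfolding level_def by simp
  qed
  hence "\<not> c0 \<le> 0" using level_ge_iff[of 0] K0(1) by simp
  thus "1 \<le> c0" by simp
qed (use distinct_key_order Q_bounds in auto)

lemma keyed_order: "keyed_order p n (T a)"
  by standard (rule T_less)

definition accepted_set :: "(nat \<Rightarrow> nat) \<Rightarrow> nat set" where
  "accepted_set a = accepted n k (threshold_run.C n c0) (rank_threshold Q) v (ord a) n"

lemma finite_top: "finite (best j)" by (simp add: top_set_def)

lemma card_top: "j \<le> n \<Longrightarrow> card (best j) = j"
  unfolding top_set_def by (rule card_rank_of_less)

text \<open>A superset of the outsiders that can be accepted, described by keys alone. The quota is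
  taken at the highest level compatible with the key of y, and x is excluded from the count so that
  its key can be prescribed separately.\<close>

definition excess :: "(nat \<Rightarrow> nat) \<Rightarrow> nat \<Rightarrow> nat set" where
  "excess a x = {y \<in> best (k ^ 2). k \<le> rk y \<and> K0 - 1 \<le> T a y
     \<and> card {z \<in> best (rk y) - {x}. T a z < T a y} < q (Suc (T a y))}"

text \<open>If x passes its threshold and is rejected all the same, then k passing elements precede
  it. They are outsiders or other best elements with keys between \<open>K0 - 1\<close> and the key
  of x. The second alternative is the price for confining the outsiders to ranks below
  \<open>k ^ 2\<close>.\<close>

lemma rejected_cases:
  assumes x: "x \<in> best k" and rej: "x \<notin> accepted_set a"
  shows "T a x < K0 \<or> card {y \<in> best (k ^ 2). T a y < K0 - 1} < k
    \<or> q (T a x) \<le> card {y \<in> best (rk x). T a y \<le> T a x}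
    \<or> k \<le> card (excess a x) + card {y \<in> best k - {x}. K0 - 1 \<le> T a y \<and> T a y \<le> T a x}"
proof (rule ccontr)
  assume neg: "\<not> ?thesis"
  interpret threshold_run n k c0 Q v "ord a" by (rule threshold_run)
  interpret K: keyed_order p n "T a" by (rule keyed_order)
  have x1: "x \<in> {1..n}" "rk x < k" using x by (auto simp: top_set_def)
  have index: "\<exists>j<n. ord a ! j = z" if "z \<in> {1..n}" for z
  proof -
    have "z \<in> set (ord a)" using that K.set_ord by simp
    thus ?thesis unfolding in_set_conv_nth K.length_ord by blast
  qed
  obtain i where i: "i < n" "ord a ! i = x" using index[OF x1(1)] by blast
  have before: "\<exists>j<s. ord a ! j = z" if "z \<in> {1..n}" "T a z < T a (ord a ! s)" "s < n" for z s
  proof -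
    from index[OF that(1)] obtain j where j: "j < n" "ord a ! j = z" by blast
    have "\<not> s \<le> j" using K.T_mono[of s j] j that(2) by auto
    hence "j < s" by simp
    thus ?thesis using j by blast
  qed
  have set_take: "set (take s (ord a)) = (\<lambda>j. ord a ! j) ` {..<s}" if "s \<le> n" for s
    using that K.length_ord nth_image[of s "ord a"] by (simp add: atLeast0LessThan)
  have lev: "T a x \<le> level p n i" using level_index(1)[OF i(1), of a] i by simp
  have "passes i"
    unfolding passes_def
  proof
    show "c0 \<le> i" using lev neg level_ge_iff[of i] by simp
    \<comment> \<open>Two approximations, both on the safe side: better elements seen before x have
      keys at most \<open>T a x\<close>, and the level at x is at least \<open>T a x\<close>, so the
      actual quota is at least \<open>q (T a x)\<close>.\<close>
    have "{z \<in> set (take i (ord a)). beats v z (ord a ! i)} \<subseteq> {y \<in> best (rk x). T a y \<le> T a x}"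
    proof
      fix z assume z: "z \<in> {z \<in> set (take i (ord a)). beats v z (ord a ! i)}"
      then obtain j where j: "j < i" "z = ord a ! j" using set_take[of i] i by auto
      have z1: "z \<in> {1..n}" using K.nth_in[of j] j i by simp
      hence "rk z < rk x" using z i rank_of_less_iff[OF z1 x1(1)] by simp
      moreover have "T a z \<le> T a x" using K.T_mono[of j i] j i by simp
      ultimately show "z \<in> {y \<in> best (rk x). T a y \<le> T a x}" using z1 by (simp add: top_set_def)
    qed
    hence "card {z \<in> set (take i (ord a)). beats v z (ord a ! i)} \<le> card {y \<in> best (rk x). T a y \<le> T a x}"
      by (intro card_mono) (auto simp: finite_top)
    also have "\<dots> < q (T a x)" using neg by simp
    also have "\<dots> \<le> Q i" unfolding Q_def using lev neg by (intro q_mono) auto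
    finally show "card {z \<in> set (take i (ord a)). beats v z (ord a ! i)} < Q i" .
  qed
  hence "k \<le> card {s. s < i \<and> passes s}"
    using capacity_exhausted[OF i(1)] rej i by (simp add: accepted_set_def)
  also have "\<dots> = card ((\<lambda>s. ord a ! s) ` {s. s < i \<and> passes s})"
    using ord(1) length_ord i by (intro card_image[symmetric]) (auto simp: inj_on_def nth_eq_iff_index_eq)
  also have "\<dots> \<le> card (excess a x \<union> {y \<in> best k - {x}. K0 - 1 \<le> T a y \<and> T a y \<le> T a x})"
  proof (rule card_mono)
    show "finite (excess a x \<union> {y \<in> best k - {x}. K0 - 1 \<le> T a y \<and> T a y \<le> T a x})"
      by (auto simp: excess_def finite_top)
    show "(\<lambda>s. ord a ! s) ` {s. s < i \<and> passes s} \<subseteq> excess a x \<union> {y \<in> best k - {x}. K0 - 1 \<le> T a y \<and> T a y \<le> T a x}"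
    proof
      fix y assume "y \<in> (\<lambda>s. ord a ! s) ` {s. s < i \<and> passes s}"
      then obtain s where s: "s < i" "passes s" "y = ord a ! s" by blast
      have sn: "s < n" using s(1) i(1) by simp
      have y1: "y \<in> {1..n}" using K.nth_in[OF sn] s(3) by simp
      have Tx: "T a y \<le> T a x" using K.T_mono[of s i] s i by simp
      have ls: "K0 \<le> level p n s" using s(2) level_ge_iff[of s] by (simp add: passes_def)
      have lT: "level p n s \<le> Suc (T a y)" using level_index(2)[OF sn, of a] s(3) by simp
      hence Ty: "K0 - 1 \<le> T a y" using ls by simp
      have ne: "y \<noteq> x" using s i sn ord(1) length_ord by (auto simp: nth_eq_iff_index_eq)
      have cnt: "card {z \<in> set (take s (ord a)). beats v z y} < q (level p n s)"
        using s by (simp add: passes_def Q_def)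
      show "y \<in> excess a x \<union> {y \<in> best k - {x}. K0 - 1 \<le> T a y \<and> T a y \<le> T a x}"
      proof (cases "rk y < k")
        case True
        thus ?thesis using Ty Tx ne y1 by (auto simp: top_set_def)
      next
        case False
        \<comment> \<open>Otherwise the elements of \<open>best (k ^ 2)\<close> with keys below
          \<open>K0 - 1\<close>, at least k in number, have all been seen before y and beat it,
          whereas the quota is at most k.\<close>
        have "rk y < k ^ 2"
        proof (rule ccontr)
          assume far: "\<not> rk y < k ^ 2"
          have "{z \<in> best (k ^ 2). T a z < K0 - 1} \<subseteq> {z \<in> set (take s (ord a)). beats v z y}"
          proof
            fix z assume z: "z \<in> {z \<in> best (k ^ 2). T a z < K0 - 1}"
            hence z1: "z \<in> {1..n}" "rk z < rk y" using far by (auto simp: top_set_def)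
            have "T a z < T a (ord a ! s)" using z Ty s(3) by simp
            from before[OF z1(1) this sn] have "z \<in> set (take s (ord a))" using set_take[of s] sn by auto
            thus "z \<in> {z \<in> set (take s (ord a)). beats v z y}" using rank_of_less_iff[OF z1(1) y1] z1(2) by simp
          qed
          hence "card {z \<in> best (k ^ 2). T a z < K0 - 1} \<le> card {z \<in> set (take s (ord a)). beats v z y}"
            by (intro card_mono) auto
          also note cnt
          also have "q (level p n s) \<le> k"
            using ls lT T_less[of a y] by (intro q_le_k) auto
          finally show False using neg by simp
        qed
        moreover have "card {z \<in> best (rk y) - {x}. T a z < T a y} < q (Suc (T a y))"
        proof -
          have "{z \<in> best (rk y) - {x}. T a z < T a y} \<subseteq> {z \<in> set (take s (ord a)). beats v z y}"
          proof
            fix z assume z: "z \<in> {z \<in> best (rk y) - {x}. T a z < T a y}"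
            hence z1: "z \<in> {1..n}" "rk z < rk y" by (auto simp: top_set_def)
            have "T a z < T a (ord a ! s)" using z s(3) by simp
            from before[OF z1(1) this sn] have "z \<in> set (take s (ord a))" using set_take[of s] sn by auto
            thus "z \<in> {z \<in> set (take s (ord a)). beats v z y}" using rank_of_less_iff[OF z1(1) y1] z1(2) by simp
          qed
          hence "card {z \<in> best (rk y) - {x}. T a z < T a y} \<le> card {z \<in> set (take s (ord a)). beats v z y}"
            by (intro card_mono) auto
          also note cnt
          also have "q (level p n s) \<le> q (Suc (T a y))" using ls lT by (intro q_mono) auto
          finally show ?thesis .
        qed
        ultimately show ?thesis using False Ty y1 by (auto simp: excess_def top_set_def)
      qed
    qed
  qed
  also have "\<dots> \<le> card (excess a x) + card {y \<in> best k - {x}. K0 - 1 \<le> T a y \<and> T a y \<le> T a x}"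
    by (rule card_Un_le)
  finally show False using neg by simp
qed

section \<open>Probabilities over the random polynomial, for a fixed hash function\<close>

definition pr :: "((nat \<Rightarrow> nat) \<Rightarrow> bool) \<Rightarrow> real" where
  "pr E = real (card {a \<in> coefs p 6. E a}) / real p ^ 6"

lemma pr_eq_sum: "pr E = (\<Sum>a | a \<in> coefs p 6 \<and> E a. 1 / real p ^ 6)"
  by (simp add: pr_def)

lemma pr_mono: "(\<And>a. a \<in> coefs p 6 \<Longrightarrow> E a \<Longrightarrow> E' a) \<Longrightarrow> pr E \<le> pr E'"
  unfolding pr_def 
  by (intro divide_right_mono of_nat_mono card_mono) (auto simp: finite_coefs)

lemma pr_or: "pr (\<lambda>a. E a \<or> E' a) \<le> pr E + pr E'"
proof -
  have "{a \<in> coefs p 6. E a \<or> E' a} = {a \<in> coefs p 6. E a} \<union> {a \<in> coefs p 6. E' a}" by auto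
  thus ?thesis unfolding pr_def
    by (simp add: card_Un_le divide_right_mono flip: add_divide_distrib of_nat_add)
qed

lemma pr_bex: "finite I \<Longrightarrow> pr (\<lambda>a. \<exists>i\<in>I. E i a) \<le> (\<Sum>i\<in>I. pr (E i))"
proof (induction I rule: finite_induct)
  case empty
  show ?case by (simp add: pr_def)
next
  case (insert i I)
  have "pr (\<lambda>a. \<exists>i\<in>insert i I. E i a) = pr (\<lambda>a. E i a \<or> (\<exists>i\<in>I. E i a))" by simp
  also have "\<dots> \<le> pr (E i) + pr (\<lambda>a. \<exists>i\<in>I. E i a)" by (rule pr_or)
  finally show ?case using insert by simp
qed

lemma pr_rectangle:
  assumes X: "X \<subseteq> best (k ^ 2)" "card X \<le> 6" and S: "\<And>x. x \<in> X \<Longrightarrow> S x \<subseteq> {..<p}"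
  shows "pr (\<lambda>a. \<forall>x\<in>X. T a x \<in> S x) = (\<Prod>x\<in>X. real (card (S x)) / real p)"
proof -
  have finX: "finite X" using X(1) finite_top by (rule finite_subset)
  have "card {a \<in> coefs p 6. \<forall>x\<in>X. T a x \<in> S x} * p ^ card X = p ^ 6 * (\<Prod>x\<in>X. card (S x))"
    using p h inj_on_subset[OF inj X(1)] finX X(2) S by (intro card_spread_key_in) auto
  hence "real (card {a \<in> coefs p 6. \<forall>x\<in>X. T a x \<in> S x}) * real p ^ card X = real p ^ 6 * (\<Prod>x\<in>X. real (card (S x)))"
    by (simp flip: of_nat_power of_nat_mult of_nat_prod)
  thus ?thesis using p0 finX by (simp add: pr_def prod_dividef field_simps)
qed

text \<open>Two prescribed keys and joint events of four counted elements together exhaust the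
  6-wise independence. The prescription enters through the weights.\<close>

lemma weighted_counts:
  assumes F: "F \<subseteq> best (k ^ 2)" "card F \<le> 2" "\<And>x. x \<in> F \<Longrightarrow> \<kappa> x < p"
    and D: "D \<subseteq> best (k ^ 2)" "D \<inter> F = {}" and S: "S \<subseteq> {..<p}"
  shows "weighted_counts (coefs p 6) D (\<lambda>z a. T a z \<in> S)
    (\<lambda>a. if \<forall>x\<in>F. T a x = \<kappa> x then 1 / real p ^ 6 else 0) ((1 / real p) ^ card F) (real (card S) / real p) 4"
proof
  show "finite (coefs p 6)" by (rule finite_coefs)
  show "finite D" using D(1) finite_top by (rule finite_subset)
  have "card S \<le> p" using card_mono[OF _ S] by simp
  thus "real (card S) / real p \<le> 1" using p0 by (simp add: divide_le_eq_1)
  fix R assume R: "R \<subseteq> D" "card R \<le> 4"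
  have fin: "finite F" "finite R" using F(1) R(1) D(1) finite_top finite_subset by metis+
  define S' where "S' x = (if x \<in> F then {\<kappa> x} else S)" for x
  have disj: "F \<inter> R = {}" using D(2) R(1) by blast
  have "(\<Sum>a | a \<in> coefs p 6 \<and> (\<forall>z\<in>R. T a z \<in> S). if \<forall>x\<in>F. T a x = \<kappa> x then 1 / real p ^ 6 else 0)
      = (\<Sum>a | a \<in> coefs p 6 \<and> (\<forall>x\<in>F \<union> R. T a x \<in> S' x). 1 / real p ^ 6)"
    by (rule sum.mono_neutral_cong_right)
      (use disj in \<open>auto simp: S'_def finite_coefs split: if_splits\<close>)
  also have "\<dots> = pr (\<lambda>a. \<forall>x\<in>F \<union> R. T a x \<in> S' x)" by (simp only: pr_eq_sum)
  also have "\<dots> = (\<Prod>x\<in>F \<union> R. real (card (S' x)) / real p)"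
  proof (rule pr_rectangle)
    show "F \<union> R \<subseteq> best (k ^ 2)" using F D R by blast
    show "card (F \<union> R) \<le> 6" using card_Un_le[of F R] F(2) R(2) by linarith
  qed (use F(3) S in \<open>auto simp: S'_def\<close>)
  also have "\<dots> = (\<Prod>x\<in>F. real (card (S' x)) / real p) * (\<Prod>x\<in>R. real (card (S' x)) / real p)"
    by (rule prod.union_disjoint) (use fin disj in auto)
  also have "(\<Prod>x\<in>F. real (card (S' x)) / real p) = (1 / real p) ^ card F" by (simp add: S'_def)
  also have "(\<Prod>x\<in>R. real (card (S' x)) / real p) = (\<Prod>x\<in>R. real (card S) / real p)"
    by (rule prod.cong) (use disj in \<open>auto simp: S'_def\<close>)
  also have "\<dots> = (real (card S) / real p) ^ card R" by simp
  finally show "(\<Sum>a | a \<in> coefs p 6 \<and> (\<forall>z\<in>R. T a z \<in> S). if \<forall>x\<in>F. T a x = \<kappa> x then 1 / real p ^ 6 else 0)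
      = (1 / real p) ^ card F * (real (card S) / real p) ^ card R" .
qed auto

lemma pr_tail:
  assumes F: "F \<subseteq> best (k ^ 2)" "card F \<le> 2" "\<And>x. x \<in> F \<Longrightarrow> \<kappa> x < p"
    and D: "D \<subseteq> best (k ^ 2)" "D \<inter> F = {}" and S: "S \<subseteq> {..<p}" and d: "0 < d"
    and E: "\<And>a. \<forall>x\<in>F. T a x = \<kappa> x \<Longrightarrow> E a \<Longrightarrow> d \<le> \<bar>real (card {z \<in> D. T a z \<in> S}) - u\<bar>"
    and u: "u = real (card D) * (real (card S) / real p)"
  shows "pr (\<lambda>a. (\<forall>x\<in>F. T a x = \<kappa> x) \<and> E a) \<le> (1 / real p) ^ card F * u / d ^ 2"
    and "pr (\<lambda>a. (\<forall>x\<in>F. T a x = \<kappa> x) \<and> E a) \<le> (1 / real p) ^ card F * (3 * u ^ 2 + u) / d ^ 4"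
proof -
  interpret weighted_counts "coefs p 6" D "\<lambda>z a. T a z \<in> S"
    "\<lambda>a. if \<forall>x\<in>F. T a x = \<kappa> x then 1 / real p ^ 6 else 0" "(1 / real p) ^ card F" "real (card S) / real p" 4
    using F D S by (rule weighted_counts)
  let ?P = "\<lambda>a. (\<forall>x\<in>F. T a x = \<kappa> x) \<and> E a"
  have eq: "(\<Sum>a | a \<in> coefs p 6 \<and> ?P a. if \<forall>x\<in>F. T a x = \<kappa> x then 1 / real p ^ 6 else 0) = pr ?P"
    unfolding pr_eq_sum by (rule sum.cong) auto
  have P: "d \<le> \<bar>N a - m * (real (card S) / real p)\<bar>" if "?P a" for a
    using E that unfolding u by blast
  show "pr ?P \<le> (1 / real p) ^ card F * u / d ^ 2"
    unfolding eq[symmetric] u by (rule tail2) (use d P in auto)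
  show "pr ?P \<le> (1 / real p) ^ card F * (3 * u ^ 2 + u) / d ^ 4"
    unfolding eq[symmetric] u by (rule tail4) (use d P in auto)
qed

end

text \<open>After the first term the sum telescopes, because 1/(a+t)^2 <= (1/a - 1/(a+t))/t.\<close>

lemma sum_inverse_square_le:
  fixes t m :: real
  assumes "0 < t" "0 < m"
  shows "(\<Sum>g<G. 1 / (real g * t + m) ^ 2) \<le> 1 / m ^ 2 + 1 / (t * m)"
proof -
  have "(\<Sum>g<Suc G. 1 / (real g * t + m) ^ 2) \<le> 1 / m ^ 2 + (1 / m - 1 / (real G * t + m)) / t" for G
  proof (induction G)
    case (Suc G)
    define a where "a = real G * t + m"
    have a: "a > 0" unfolding a_def using assms by (intro add_nonneg_pos) auto
    have "1 / (a + t) ^ 2 \<le> 1 / (a * (a + t))"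
      using a assms(1) by (intro divide_left_mono) (auto simp: power2_eq_square intro: mult_right_mono)
    also have "\<dots> = (1 / a - 1 / (a + t)) / t"
    proof -
      have "1 / a - 1 / (a + t) = t / (a * (a + t))" using a assms(1) by (simp add: diff_frac_eq)
      thus ?thesis using assms(1) by simp
    qed
    finally have "1 / (a + t) ^ 2 \<le> (1 / a - 1 / (a + t)) / t" .
    hence "1 / (real (Suc G) * t + m) ^ 2 \<le> (1 / (real G * t + m) - 1 / (real (Suc G) * t + m)) / t"
      by (simp add: a_def algebra_simps)
    moreover have "1 / m ^ 2 + (1 / m - 1 / (real (Suc G) * t + m)) / t
      = 1 / m ^ 2 + (1 / m - 1 / (real G * t + m)) / t + (1 / (real G * t + m) - 1 / (real (Suc G) * t + m)) / t"
      by (simp add: diff_divide_distrib)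
    moreover have "(\<Sum>g<Suc (Suc G). 1 / (real g * t + m) ^ 2)
      = (\<Sum>g<Suc G. 1 / (real g * t + m) ^ 2) + 1 / (real (Suc G) * t + m) ^ 2"
      by (rule sum.lessThan_Suc)
    ultimately show ?case using Suc.IH by linarith
  qed simp
  also have "(1 / m - 1 / (real G * t + m)) / t \<le> 1 / (t * m)" for G
  proof -
    have "0 \<le> 1 / (real G * t + m)" using assms by simp
    hence "(1 / m - 1 / (real G * t + m)) / t \<le> (1 / m) / t"
      using assms(1) by (intro divide_right_mono) auto
    thus ?thesis by (simp add: mult.commute)
  qed
  finally have *: "(\<Sum>g<Suc G. 1 / (real g * t + m) ^ 2) \<le> 1 / m ^ 2 + 1 / (t * m)" for G by simp
  show ?thesis
  proof (cases G)
    case 0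
    thus ?thesis using assms by simp
  qed (use * in auto)
qed

section \<open>The probability of each cause of rejection\<close>

context secretary_params
begin

lemma best_mono: "i \<le> j \<Longrightarrow> best i \<subseteq> best j"
  by (auto simp: top_set_def)

lemma k_le: "k \<le> k ^ 2" "k \<le> n"
proof -
  show "k \<le> k ^ 2" using k(1) by (simp add: power2_eq_square)
  thus "k \<le> n" using k(3) by simp
qed

lemma pr_single:
  assumes "x \<in> best (k ^ 2)" "S \<subseteq> {..<p}"
  shows "pr (\<lambda>a. T a x \<in> S) = real (card S) / real p"
  using pr_rectangle[of "{x}" "\<lambda>_. S"] assms by simp

text \<open>Absorbs the linear term of the fourth moment bound at the cost of r^2/10. It will be
  applied with r at least 13, by \<open>ratio_ge'\<close>.\<close>

lemma cubic_le: "0 \<le> u \<Longrightarrow> u \<le> r \<Longrightarrow> 10 \<le> r \<Longrightarrow> 3 * u ^ 2 + u \<le> 31 / 10 * (r::real) ^ 2"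
proof -
  assume u: "0 \<le> u" "u \<le> r" "10 \<le> r"
  have "u ^ 2 \<le> r ^ 2" using u by (intro power_mono) auto
  moreover have "10 * r \<le> r ^ 2" using u mult_right_mono[of 10 r r] by (simp add: power2_eq_square)
  ultimately show ?thesis using u by linarith
qed

text \<open>The expected count is at least 10 k, so falling below k is a deviation by nine tenths of
  the mean. No key is prescribed, and Chebyshev's inequality is sufficient.\<close>

lemma pr_few_best: "pr (\<lambda>a. card {y \<in> best (k ^ 2). T a y < K0 - 1} < k) \<le> 1 / (8 * real k)"
proof -
  define u where "u = real (k ^ 2) * (real (K0 - 1) / real p)"
  have "10 \<le> real k * real (K0 - 1) / real p" using ratio_ge'[of "K0 - 1"] by linarith
  hence "real k * 10 \<le> real k * (real k * real (K0 - 1) / real p)" by (rule mult_left_mono) simp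
  also have "\<dots> = u" by (simp add: u_def power2_eq_square)
  finally have u: "10 * real k \<le> u" by simp
  have k0: "real k > 0" using k(1) by simp
  have "pr (\<lambda>a. (\<forall>x\<in>{}. T a x = 0) \<and> card {y \<in> best (k ^ 2). T a y < K0 - 1} < k)
    \<le> (1 / real p) ^ card ({}::nat set) * u / (9 / 10 * u) ^ 2"
  proof (rule pr_tail(1)[where D = "best (k ^ 2)" and S = "{..<K0 - 1}"])
    show "0 < 9 / 10 * u" using u k0 by simp
    show "u = real (card (best (k ^ 2))) * (real (card {..<K0 - 1}) / real p)"
      using k(3) by (simp add: u_def card_top)
    fix a assume "card {y \<in> best (k ^ 2). T a y < K0 - 1} < k"
    hence "real (card {y \<in> best (k ^ 2). T a y < K0 - 1}) \<le> u / 10" using u by simp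
    thus "9 / 10 * u \<le> \<bar>real (card {z \<in> best (k ^ 2). T a z \<in> {..<K0 - 1}}) - u\<bar>" by simp
  qed (use K0 in auto)
  also have "\<dots> = 100 / (81 * u)" using u k0 by (simp add: field_simps power2_eq_square)
  also have "\<dots> \<le> 100 / (81 * (10 * real k))" using u k0 by (intro divide_left_mono) auto
  also have "\<dots> \<le> 1 / (8 * real k)" using k0 by (simp add: field_simps)
  finally show ?thesis by simp
qed

text \<open>Let t be the share of the keys up to l and g the distance of the rank from k. Then
  \<open>d\<close> is the guaranteed quota k t - \<mu> sqrt(k t) - 2 minus the expected number (k -
  g) t of better elements seen; the 2 consists of the 1 in \<open>quota\<close> and of the rounding
  in \<open>q\<close>. For positive d the fourth moment bounds the chance that the threshold is too
  high.\<close>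

definition miss :: "nat \<Rightarrow> nat \<Rightarrow> real" where
  "miss g l = (let t = real (Suc l) / real p; d = real g * t - \<mu> * sqrt (real k * t) - 2
     in if 0 < d then min 1 (31 / 10 * (real k * t) ^ 2 / d ^ 4) else 1)"

lemma pr_threshold_too_high:
  assumes x: "x \<in> best k" and l: "l \<in> {K0..<p}"
  shows "pr (\<lambda>a. T a x = l \<and> q l \<le> card {y \<in> best (rk x). T a y \<le> l}) \<le> miss (k - rk x) l / real p"
proof -
  define t where "t = real (Suc l) / real p"
  define d where "d = real (k - rk x) * t - \<mu> * sqrt (real k * t) - 2"
  have t0: "0 < t" using p0 by (simp add: t_def)
  have rx: "rk x < k" "x \<in> {1..n}" using x by (auto simp: top_set_def)
  have lK: "K0 - 1 \<le> l" using l by auto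
  have "13 \<le> real k * real (Suc l) / real p" by (rule ratio_ge') (use l in auto)
  hence r: "13 \<le> real k * t" by (simp add: t_def)
  let ?E = "\<lambda>a. q l \<le> card {y \<in> best (rk x). T a y \<le> l}"
  have triv: "pr (\<lambda>a. T a x = l \<and> ?E a) \<le> 1 / real p"
  proof -
    have "pr (\<lambda>a. T a x = l \<and> ?E a) \<le> pr (\<lambda>a. T a x \<in> {l})" by (rule pr_mono) simp
    also have "\<dots> = real (card {l}) / real p" using x best_mono[OF k_le(1)] l by (intro pr_single) auto
    finally show ?thesis by simp
  qed
  show ?thesis
  proof (cases "0 < d")
    case False
    thus ?thesis using triv by (simp add: miss_def Let_def d_def t_def)
  next
    case True
    define u where "u = real (rk x) * t"
    have "pr (\<lambda>a. (\<forall>x\<in>{x}. T a x = l) \<and> ?E a) \<le> (1 / real p) ^ card {x} * (3 * u ^ 2 + u) / d ^ 4"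
    proof (rule pr_tail(2)[where D = "best (rk x)" and S = "{..l}"])
      show "{x} \<subseteq> best (k ^ 2)" using x best_mono[OF k_le(1)] by blast
      show "best (rk x) \<subseteq> best (k ^ 2)" using rx k_le by (intro best_mono) simp
      show "u = real (card (best (rk x))) * (real (card {..l}) / real p)"
        using rx k_le by (simp add: u_def t_def card_top)
      fix a assume "?E a"
      hence "real (q l) \<le> real (card {z \<in> best (rk x). T a z \<in> {..l}})" by simp
      moreover have "quota (real k * t) - 1 \<le> real (q l)" using real_q_ge[OF lK] by (simp add: t_def)
      moreover have "real (k - rk x) * t = real k * t - u" using rx by (simp add: u_def algebra_simps of_nat_diff)
      ultimately show "d \<le> \<bar>real (card {z \<in> best (rk x). T a z \<in> {..l}}) - u\<bar>"
        unfolding d_def quota_def by linarith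
    qed (use l True in \<open>auto simp: top_set_def\<close>)
    also have "\<dots> \<le> (1 / real p) ^ card {x} * (31 / 10 * (real k * t) ^ 2) / d ^ 4"
    proof (intro divide_right_mono mult_left_mono cubic_le)
      show "u \<le> real k * t" unfolding u_def using rx t0 by (intro mult_right_mono) auto
    qed (use r t0 in \<open>auto simp: u_def\<close>)
    finally have "pr (\<lambda>a. T a x = l \<and> ?E a) \<le> (31 / 10 * (real k * t) ^ 2 / d ^ 4) / real p"
      by (simp add: mult_ac)
    moreover have "miss (k - rk x) l = min 1 (31 / 10 * (real k * t) ^ 2 / d ^ 4)"
      using True by (simp add: miss_def Let_def d_def t_def)
    ultimately show ?thesis using triv by (simp add: min_def)
  qed
qed

text \<open>Divided by p, a bound on the expected number of outsiders with key l: the estimate of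
  \<open>pr_excess_element\<close>, summed over all ranks by
  \<open>sum_inverse_square_le\<close>.\<close>

definition psi :: "nat \<Rightarrow> real" where
  "psi l = 31 / 10 * (1 / \<mu> ^ 4 + sqrt (real k * real l / real p) / (real l / real p * \<mu> ^ 3))"

definition expected_excess :: real where
  "expected_excess = (\<Sum>l\<in>{K0 - 1..<p}. psi l / real p)"

text \<open>An outsider at rank k + g passes only if the count of better elements falls short of its
  mean by \<open>g * t + \<mu> * sqrt r\<close>. That mean also grows with g; only with the fourth
  moment does the bound decay like 1/g^2.\<close>

lemma pr_excess_element:
  assumes x: "x \<in> best k" "l < p" and y: "y \<in> best (k ^ 2)" "k \<le> rk y" and l': "l' \<in> {K0 - 1..<p}"
  defines "r \<equiv> real k * real l' / real p"
  shows "pr (\<lambda>a. T a x = l \<and> T a y = l' \<and> card {z \<in> best (rk y) - {x}. T a z < l'} < q (Suc l'))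
    \<le> (1 / real p) ^ 2 * (31 / 10 * (r / \<mu> ^ 2) * (1 / (real (rk y - k) * (real l' / real p) + \<mu> * sqrt r) ^ 2))"
proof -
  define t where "t = real l' / real p"
  define g where "g = real (rk y - k)"
  define d where "d = g * t + \<mu> * sqrt r"
  define u where "u = real (rk y - 1) * t"
  have r_t: "r = real k * t" by (simp add: r_def t_def)
  have r13: "13 \<le> r" and rmu: "9 / 4 * \<mu> ^ 2 \<le> r" using ratio_ge'[of l'] ratio_ge[of l'] l' by (auto simp: r_def)
  have t: "0 \<le> t" "t \<le> 1" using p0 l' by (auto simp: t_def)
  have "\<mu> ^ 2 \<le> 9 / 4 * \<mu> ^ 2" by simp
  with rmu have mu_r: "\<mu> \<le> sqrt r" by (intro real_le_rsqrt) linarith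
  have d0: "0 < d" unfolding d_def g_def using t r13 mu(1) by (intro add_nonneg_pos mult_pos_pos mult_nonneg_nonneg) auto
  have ry: "y \<in> {1..n}" "rk y < k ^ 2" using y by (auto simp: top_set_def)
  have rx: "rk x < k" "x \<in> {1..n}" using x by (auto simp: top_set_def)
  have xy: "x \<noteq> y" using rx y(2) by auto
  have rky: "real (rk y) = real k + g" using y(2) by (simp add: g_def of_nat_diff)
  let ?f = "\<lambda>z. if z = x then l else l'"
  let ?D = "best (rk y) - {x}"
  let ?E = "\<lambda>a. card {z \<in> ?D. T a z < l'} < q (Suc l')"
  have "pr (\<lambda>a. (\<forall>z\<in>{x, y}. T a z = ?f z) \<and> ?E a) \<le> (1 / real p) ^ card {x, y} * (3 * u ^ 2 + u) / d ^ 4"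
  proof (rule pr_tail(2)[where D = ?D and S = "{..<l'}"])
    show "{x, y} \<subseteq> best (k ^ 2)" using x y best_mono[OF k_le(1)] by blast
    show "?D \<subseteq> best (k ^ 2)" using best_mono[of "rk y" "k ^ 2"] ry by auto
    have "x \<in> best (rk y)" using rx y(2) by (simp add: top_set_def)
    hence "card ?D = rk y - 1" using ry k(3) by (simp add: card_top finite_top)
    thus "u = real (card ?D) * (real (card {..<l'}) / real p)"
      by (simp add: u_def t_def)
    fix a assume "?E a"
    hence "real (card {z \<in> ?D. T a z \<in> {..<l'}}) + 1 \<le> real (q (Suc l'))" by simp
    also have "real (q (Suc l')) \<le> quota (real k * real (Suc (Suc l')) / real p)"
      using l' by (intro real_q_le) auto
    \<comment> \<open>Passing from l' to \<open>Suc (Suc l')\<close> increases the expected count by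
      2k/p <= 1, which the 1 subtracted in \<open>quota\<close> makes up for.\<close>
    also have "\<dots> \<le> r + 1 - \<mu> * sqrt r - 1"
    proof -
      have eq: "real k * real (Suc (Suc l')) / real p = r + real (2 * k) / real p"
        by (simp add: r_def add_divide_distrib distrib_left)
      moreover have "0 \<le> real (2 * k) / real p" "real (2 * k) / real p \<le> 1" using k(2) p0 by (auto simp: divide_le_eq_1)
      moreover from this have "\<mu> * sqrt r \<le> \<mu> * sqrt (r + real (2 * k) / real p)" using mu(1) by simp
      ultimately show ?thesis unfolding quota_def eq by linarith
    qed
    finally have N: "real (card {z \<in> ?D. T a z \<in> {..<l'}}) \<le> r - \<mu> * sqrt r - 1" by simp
    \<comment> \<open>One is subtracted because x itself is among the elements better than y. The
      loss t <= 1 is covered by the strict inequality in the event.\<close>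
    have "u = (real k + g - 1) * t" using rky y(2) k(1) by (simp add: u_def of_nat_diff)
    hence "u = r + g * t - t" by (simp add: r_t algebra_simps)
    thus "d \<le> \<bar>real (card {z \<in> ?D. T a z \<in> {..<l'}}) - u\<bar>"
      using N t unfolding d_def by linarith
  qed (use l' x xy d0 in \<open>auto simp: top_set_def card_insert_if split: if_splits\<close>)
  \<comment> \<open>Since \<mu> <= sqrt r, the mean is at most sqrt r / \<mu> times d. This cancels
    two of the four powers of d.\<close>
  also have "\<dots> \<le> (1 / real p) ^ card {x, y} * (31 / 10 * (r / \<mu> ^ 2 * d ^ 2)) / d ^ 4"
  proof (intro divide_right_mono mult_left_mono)
    define U where "U = (real k + g) * t"
    have "3 * u ^ 2 + u \<le> 31 / 10 * U ^ 2"
    proof (rule cubic_le)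
      show "0 \<le> u" using t by (simp add: u_def)
      show "u \<le> U" unfolding u_def U_def rky[symmetric] using t by (intro mult_right_mono) auto
      have "0 \<le> g * t" using t by (simp add: g_def)
      thus "10 \<le> U" using r13 by (simp add: U_def r_t algebra_simps)
    qed
    also have "U ^ 2 \<le> r / \<mu> ^ 2 * d ^ 2"
    proof -
      have "0 \<le> g * t" using t by (simp add: g_def)
      hence "g * t * \<mu> \<le> g * t * sqrt r" using mu_r by (intro mult_left_mono)
      moreover have "sqrt r * sqrt r = r" using r13 by simp
      ultimately have "U * \<mu> \<le> sqrt r * d"
        by (simp add: U_def d_def r_t algebra_simps)
      moreover have "0 \<le> U * \<mu>" using t mu(1) by (simp add: U_def g_def)
      ultimately have "(U * \<mu>) ^ 2 \<le> (sqrt r * d) ^ 2" by (intro power_mono)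
      thus ?thesis using mu(1) r13 by (simp add: field_simps power_mult_distrib)
    qed
    finally show "3 * u ^ 2 + u \<le> 31 / 10 * (r / \<mu> ^ 2 * d ^ 2)" by simp
  qed (use d0 in auto)
  also have "\<dots> = (1 / real p) ^ 2 * (31 / 10 * (r / \<mu> ^ 2) * (1 / d ^ 2))"
    using xy d0 by (simp add: field_simps power4_eq_xxxx power2_eq_square)
  finally show ?thesis
    using xy unfolding d_def g_def t_def by (simp add: conj_assoc)
qed

text \<open>Markov's inequality for the number of outsiders on the event that x has key l. The mass
  1/p of this event is the factor \<open>real p\<close> in the denominator.\<close>

lemma pr_excess_large:
  assumes x: "x \<in> best k" "l < p" and z: "0 < z"
  shows "pr (\<lambda>a. T a x = l \<and> z \<le> real (card (excess a x))) \<le> expected_excess / (z * real p)"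
proof -
  let ?B = "best (k ^ 2) - best k"
  let ?E = "\<lambda>a y l'. T a x = l \<and> T a y = l' \<and> card {z \<in> best (rk y) - {x}. T a z < l'} < q (Suc l')"
  have finB: "finite ?B" using finite_top by simp
  have sub: "excess a x \<subseteq> ?B" for a by (auto simp: excess_def top_set_def)
  have "z * pr (\<lambda>a. T a x = l \<and> z \<le> real (card (excess a x)))
      = (\<Sum>a | a \<in> coefs p 6 \<and> T a x = l \<and> z \<le> real (card (excess a x)). z / real p ^ 6)"
    by (simp add: pr_eq_sum sum_distrib_left)
  also have "\<dots> \<le> (\<Sum>a | a \<in> coefs p 6 \<and> T a x = l \<and> z \<le> real (card (excess a x)). real (card (excess a x)) / real p ^ 6)"
    by (intro sum_mono divide_right_mono) auto
  also have "\<dots> \<le> (\<Sum>a | a \<in> coefs p 6 \<and> T a x = l. real (card (excess a x)) / real p ^ 6)"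
    by (intro sum_mono2) (auto simp: finite_coefs)
  also have "\<dots> = (\<Sum>a | a \<in> coefs p 6 \<and> T a x = l. \<Sum>y\<in>?B. if y \<in> excess a x then 1 / real p ^ 6 else 0)"
  proof (rule sum.cong[OF refl])
    fix a
    have "(\<Sum>y\<in>?B. if y \<in> excess a x then 1 / real p ^ 6 else 0) = (\<Sum>y\<in>?B \<inter> excess a x. 1 / real p ^ 6)"
      by (rule sum.inter_restrict[OF finB, symmetric])
    also have "?B \<inter> excess a x = excess a x" using sub by blast
    finally show "real (card (excess a x)) / real p ^ 6 = (\<Sum>y\<in>?B. if y \<in> excess a x then 1 / real p ^ 6 else 0)"
      by simp
  qed
  also have "\<dots> = (\<Sum>y\<in>?B. \<Sum>a | a \<in> coefs p 6 \<and> T a x = l. if y \<in> excess a x then 1 / real p ^ 6 else 0)"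
    by (rule sum.swap)
  also have "\<dots> = (\<Sum>y\<in>?B. pr (\<lambda>a. T a x = l \<and> y \<in> excess a x))"
  proof (rule sum.cong[OF refl])
    fix y
    show "(\<Sum>a | a \<in> coefs p 6 \<and> T a x = l. if y \<in> excess a x then 1 / real p ^ 6 else 0) = pr (\<lambda>a. T a x = l \<and> y \<in> excess a x)"
      unfolding pr_eq_sum by (rule sum.mono_neutral_cong_right) (auto simp: finite_coefs)
  qed
  also have "\<dots> \<le> (\<Sum>y\<in>?B. \<Sum>l'\<in>{K0 - 1..<p}. (1 / real p) ^ 2 * (31 / 10 * (real k * real l' / real p / \<mu> ^ 2)
       * (1 / (real (rk y - k) * (real l' / real p) + \<mu> * sqrt (real k * real l' / real p)) ^ 2)))"
  proof (rule sum_mono)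
    fix y assume y: "y \<in> ?B"
    have "pr (\<lambda>a. T a x = l \<and> y \<in> excess a x) \<le> pr (\<lambda>a. \<exists>l'\<in>{K0 - 1..<p}. ?E a y l')"
      by (rule pr_mono) (use T_less in \<open>auto simp: excess_def\<close>)
    also have "\<dots> \<le> (\<Sum>l'\<in>{K0 - 1..<p}. pr (\<lambda>a. ?E a y l'))" by (rule pr_bex) simp
    also have "\<dots> \<le> (\<Sum>l'\<in>{K0 - 1..<p}. (1 / real p) ^ 2 * (31 / 10 * (real k * real l' / real p / \<mu> ^ 2)
       * (1 / (real (rk y - k) * (real l' / real p) + \<mu> * sqrt (real k * real l' / real p)) ^ 2)))"
      using x y by (intro sum_mono pr_excess_element) (auto simp: top_set_def)
    finally show "pr (\<lambda>a. T a x = l \<and> y \<in> excess a x) \<le> \<dots>" .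
  qed
  also have "\<dots> = (\<Sum>l'\<in>{K0 - 1..<p}. \<Sum>y\<in>?B. (1 / real p) ^ 2 * (31 / 10 * (real k * real l' / real p / \<mu> ^ 2)
       * (1 / (real (rk y - k) * (real l' / real p) + \<mu> * sqrt (real k * real l' / real p)) ^ 2)))"
    by (rule sum.swap)
  also have "\<dots> \<le> (\<Sum>l'\<in>{K0 - 1..<p}. psi l' / real p * (1 / real p))"
  proof (rule sum_mono)
    fix l' assume l': "l' \<in> {K0 - 1..<p}"
    define t where "t = real l' / real p"
    define r where "r = real k * real l' / real p"
    have r_t: "r = real k * t" by (simp add: r_def t_def)
    have r13: "13 \<le> r" using ratio_ge'[of l'] l' by (auto simp: r_def)
    have "0 < l'" using l' K0(1) by auto
    hence t: "0 < t" using p0 by (simp add: t_def)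
    have m: "0 < \<mu> * sqrt r" using mu(1) r13 by simp
    \<comment> \<open>Different outsiders have different ranks, so a sum over outsiders is dominated
      by the sum over all distances g below k^2.\<close>
    have inj_rk: "inj_on (\<lambda>y. rk y - k) ?B"
    proof (rule inj_onI)
      fix y y' assume y: "y \<in> ?B" "y' \<in> ?B" "rk y - k = rk y' - k"
      have B: "?B \<subseteq> {1..n}" by (auto simp: top_set_def)
      have "\<not> rk y < k" "\<not> rk y' < k" using y(1,2) by (auto simp: top_set_def)
      hence "rk y = rk y'" using y(3) by linarith
      thus "y = y'"
        by (rule inj_onD[OF bij_betw_imp_inj_on[OF bij_betw_rank_of]]) (use y B in blast)+
    qed
    have "(\<Sum>y\<in>?B. 1 / (real (rk y - k) * t + \<mu> * sqrt r) ^ 2)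
        = (\<Sum>g\<in>(\<lambda>y. rk y - k) ` ?B. 1 / (real g * t + \<mu> * sqrt r) ^ 2)"
      by (simp add: sum.reindex[OF inj_rk])
    also have "\<dots> \<le> (\<Sum>g<k ^ 2. 1 / (real g * t + \<mu> * sqrt r) ^ 2)"
      by (rule sum_mono2) (auto simp: top_set_def)
    also have "\<dots> \<le> 1 / (\<mu> * sqrt r) ^ 2 + 1 / (t * (\<mu> * sqrt r))"
      by (rule sum_inverse_square_le[OF t m])
    finally have S: "(\<Sum>y\<in>?B. 1 / (real (rk y - k) * t + \<mu> * sqrt r) ^ 2) \<le> 1 / (\<mu> * sqrt r) ^ 2 + 1 / (t * (\<mu> * sqrt r))" .
    have "(\<Sum>y\<in>?B. (1 / real p) ^ 2 * (31 / 10 * (r / \<mu> ^ 2) * (1 / (real (rk y - k) * t + \<mu> * sqrt r) ^ 2)))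
        = (1 / real p) ^ 2 * (31 / 10 * (r / \<mu> ^ 2) * (\<Sum>y\<in>?B. 1 / (real (rk y - k) * t + \<mu> * sqrt r) ^ 2))"
      by (simp only: sum_distrib_left)
    also have "\<dots> \<le> (1 / real p) ^ 2 * (31 / 10 * (r / \<mu> ^ 2) * (1 / (\<mu> * sqrt r) ^ 2 + 1 / (t * (\<mu> * sqrt r))))"
      using r13 by (intro mult_left_mono S) auto
    also have "r / \<mu> ^ 2 * (1 / (\<mu> * sqrt r) ^ 2 + 1 / (t * (\<mu> * sqrt r))) = 1 / \<mu> ^ 4 + sqrt r / (t * \<mu> ^ 3)"
    proof -
      define s where "s = sqrt r"
      have "s > 0" "r = s ^ 2" using r13 by (auto simp: s_def)
      thus ?thesis unfolding s_def[symmetric] using t mu(1)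
        by (simp add: field_simps power2_eq_square power3_eq_cube power4_eq_xxxx)
    qed
    hence "31 / 10 * (r / \<mu> ^ 2) * (1 / (\<mu> * sqrt r) ^ 2 + 1 / (t * (\<mu> * sqrt r))) = psi l'"
      unfolding psi_def r_def[symmetric] t_def[symmetric] by (simp only: mult.assoc)
    finally show "(\<Sum>y\<in>?B. (1 / real p) ^ 2 * (31 / 10 * (real k * real l' / real p / \<mu> ^ 2)
       * (1 / (real (rk y - k) * (real l' / real p) + \<mu> * sqrt (real k * real l' / real p)) ^ 2)))
       \<le> psi l' / real p * (1 / real p)"
      unfolding r_def t_def by (simp add: power2_eq_square)
  qed
  also have "\<dots> = expected_excess / real p"
    unfolding expected_excess_def sum_divide_distrib by simp
  finally have "z * pr (\<lambda>a. T a x = l \<and> z \<le> real (card (excess a x))) \<le> expected_excess / real p" .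
  hence "pr (\<lambda>a. T a x = l \<and> z \<le> real (card (excess a x))) \<le> expected_excess / real p / z"
    using z by (subst pos_le_divide_eq) (simp_all only: mult.commute)
  thus ?thesis by (simp only: divide_divide_eq_left mult.commute)
qed

text \<open>The expected number of best elements other than x whose keys lie before
  \<open>K0 - 1\<close> or after l: these are the places that remain for outsiders.\<close>

definition off_mean :: "nat \<Rightarrow> real" where
  "off_mean l = real (k - 1) * (real (K0 - 1 + (p - 1 - l)) / real p)"

lemma off_mean_pos: "l < p \<Longrightarrow> 0 < off_mean l"
  using k(1) K0(1) p0 by (simp add: off_mean_def)

text \<open>The other k - 1 best elements lie inside or outside the window of keys, so the capacity
  runs out only if the outsiders outnumber those outside it. Then either the number outside is at
  most half its mean, which by Chebyshev accounts for the 4, or there are at least half that many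
  outsiders, which by Markov accounts for the 2.\<close>

lemma pr_capacity:
  assumes x: "x \<in> best k" and l: "l \<in> {K0..<p}"
  shows "pr (\<lambda>a. T a x = l \<and> k \<le> card (excess a x) + card {y \<in> best k - {x}. K0 - 1 \<le> T a y \<and> T a y \<le> l})
    \<le> (4 + 2 * expected_excess) / off_mean l / real p"
proof -
  define S where "S = {..<K0 - 1} \<union> {l<..<p}"
  define D where "D = best k - {x}"
  have lp: "l < p" using l by simp
  note Z = off_mean_pos[OF lp]
  have cS: "card S = K0 - 1 + (p - 1 - l)"
  proof -
    have "card S = card {..<K0 - 1} + card {l<..<p}"
      unfolding S_def using l by (intro card_Un_disjoint) auto
    thus ?thesis by simp
  qed
  have cD: "card D = k - 1" using x k_le by (simp add: D_def card_top finite_top)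
  have finD: "finite D" by (simp add: D_def finite_top)
  have split: "card {y \<in> D. K0 - 1 \<le> T a y \<and> T a y \<le> l} + card {y \<in> D. T a y \<in> S} = k - 1" for a
  proof -
    have "card ({y \<in> D. K0 - 1 \<le> T a y \<and> T a y \<le> l} \<union> {y \<in> D. T a y \<in> S})
      = card {y \<in> D. K0 - 1 \<le> T a y \<and> T a y \<le> l} + card {y \<in> D. T a y \<in> S}"
      using finD by (intro card_Un_disjoint) (auto simp: S_def)
    moreover have "{y \<in> D. K0 - 1 \<le> T a y \<and> T a y \<le> l} \<union> {y \<in> D. T a y \<in> S} = D"
      using T_less by (auto simp: S_def)
    ultimately show ?thesis using cD by simp
  qed
  let ?few = "\<lambda>a. real (card {y \<in> D. T a y \<in> S}) \<le> off_mean l / 2"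
  have "pr (\<lambda>a. T a x = l \<and> k \<le> card (excess a x) + card {y \<in> best k - {x}. K0 - 1 \<le> T a y \<and> T a y \<le> l})
    \<le> pr (\<lambda>a. (T a x = l \<and> ?few a) \<or> (T a x = l \<and> off_mean l / 2 \<le> real (card (excess a x))))"
  proof (rule pr_mono)
    fix a assume a: "T a x = l \<and> k \<le> card (excess a x) + card {y \<in> best k - {x}. K0 - 1 \<le> T a y \<and> T a y \<le> l}"
    hence "k \<le> card (excess a x) + card {y \<in> D. K0 - 1 \<le> T a y \<and> T a y \<le> l}" by (simp only: D_def)
    hence "card {y \<in> D. T a y \<in> S} \<le> card (excess a x)" using split[of a] k(1) by linarith
    thus "(T a x = l \<and> ?few a) \<or> (T a x = l \<and> off_mean l / 2 \<le> real (card (excess a x)))"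
      using a by (auto simp: not_le dest: less_imp_le)
  qed
  also have "\<dots> \<le> pr (\<lambda>a. T a x = l \<and> ?few a) + pr (\<lambda>a. T a x = l \<and> off_mean l / 2 \<le> real (card (excess a x)))"
    by (rule pr_or)
  also have "pr (\<lambda>a. T a x = l \<and> off_mean l / 2 \<le> real (card (excess a x))) \<le> expected_excess / (off_mean l / 2 * real p)"
    using x lp Z by (intro pr_excess_large) auto
  also have "pr (\<lambda>a. T a x = l \<and> ?few a) \<le> 4 / off_mean l / real p"
  proof -
    have "pr (\<lambda>a. (\<forall>x\<in>{x}. T a x = l) \<and> ?few a) \<le> (1 / real p) ^ card {x} * off_mean l / (off_mean l / 2) ^ 2"
    proof (rule pr_tail(1)[where D = D and S = S])
      show "{x} \<subseteq> best (k ^ 2)" using x best_mono[OF k_le(1)] by blast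
      show "D \<subseteq> best (k ^ 2)" using best_mono[OF k_le(1)] by (auto simp: D_def)
      show "off_mean l = real (card D) * (real (card S) / real p)" by (simp add: off_mean_def cS cD)
      fix a assume "?few a"
      thus "off_mean l / 2 \<le> \<bar>real (card {z \<in> D. T a z \<in> S}) - off_mean l\<bar>" by simp
    qed (use l K0 Z in \<open>auto simp: D_def S_def\<close>)
    also have "\<dots> = 4 / off_mean l / real p" using Z by (simp add: field_simps power2_eq_square)
    finally show ?thesis by simp
  qed
  finally show ?thesis by (simp add: add_divide_distrib mult.commute)
qed

text \<open>One summand for each alternative of \<open>rejected_cases\<close>. Only the one with
  \<open>miss\<close> involves the rank.\<close>

definition reject_bound :: "nat \<Rightarrow> real" where
  "reject_bound g = real K0 / real p + 1 / (8 * real k) + (\<Sum>l\<in>{K0..<p}. miss g l / real p)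
    + (\<Sum>l\<in>{K0..<p}. (4 + 2 * expected_excess) / off_mean l / real p)"

theorem pr_rejected:
  assumes x: "x \<in> best k"
  shows "pr (\<lambda>a. x \<notin> accepted_set a) \<le> reject_bound (k - rk x)"
proof -
  let ?A = "\<lambda>a. T a x \<in> {..<K0}"
  let ?B = "\<lambda>a. card {y \<in> best (k ^ 2). T a y < K0 - 1} < k"
  let ?C = "\<lambda>l a. T a x = l \<and> q l \<le> card {y \<in> best (rk x). T a y \<le> l}"
  let ?D = "\<lambda>l a. T a x = l \<and> k \<le> card (excess a x) + card {y \<in> best k - {x}. K0 - 1 \<le> T a y \<and> T a y \<le> l}"
  have "pr (\<lambda>a. x \<notin> accepted_set a)
    \<le> pr (\<lambda>a. (?A a \<or> ?B a) \<or> ((\<exists>l\<in>{K0..<p}. ?C l a) \<or> (\<exists>l\<in>{K0..<p}. ?D l a)))"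
  proof (rule pr_mono)
    fix a assume "x \<notin> accepted_set a"
    from rejected_cases[OF x this] T_less[of a x]
    show "(?A a \<or> ?B a) \<or> ((\<exists>l\<in>{K0..<p}. ?C l a) \<or> (\<exists>l\<in>{K0..<p}. ?D l a))"
      by (cases "T a x < K0") auto
  qed
  also have "\<dots> \<le> (pr ?A + pr ?B) + ((\<Sum>l\<in>{K0..<p}. pr (?C l)) + (\<Sum>l\<in>{K0..<p}. pr (?D l)))"
    by (intro order.trans[OF pr_or] add_mono pr_bex) auto
  also have "pr ?A = real K0 / real p"
    using pr_single[of x "{..<K0}"] x best_mono[OF k_le(1)] K0 by auto
  also note pr_few_best
  also have "(\<Sum>l\<in>{K0..<p}. pr (?C l)) \<le> (\<Sum>l\<in>{K0..<p}. miss (k - rk x) l / real p)"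
    using x by (intro sum_mono pr_threshold_too_high)
  also have "(\<Sum>l\<in>{K0..<p}. pr (?D l)) \<le> (\<Sum>l\<in>{K0..<p}. (4 + 2 * expected_excess) / off_mean l / real p)"
    using x by (intro sum_mono pr_capacity)
  finally show ?thesis by (simp add: reject_bound_def)
qed

end

section \<open>Numerical estimates\<close>

text \<open>The decreasing function 3/x^4 is minus the derivative of 1/x^3; its value at the right
  end of an interval is compared with the integral, in order to telescope.\<close>

lemma inverse_fourth_power_le:
  fixes a t :: real
  assumes "0 < a" "0 < t"
  shows "3 * t / (a + t) ^ 4 \<le> 1 / a ^ 3 - 1 / (a + t) ^ 3"
proof -
  define b where "b = a + t"
  have b: "0 < b" "a \<le> b" "t = b - a" using assms by (auto simp: b_def)
  have "a * a \<le> a * b" "a * b \<le> b * b" using b assms by (auto intro: mult_mono)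
  hence "3 * (a * a) \<le> a * a + a * b + b * b" by linarith
  hence "t * (3 * (a * a)) * a \<le> t * (a * a + a * b + b * b) * b"
    using b(1,2) assms by (intro mult_mono[OF mult_left_mono]) simp_all
  hence "3 * t * a ^ 3 \<le> (b ^ 3 - a ^ 3) * b"
    unfolding b(3) by (simp add: algebra_simps power3_eq_cube)
  hence "3 * t * a ^ 3 / (a ^ 3 * b ^ 4) \<le> (b ^ 3 - a ^ 3) * b / (a ^ 3 * b ^ 4)"
    using b assms by (intro divide_right_mono) auto
  moreover have "3 * t * a ^ 3 / (a ^ 3 * b ^ 4) = 3 * t / b ^ 4" using assms by simp
  moreover have "(b ^ 3 - a ^ 3) * b / (a ^ 3 * b ^ 4) = 1 / a ^ 3 - 1 / b ^ 3"
  proof -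
    have "b ^ 4 = b ^ 3 * b" by (simp add: power4_eq_xxxx power3_eq_cube)
    hence "(b ^ 3 - a ^ 3) * b / (a ^ 3 * b ^ 4) = (b ^ 3 - a ^ 3) / (a ^ 3 * b ^ 3)"
      using b by simp
    also have "\<dots> = 1 / a ^ 3 - 1 / b ^ 3" using b assms by (simp add: diff_frac_eq)
    finally show ?thesis .
  qed
  ultimately show ?thesis by (simp only: b_def)
qed

text \<open>The trivial bound 1 is used until g t reaches a + D, and telescoping afterwards.
  \<open>D\<close> is a free parameter, chosen in \<open>sum_miss_le\<close>.\<close>

lemma sum_truncated_tail_le:
  fixes t a D c :: real
  assumes t: "0 < t" and a: "0 \<le> a" and D: "0 < D" and c: "0 \<le> c"
  shows "(\<Sum>g\<in>{1..k}. if 0 < real g * t - a then min 1 (c / (real g * t - a) ^ 4) else 1)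
    \<le> (a + D) / t + 1 + c / (3 * t * D ^ 3)"
proof -
  define f where "f g = (if 0 < real g * t - a then min 1 (c / (real g * t - a) ^ 4) else 1)" for g :: nat
  define G where "G = nat \<lceil>(a + D) / t\<rceil>"
  have f: "0 \<le> f g" "f g \<le> 1" for g using c by (auto simp: f_def)
  have "0 \<le> (a + D) / t" using a D t by simp
  hence G: "real G \<le> (a + D) / t + 1" "(a + D) / t \<le> real G" unfolding G_def by linarith+
  have Gt: "a + D \<le> real G * t" using G(2) t by (simp add: pos_divide_le_eq)
  have tail: "f (G + j) \<le> c / (D + real j * t) ^ 4" for j
  proof -
    have le: "D + real j * t \<le> real (G + j) * t - a" using Gt by (simp add: algebra_simps)
    have pos: "0 < D + real j * t" using D t by (intro add_pos_nonneg) auto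
    have "c / (real (G + j) * t - a) ^ 4 \<le> c / (D + real j * t) ^ 4"
      using le pos c by (intro divide_left_mono power_mono mult_pos_pos zero_less_power) auto
    thus ?thesis using le pos unfolding f_def by auto
  qed
  have telescope: "(\<Sum>j\<in>{1..J}. c / (D + real j * t) ^ 4) \<le> c / (3 * t) * (1 / D ^ 3 - 1 / (D + real J * t) ^ 3)" for J
  proof (induction J)
    case (Suc J)
    define u where "u = D + real J * t"
    have u: "0 < u" unfolding u_def using D t by (intro add_pos_nonneg) auto
    have "c / (3 * t) * (3 * t / (u + t) ^ 4) \<le> c / (3 * t) * (1 / u ^ 3 - 1 / (u + t) ^ 3)"
      using inverse_fourth_power_le[OF u t] c t by (intro mult_left_mono) auto
    hence "c / (u + t) ^ 4 \<le> c / (3 * t) * (1 / u ^ 3 - 1 / (u + t) ^ 3)" using t by simp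
    moreover have "u + t = D + real (Suc J) * t" by (simp add: u_def algebra_simps)
    ultimately have "c / (D + real (Suc J) * t) ^ 4 \<le> c / (3 * t) * (1 / (D + real J * t) ^ 3 - 1 / (D + real (Suc J) * t) ^ 3)"
      by (simp only: u_def)
    with Suc.IH show ?case by (simp add: right_diff_distrib)
  qed simp
  have "(\<Sum>g\<in>{1..k}. f g) \<le> (\<Sum>g\<in>{1..G} \<union> (\<lambda>j. G + j) ` {1..k}. f g)"
  proof (rule sum_mono2)
    show "{1..k} \<subseteq> {1..G} \<union> (\<lambda>j. G + j) ` {1..k}"
    proof
      fix g assume g: "g \<in> {1..k}"
      show "g \<in> {1..G} \<union> (\<lambda>j. G + j) ` {1..k}"
      proof (cases "g \<le> G")
        case False
        hence "g = G + (g - G)" "g - G \<in> {1..k}" using g by auto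
        thus ?thesis by blast
      qed (use g in auto)
    qed
  qed (use f in auto)
  also have "\<dots> = (\<Sum>g\<in>{1..G}. f g) + (\<Sum>g\<in>(\<lambda>j. G + j) ` {1..k}. f g)"
    by (intro sum.union_disjoint) auto
  also have "(\<Sum>g\<in>(\<lambda>j. G + j) ` {1..k}. f g) = (\<Sum>j\<in>{1..k}. f (G + j))"
    by (subst sum.reindex) auto
  also have "\<dots> \<le> (\<Sum>j\<in>{1..k}. c / (D + real j * t) ^ 4)" by (intro sum_mono tail)
  also note telescope
  also have "c / (3 * t) * (1 / D ^ 3 - 1 / (D + real k * t) ^ 3) \<le> c / (3 * t) * (1 / D ^ 3)"
    using c t D by (intro mult_left_mono) auto
  also have "(\<Sum>g\<in>{1..G}. f g) \<le> (\<Sum>g\<in>{1..G}. 1)" by (intro sum_mono f)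
  also have "\<dots> = real G" by simp
  also note G(1)
  finally show ?thesis by (simp add: f_def)
qed

lemma sum_inverse_sqrt_le:
  assumes "a \<le> b"
  shows "(\<Sum>l\<in>{a..<b}. 1 / sqrt (real (Suc l))) \<le> 2 * (sqrt (real b) - sqrt (real a))"
  using assms
proof (induction b rule: dec_induct)
  case (step b)
  define s u where "s = sqrt (real b)" and "u = sqrt (real (Suc b))"
  have su: "0 \<le> s" "s \<le> u" "0 < u" "u ^ 2 = s ^ 2 + 1" by (auto simp: s_def u_def)
  have "(u - s) * (u + s) = 1" using su(4) by (simp add: algebra_simps power2_eq_square)
  moreover have "(u - s) * (u + s) \<le> (u - s) * (2 * u)" using su by (intro mult_left_mono) auto
  ultimately have "1 \<le> (u - s) * (2 * u)" by simp
  hence "1 \<le> (2 * (u - s)) * u" by (simp only: mult_ac)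
  hence "1 / u \<le> 2 * (u - s)" by (subst pos_divide_le_eq[OF su(3)])
  thus ?case using step by (simp add: s_def u_def)
qed simp

lemma sum_inverse_le_ln:
  assumes "1 \<le> a" "a \<le> b"
  shows "(\<Sum>l\<in>{a..<b}. 1 / real (Suc l)) \<le> ln (real b / real a)"
  using assms(2)
proof (induction b rule: dec_induct)
  case (step b)
  have b: "0 < real b" "0 < real a" using step assms(1) by auto
  have "ln (real b / real (Suc b)) \<le> real b / real (Suc b) - 1" using b by (intro ln_le_minus_one) auto
  also have "\<dots> = - (1 / real (Suc b))" by (simp add: field_simps)
  finally have "1 / real (Suc b) \<le> ln (real (Suc b)) - ln (real b)" using b by (simp add: ln_div)
  thus ?case using step b by (simp add: ln_div)
qed (use assms(1) in simp)

text \<open>Among the k >= 2, the number 109 is the first with a positive claimed ratio. The bound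
  169/25 is a perfect square, giving sqrt(log k) >= 13/5.\<close>

lemma log2_109: "169 / 25 \<le> log 2 109"
proof -
  have "(2::real) ^ 169 \<le> 109 ^ 25" by simp
  hence "(2::real) powr 169 \<le> 109 powr 25" by (simp flip: powr_realpow)
  hence "169 \<le> log 2 (109 powr 25)" by (subst le_log_iff) simp_all
  also have "log 2 (109 powr 25) = 25 * log 2 109" by (rule log_powr)
  finally show ?thesis by simp
qed

text \<open>The tangent bound ln z <= z/e, with e >= 27/10 obtained from (1 + 1/100)^100.\<close>

lemma ln_le_div_exp_1: "0 < z \<Longrightarrow> ln z \<le> 10 / 27 * (z::real)"
proof -
  assume z: "0 < z"
  have "(27 / 10 :: real) \<le> (1 + 1 / 100) ^ 100" by (simp add: power_divide)
  also have "\<dots> \<le> exp (1 / 100) ^ 100" by (intro power_mono exp_ge_add_one_self) auto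
  also have "\<dots> = exp 1" by (simp flip: exp_of_nat_mult)
  finally have e: "27 / 10 \<le> exp (1::real)" .
  have "ln (z / exp 1) \<le> z / exp 1 - 1" using z by (intro ln_le_minus_one) auto
  hence "ln z \<le> z / exp 1" using z by (simp add: ln_div)
  also have "\<dots> \<le> z / (27 / 10)" using z e by (intro divide_left_mono) auto
  finally show ?thesis by simp
qed

lemma ln_2_ge: "9 / 13 \<le> ln (2::real)"
proof -
  have "exp (9::real) = exp 1 ^ 9" by (simp flip: exp_of_nat_mult)
  also have "\<dots> \<le> (272 / 100) ^ 9" using e_less_272 by (intro power_mono) auto
  also have "\<dots> \<le> 2 ^ 13" by (simp add: power_divide)
  finally have "ln (exp 9) \<le> ln (2 ^ 13 :: real)" by (subst ln_le_cancel_iff) auto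
  moreover have "ln (2 ^ 13 :: real) = real 13 * ln 2" by (rule ln_realpow)
  ultimately show ?thesis by simp
qed

lemma log2_le_sqrt: "1 \<le> y \<Longrightarrow> log 2 y \<le> 2 * sqrt y"
proof -
  assume y: "1 \<le> y"
  have "ln (sqrt y) \<le> sqrt y - 1" using y by (intro ln_le_minus_one) auto
  hence "ln y \<le> 2 * (sqrt y - 1)" using y by (simp add: ln_sqrt)
  moreover have "ln y \<le> 10 / 27 * (2 * sqrt y)"
    using ln_le_div_exp_1[of "sqrt y"] y by (simp add: ln_sqrt)
  moreover have "9 / 13 \<le> ln (2::real)" by (rule ln_2_ge)
  ultimately have "ln y \<le> 2 * sqrt y * ln 2"
  proof -
    have "10 / 27 * (2 * sqrt y) \<le> 2 * sqrt y * (9 / 13)" using y by simp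
    also have "\<dots> \<le> 2 * sqrt y * ln 2" using y \<open>9 / 13 \<le> ln 2\<close> by (intro mult_left_mono) auto
    finally show ?thesis using \<open>ln y \<le> 10 / 27 * (2 * sqrt y)\<close> by linarith
  qed
  thus ?thesis by (simp add: log_def pos_divide_le_eq)
qed

text \<open>
  The total loss in units of \<open>x = sqrt (log k / k)\<close>, as a function of \<open>x\<close> and of
  \<open>r = 1 / sqrt (log k)\<close>. Treating \<open>x\<close> and \<open>r\<close> as independent is too lossy, so the range of
  \<open>log k\<close> is cut into pieces.
\<close>

lemma loss_polynomial_le_4:
  fixes x r l :: real
  assumes x: "0 \<le> x" "x \<le> 2 / 3" and r: "0 < r" and l: "l = 1 / r ^ 2" "169 / 25 \<le> l"
    and xl: "\<And>u. l \<le> u \<Longrightarrow> l / 2 powr u \<le> x ^ 2"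
  shows "9 / 4 * x + (1 - 3 / 2 * x) * (2 + 354 / 100 * r + 87 / 10 * r ^ 2 - 339 / 10 * r ^ 4)
    + r ^ 2 * (125 / 100 * x + 306 / 100) \<le> 4"
proof -
  have rl: "r ^ 2 = 1 / l" using l(1) r by simp
  have r4: "r ^ 4 = (r ^ 2) ^ 2" by simp
  \<comment> \<open>For l between lo and u one has r <= R and x >= X, and r^2 >= 1/u controls the
    negative term. Once the bracket is replaced by its bound G, the left side is affine and
    decreasing in x, so it is enough to evaluate it at X.\<close>
  have piece: ?thesis
    if u: "l \<le> u" "lo \<le> l" and lo: "0 < lo" and R: "1 / lo \<le> R ^ 2" "0 \<le> R"
      and X: "X ^ 2 \<le> lo / 2 powr u"
      and G: "2 + 354 / 100 * R + 87 / 10 * (1 / lo) - 339 / 10 * (1 / u) ^ 2 \<le> G" "2 \<le> G"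
      and fin: "9 / 4 * X + (1 - 3 / 2 * X) * G + 1 / lo * (125 / 100 * X + 306 / 100) \<le> 4" "1 / lo \<le> 1 / 2"
    for u lo R X G
  proof -
    have r2: "r ^ 2 \<le> 1 / lo" "1 / u \<le> r ^ 2" unfolding rl using u lo by (auto intro!: divide_left_mono)
    have "r ^ 2 \<le> R ^ 2" using r2(1) R(1) by linarith
    hence rR: "r \<le> R" using R(2) by (rule power2_le_imp_le)
    have "X ^ 2 \<le> l / 2 powr u" using X u(2) by (smt (verit) divide_right_mono powr_ge_zero)
    also have "\<dots> \<le> x ^ 2" by (rule xl[OF u(1)])
    finally have Xx: "X \<le> x" using x(1) by (rule power2_le_imp_le)
    have "(1 / u) ^ 2 \<le> r ^ 4" unfolding r4 using r2(2) u lo by (intro power_mono) auto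
    hence "2 + 354 / 100 * r + 87 / 10 * r ^ 2 - 339 / 10 * r ^ 4 \<le> G"
      using G(1) rR r2(1) by linarith
    hence "(1 - 3 / 2 * x) * (2 + 354 / 100 * r + 87 / 10 * r ^ 2 - 339 / 10 * r ^ 4) \<le> (1 - 3 / 2 * x) * G"
      using x by (intro mult_left_mono) auto
    moreover have "r ^ 2 * (125 / 100 * x + 306 / 100) \<le> 1 / lo * (125 / 100 * x + 306 / 100)"
      using r2(1) x by (intro mult_right_mono) auto
    moreover have "9 / 4 * x + (1 - 3 / 2 * x) * G + I * (125 / 100 * x + 306 / 100)
      = 9 / 4 * X + (1 - 3 / 2 * X) * G + I * (125 / 100 * X + 306 / 100)
        - (x - X) * (3 / 2 * G - 9 / 4 - I * (125 / 100))" for I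
      by (simp add: field_simps)
    note this[of "1 / lo"]
    moreover have "0 \<le> (x - X) * (3 / 2 * G - 9 / 4 - 1 / lo * (125 / 100))"
      using Xx G(2) fin(2) by (intro mult_nonneg_nonneg) auto
    ultimately show ?thesis using fin(1) by linarith
  qed
  consider "l \<le> 8" | "8 \<le> l" "l \<le> 9" | "9 \<le> l" "l \<le> 10" | "10 \<le> l" "l \<le> 12" | "12 \<le> l" "l \<le> 14" | "14 \<le> l"
    by linarith
  thus ?thesis
  proof cases
    case 1
    show ?thesis by (rule piece[where u = 8 and lo = "169 / 25" and R = "5 / 13" and X = "162 / 1000" and G = "413 / 100"])
        (use 1 l in \<open>simp_all add: power2_eq_square\<close>)
  next
    case 2
    show ?thesis by (rule piece[where u = 9 and lo = 8 and R = "354 / 1000" and X = "125 / 1000" and G = "394 / 100"])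
        (use 2 l in \<open>simp_all add: power2_eq_square\<close>)
  next
    case 3
    show ?thesis by (rule piece[where u = 10 and lo = 9 and R = "1 / 3" and X = "93 / 1000" and G = "382 / 100"])
        (use 3 l in \<open>simp_all add: power2_eq_square\<close>)
  next
    case 4
    show ?thesis by (rule piece[where u = 12 and lo = 10 and R = "317 / 1000" and X = "49 / 1000" and G = "377 / 100"])
        (use 4 l in \<open>simp_all add: power2_eq_square\<close>)
  next
    case 5
    show ?thesis by (rule piece[where u = 14 and lo = 12 and R = "289 / 1000" and X = 0 and G = "360 / 100"])
        (use 5 l in \<open>simp_all add: power2_eq_square\<close>)
  next
    case 6
    show ?thesis
    proof (rule piece[where u = l and lo = 14 and R = "268 / 1000" and X = 0 and G = "360 / 100"])
      show "2 + 354 / 100 * (268 / 1000) + 87 / 10 * (1 / 14) - 339 / 10 * (1 / l)\<^sup>2 \<le> 360 / 100"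
        using zero_le_power2[of "1 / l"] by linarith
    qed (use 6 in \<open>simp_all add: power2_eq_square\<close>)
  qed
qed

text \<open>In the variables x and r one has 1/k = x^2 r^2, \<mu> = 1/r and sqrt t0 = 3x/2, so every
  term carries a factor x. The summand 1/(4k) exceeds the corresponding term of
  \<open>reject_bound\<close> by 1/(8k); this surplus will pay for collisions and for
  rounding.\<close>

lemma total_loss_le:
  fixes k :: nat
  assumes k: "109 \<le> k"
  defines "l \<equiv> log 2 (real k)" and "\<mu> \<equiv> sqrt (log 2 (real k))" and "t0 \<equiv> 9 / 4 * log 2 (real k) / real k"
  defines "\<Lambda> \<equiv> ln (1 / t0)" and "e \<equiv> 31 / 10 * (1 / \<mu> ^ 4 + 2 * sqrt (real k) * (1 - sqrt t0) / \<mu> ^ 3)"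
  shows "t0 + 1 / (4 * real k) + (\<mu> + 177 / 100) * (2 * (1 - sqrt t0) / sqrt (real k))
    + (2 * \<Lambda> + 1) / real k + (4 + 2 * e) * \<Lambda> / (real k - 1) \<le> 4 * sqrt (l / real k)"
    and "169 / 25 \<le> l" and "t0 \<le> 9 / 20"
proof -
  have k0: "0 < real k" using k by simp
  have l: "169 / 25 \<le> l"
  proof -
    have "log 2 109 \<le> l" unfolding l_def using k by (subst log_le_cancel_iff) auto
    thus ?thesis using log2_109 by linarith
  qed
  show "169 / 25 \<le> l" by (rule l)
  define x where "x = sqrt (l / real k)"
  define r where "r = 1 / \<mu>"
  have mu: "\<mu> = sqrt l" by (simp add: \<mu>_def l_def)
  have mu0: "0 < \<mu>" using l by (simp add: mu)
  have r0: "0 < r" using mu0 by (simp add: r_def)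
  have x2: "x ^ 2 = l / real k" using l k0 by (simp add: x_def)
  have x0: "0 < x" using l k0 by (simp add: x_def)
  have r2: "r ^ 2 = 1 / l" using l by (simp add: r_def mu power_divide)
  have t0: "t0 = 9 / 4 * x ^ 2" by (simp add: t0_def x2 l_def)
  have st0: "sqrt t0 = 3 / 2 * x"
  proof (rule real_sqrt_unique)
    show "(3 / 2 * x) ^ 2 = t0" by (simp add: t0 power_mult_distrib power2_eq_square)
  qed (use x0 in simp)
  have small: "x ^ 2 \<le> 1 / 5"
  proof -
    have "10 ^ 2 \<le> real k" using k by simp
    hence "10 \<le> sqrt (real k)" by (rule real_le_rsqrt)
    hence "10 * sqrt (real k) \<le> sqrt (real k) * sqrt (real k)" by (intro mult_right_mono) auto
    hence "10 * sqrt (real k) \<le> real k" by simp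
    moreover have "l \<le> 2 * sqrt (real k)" unfolding l_def using k by (intro log2_le_sqrt) auto
    ultimately show ?thesis unfolding x2 using k0 by (simp add: pos_divide_le_eq)
  qed
  thus "t0 \<le> 9 / 20" by (simp add: t0)
  have "(2 / 3 :: real) ^ 2 = 4 / 9" by (simp add: power_divide)
  hence "x ^ 2 \<le> (2 / 3) ^ 2" using small by linarith
  hence x23: "x \<le> 2 / 3" by (rule power2_le_imp_le) simp
  have k_xr: "1 / real k = x ^ 2 * r ^ 2" using l by (simp add: x2 r2)
  have sk_xr: "1 / sqrt (real k) = x * r"
    using l by (simp add: x_def r_def mu real_sqrt_divide)
  have sk: "sqrt (real k) = 1 / (x * r)" by (simp flip: sk_xr)
  have mu_r: "\<mu> = 1 / r" by (simp add: r_def)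
  have L: "\<Lambda> = 2 * ln (1 / (3 / 2 * x))"
  proof -
    have "1 / t0 = (1 / (3 / 2 * x)) ^ 2" by (simp add: t0 power_divide power_mult_distrib power2_eq_square)
    thus ?thesis unfolding \<Lambda>_def using x0 by (simp only: ln_realpow)
  qed
  have "t0 < 1" using small by (simp add: t0)
  moreover have "0 < t0" using x0 by (simp add: t0)
  ultimately have L0: "0 \<le> \<Lambda>" unfolding \<Lambda>_def by (intro ln_ge_zero) simp
  \<comment> \<open>\<Lambda> is bounded in two ways: here against 1/x, and in \<open>Ll\<close>
    against l = 1/r^2, which is the better choice in the term with the factor r^4.\<close>
  have xL: "x * \<Lambda> \<le> 494 / 1000"
  proof -
    have "\<Lambda> \<le> 2 * (10 / 27 * (1 / (3 / 2 * x)))"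
      unfolding L using x0 by (intro mult_left_mono ln_le_div_exp_1) auto
    hence "x * \<Lambda> \<le> x * (2 * (10 / 27 * (1 / (3 / 2 * x))))" using x0 by (intro mult_left_mono) auto
    also have "\<dots> = 40 / 81" using x0 by simp
    finally show ?thesis by simp
  qed
  have Ll: "\<Lambda> \<le> 25 / 36 * l - 271 / 100"
  proof -
    have "1 / t0 = real k / (9 / 4 * l)" by (simp add: t0_def l_def)
    hence "\<Lambda> = ln (real k / (9 / 4 * l))" unfolding \<Lambda>_def by (simp only:)
    also have "\<dots> = ln (real k) - ln (9 / 4 * l)" by (rule ln_divide_pos) (use l k0 in simp_all)
    also have "ln (real k) = l * ln 2" unfolding l_def by (simp add: log_def)
    also have "\<dots> \<le> l * (25 / 36)" using l ln2_le_25_over_36 by (intro mult_left_mono) auto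
    moreover have "271 / 100 \<le> ln (9 / 4 * l)"
    proof -
      \<comment> \<open>The number 9/4 times 169/25 is about 15.2, so its logarithm is compared with
        ln 16 = 4 ln 2.\<close>
      have "ln (16 / (9 / 4 * (169 / 25))) \<le> 16 / (9 / 4 * (169 / 25)) - (1::real)" by (rule ln_le_minus_one) simp
      hence "ln 16 - ln (9 / 4 * (169 / 25)) \<le> 16 / (9 / 4 * (169 / 25)) - (1::real)" by (simp only: ln_divide_pos)
      moreover have "ln (16::real) = 4 * ln 2" using ln_realpow[of 2 4] by simp
      moreover have "9 / 13 \<le> ln (2::real)" by (rule ln_2_ge)
      ultimately have "271 / 100 \<le> ln (9 / 4 * (169 / 25) :: real)" by simp
      also have "\<dots> \<le> ln (9 / 4 * l)" using l by (subst ln_le_cancel_iff) auto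
      finally show ?thesis .
    qed
    ultimately show ?thesis by linarith
  qed
  have rL: "r ^ 4 * \<Lambda> \<le> 25 / 36 * r ^ 2 - 271 / 100 * r ^ 4"
  proof -
    have "r ^ 4 * \<Lambda> \<le> r ^ 4 * (25 / 36 * l - 271 / 100)" using Ll r0 by (intro mult_left_mono) auto
    also have "r ^ 4 * (25 / 36 * l - 271 / 100) = 25 / 36 * (r ^ 2 * (r ^ 2 * l)) - 271 / 100 * r ^ 4"
      by (simp add: algebra_simps power4_eq_xxxx power2_eq_square)
    also have "r ^ 2 * l = 1" using l by (simp add: r2)
    finally show ?thesis by simp
  qed
  have r24: "r ^ 2 \<le> 25 / 169" "r ^ 4 \<le> 22 / 1000"
  proof -
    have "1 / l \<le> 1 / (169 / 25)" using l by (intro divide_left_mono) auto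
    thus r2': "r ^ 2 \<le> 25 / 169" by (simp add: r2)
    have "(r ^ 2) ^ 2 \<le> (25 / 169) ^ 2" using r2' by (rule power_mono) simp
    moreover have "r ^ 4 = (r ^ 2) ^ 2" by simp
    moreover have "(25 / 169 :: real) ^ 2 = 625 / 28561" by (simp add: power_divide)
    ultimately show "r ^ 4 \<le> 22 / 1000" by linarith
  qed
  have e_eq: "x * e = 31 / 10 * (x * r ^ 4 + 2 * (1 - 3 / 2 * x) * r ^ 2)"
    unfolding e_def st0 sk mu_r using x0 r0
    by (simp add: field_simps power2_eq_square power3_eq_cube power4_eq_xxxx)
  have e0: "0 \<le> e" unfolding e_def st0 using mu0 x23 by (intro mult_nonneg_nonneg add_nonneg_nonneg divide_nonneg_nonneg) auto
  have k1: "1 / (real k - 1) \<le> 109 / 108 * (1 / real k)" using k by (simp add: field_simps)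
  have "(4 + 2 * e) * \<Lambda> / (real k - 1) \<le> (4 + 2 * e) * \<Lambda> * (109 / 108 * (1 / real k))"
    using mult_left_mono[OF k1, of "(4 + 2 * e) * \<Lambda>"] e0 L0 by simp
  also have "\<dots> = x * (109 / 108 * (4 * (x * \<Lambda>) * r ^ 2 + 2 * (x * e) * \<Lambda> * r ^ 2))"
    unfolding k_xr by (simp add: algebra_simps power2_eq_square)
  also have "\<dots> = x * (109 / 108 * (4 * (x * \<Lambda>) * r ^ 2 + 62 / 10 * (x * \<Lambda>) * r ^ 2 * r ^ 4
      + 124 / 10 * (1 - 3 / 2 * x) * (r ^ 4 * \<Lambda>)))"
    unfolding e_eq by (simp add: field_simps power2_eq_square power4_eq_xxxx)
  finally have cap: "(4 + 2 * e) * \<Lambda> / (real k - 1) \<le> \<dots>" .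
  have A: "4 * (x * \<Lambda>) * r ^ 2 + 62 / 10 * (x * \<Lambda>) * r ^ 2 * r ^ 4 \<le> 4137 / 1000 * (494 / 1000) * r ^ 2"
  proof -
    have "4 * (x * \<Lambda>) * r ^ 2 + 62 / 10 * (x * \<Lambda>) * r ^ 2 * r ^ 4 = (4 + 62 / 10 * r ^ 4) * ((x * \<Lambda>) * r ^ 2)"
      by (simp add: algebra_simps)
    also have "\<dots> \<le> (4137 / 1000) * (494 / 1000 * r ^ 2)"
      using r24(2) xL x0 L0 by (intro mult_mono mult_right_mono) auto
    finally show ?thesis by simp
  qed
  have B: "124 / 10 * (1 - 3 / 2 * x) * (r ^ 4 * \<Lambda>) \<le> 124 / 10 * (1 - 3 / 2 * x) * (25 / 36 * r ^ 2 - 271 / 100 * r ^ 4)"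
    using rL x23 by (intro mult_left_mono) auto
  have main: "t0 + 1 / (4 * real k) + (\<mu> + 177 / 100) * (2 * (1 - sqrt t0) / sqrt (real k)) + (2 * \<Lambda> + 1) / real k
      = x * (9 / 4 * x + 125 / 100 * x * r ^ 2 + 2 * (x * \<Lambda>) * r ^ 2 + (1 - 3 / 2 * x) * (2 + 354 / 100 * r))"
  proof -
    have "t0 + 1 / (4 * real k) + (\<mu> + 177 / 100) * (2 * (1 - sqrt t0) / sqrt (real k)) + (2 * \<Lambda> + 1) / real k
      = t0 + 1 / 4 * (1 / real k) + (\<mu> + 177 / 100) * (2 * (1 - sqrt t0) * (1 / sqrt (real k))) + (2 * \<Lambda> + 1) * (1 / real k)"
      by simp
    also have "\<dots> = 9 / 4 * x ^ 2 + 1 / 4 * (x ^ 2 * r ^ 2) + (1 / r + 177 / 100) * (2 * (1 - 3 / 2 * x) * (x * r)) + (2 * \<Lambda> + 1) * (x ^ 2 * r ^ 2)"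
      unfolding k_xr sk_xr st0 mu_r by (simp only: t0)
    also have "\<dots> = x * (9 / 4 * x + 125 / 100 * x * r ^ 2 + 2 * (x * \<Lambda>) * r ^ 2 + (1 - 3 / 2 * x) * (2 + 354 / 100 * r))"
      using r0 by (simp add: field_simps power2_eq_square)
    finally show ?thesis .
  qed
  have poly: "9 / 4 * x + (1 - 3 / 2 * x) * (2 + 354 / 100 * r + 87 / 10 * r ^ 2 - 339 / 10 * r ^ 4)
    + r ^ 2 * (125 / 100 * x + 306 / 100) \<le> 4"
  proof (rule loss_polynomial_le_4)
    show "l = 1 / r ^ 2" using l by (simp add: r2)
    fix u assume "l \<le> u"
    hence "2 powr l \<le> 2 powr u" by simp
    moreover have "2 powr l = real k" unfolding l_def using k0 by simp
    ultimately show "l / 2 powr u \<le> x ^ 2" unfolding x2 using l k0 by (intro divide_left_mono) auto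
  qed (use x0 x23 r0 l in auto)
  have "9 / 4 * x + 125 / 100 * x * r ^ 2 + 2 * (x * \<Lambda>) * r ^ 2 + (1 - 3 / 2 * x) * (2 + 354 / 100 * r)
      + 109 / 108 * (4 * (x * \<Lambda>) * r ^ 2 + 62 / 10 * (x * \<Lambda>) * r ^ 2 * r ^ 4
      + 124 / 10 * (1 - 3 / 2 * x) * (r ^ 4 * \<Lambda>)) \<le> 4"
  proof -
    have "(x * \<Lambda>) * r ^ 2 \<le> 494 / 1000 * r ^ 2" using xL by (intro mult_right_mono) auto
    \<comment> \<open>87/10 and 339/10 are 109/108 times 124/10 times 25/36, rounded up, and times
      271/100, rounded down.\<close>
    moreover have "(1 - 3 / 2 * x) * (2 + 354 / 100 * r) + 109 / 108 * (124 / 10 * (1 - 3 / 2 * x) * (25 / 36 * r ^ 2 - 271 / 100 * r ^ 4))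
      \<le> (1 - 3 / 2 * x) * (2 + 354 / 100 * r + 87 / 10 * r ^ 2 - 339 / 10 * r ^ 4)"
    proof -
      have "(1 - 3 / 2 * x) * (2 + 354 / 100 * r) + 109 / 108 * (124 / 10 * (1 - 3 / 2 * x) * (25 / 36 * r ^ 2 - 271 / 100 * r ^ 4))
        = (1 - 3 / 2 * x) * (2 + 354 / 100 * r + 109 / 108 * (124 / 10) * (25 / 36 * r ^ 2 - 271 / 100 * r ^ 4))"
        by (simp add: field_simps)
      also have "\<dots> \<le> (1 - 3 / 2 * x) * (2 + 354 / 100 * r + 87 / 10 * r ^ 2 - 339 / 10 * r ^ 4)"
        using x23 by (intro mult_left_mono) (auto simp: field_simps)
      finally show ?thesis .
    qed
    moreover have "109 / 108 * (4 * (x * \<Lambda>) * r ^ 2 + 62 / 10 * (x * \<Lambda>) * r ^ 2 * r ^ 4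
      + 124 / 10 * (1 - 3 / 2 * x) * (r ^ 4 * \<Lambda>))
      \<le> 109 / 108 * (4137 / 1000 * (494 / 1000) * r ^ 2) + 109 / 108 * (124 / 10 * (1 - 3 / 2 * x) * (25 / 36 * r ^ 2 - 271 / 100 * r ^ 4))"
      unfolding distrib_left[symmetric] by (intro mult_left_mono add_mono A B) simp
    moreover have "109 / 108 * (4137 / 1000 * (494 / 1000) * r ^ 2) + 2 * (494 / 1000 * r ^ 2) \<le> 306 / 100 * r ^ 2"
      by simp
    moreover have "r ^ 2 * (125 / 100 * x + 306 / 100) = 125 / 100 * x * r ^ 2 + 306 / 100 * r ^ 2"
      by (simp add: algebra_simps)
    ultimately show ?thesis using poly by linarith
  qed
  from mult_left_mono[OF this, of x]
  have "x * (9 / 4 * x + 125 / 100 * x * r ^ 2 + 2 * (x * \<Lambda>) * r ^ 2 + (1 - 3 / 2 * x) * (2 + 354 / 100 * r))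
      + x * (109 / 108 * (4 * (x * \<Lambda>) * r ^ 2 + 62 / 10 * (x * \<Lambda>) * r ^ 2 * r ^ 4
      + 124 / 10 * (1 - 3 / 2 * x) * (r ^ 4 * \<Lambda>))) \<le> x * 4"
    using x0 by (simp only: distrib_left less_imp_le simp_thms)
  thus "t0 + 1 / (4 * real k) + (\<mu> + 177 / 100) * (2 * (1 - sqrt t0) / sqrt (real k))
    + (2 * \<Lambda> + 1) / real k + (4 + 2 * e) * \<Lambda> / (real k - 1) \<le> 4 * sqrt (l / real k)"
    using add_left_mono[OF cap] unfolding main x_def[symmetric] mult.commute[of 4 x]
    by (rule order.trans[rotated])
qed

section \<open>Averaging the rejection bound over the ranks of the k best elements\<close>

context secretary_params
begin

text \<open>\<open>sum_truncated_tail_le\<close> with D = 133/100 s, close to the minimiser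
  (31/10)^(1/4) s of D + c/(3 D^3). The minimum is about (133/100 + 44/100) s, whence
  177/100.\<close>

lemma sum_miss_le:
  assumes l: "l \<in> {K0..<p}"
  defines "t \<equiv> real (Suc l) / real p"
  shows "(\<Sum>g\<in>{1..k}. miss g l) \<le> (\<mu> + 177 / 100) * (sqrt (real k * t) / t) + 2 / t + 1"
proof -
  define s where "s = sqrt (real k * t)"
  have lK: "K0 - 1 \<le> Suc l" using l by auto
  have "13 \<le> real k * t" using ratio_ge'[OF lK] by (simp add: t_def)
  hence s: "0 < s" "real k * t = s ^ 2" by (auto simp: s_def)
  have t: "0 < t" using p0 by (simp add: t_def)
  have "(\<Sum>g\<in>{1..k}. miss g l) = (\<Sum>g\<in>{1..k}. if 0 < real g * t - (\<mu> * s + 2)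
      then min 1 (31 / 10 * s ^ 4 / (real g * t - (\<mu> * s + 2)) ^ 4) else 1)"
    unfolding miss_def Let_def t_def[symmetric] s_def[symmetric] s(2)
    by (intro sum.cong) (use s(1) in \<open>simp_all add: diff_diff_eq\<close>)
  also have "\<dots> \<le> (\<mu> * s + 2 + 133 / 100 * s) / t + 1 + 31 / 10 * s ^ 4 / (3 * t * (133 / 100 * s) ^ 3)"
    using t s mu(1) by (intro sum_truncated_tail_le) auto
  also have "31 / 10 * s ^ 4 / (3 * t * (133 / 100 * s) ^ 3) = 31 / 10 / (3 * (133 / 100) ^ 3) * (s / t)"
    using s t by (simp add: power_mult_distrib power3_eq_cube power4_eq_xxxx)
  also have "\<dots> \<le> 44 / 100 * (s / t)"
    using s t by (intro mult_right_mono) (auto simp: power3_eq_cube)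
  finally show ?thesis unfolding s_def[symmetric] using t by (simp add: field_simps)
qed

text \<open>The sums over the keys are compared with integrals from t0 to 1: 1/sqrt t contributes 2
  (1 - sqrt t0), and 1/t contributes \<Lambda>. Index shifts let some sums start at
  \<open>K0 - 2\<close>, which is why t0 p has to stay below that number.\<close>

lemma average_reject_bound:
  fixes t0 :: real
  assumes t0: "0 < t0" "t0 < 1" "t0 * real p \<le> real (K0 - 2)" "real K0 \<le> t0 * real p + 3" and K03: "3 \<le> K0"
  defines "\<Lambda> \<equiv> ln (1 / t0)" and "e \<equiv> 31 / 10 * (1 / \<mu> ^ 4 + 2 * sqrt (real k) * (1 - sqrt t0) / \<mu> ^ 3)"
  shows "(\<Sum>g\<in>{1..k}. reject_bound g) \<le> real k * (t0 + 3 / real p + 1 / (8 * real k)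
    + (\<mu> + 177 / 100) * (2 * (1 - sqrt t0) / sqrt (real k)) + (2 * \<Lambda> + 1) / real k
    + (4 + 2 * e) * \<Lambda> / (real k - 1))"
proof -
  have rp: "0 < real p" using p0 by simp
  have rk: "0 < real k" "0 < real k - 1" using k(1) by auto
  have K2: "t0 \<le> real (K0 - 2) / real p" using t0(3) rp by (simp add: pos_le_divide_eq)
  have K1: "t0 \<le> real K0 / real p"
  proof -
    have "real (K0 - 2) / real p \<le> real K0 / real p" by (intro divide_right_mono) auto
    thus ?thesis using K2 by linarith
  qed
  have L0: "0 \<le> \<Lambda>" unfolding \<Lambda>_def using t0 by (intro ln_ge_zero) simp
  have lnL: "ln (b / a) \<le> \<Lambda>" if "0 < a" "0 < b" "b \<le> real p" "real (K0 - 2) \<le> a" for a b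
  proof -
    have "t0 * b \<le> t0 * real p" using that t0 by simp
    hence "t0 * b \<le> a" using t0(3) that by linarith
    hence "b / a \<le> 1 / t0" using that t0 by (simp add: field_simps)
    thus ?thesis unfolding \<Lambda>_def using that by (subst ln_le_cancel_iff) (use t0 in auto)
  qed
  have sq: "sqrt (real k) / sqrt (real p) * (2 * (sqrt b - sqrt a)) \<le> 2 * sqrt (real k) * (1 - sqrt t0)"
    if "b \<le> real p" "t0 \<le> a / real p" for a b
  proof -
    have b: "sqrt b \<le> sqrt (real p)" using that by simp
    have "sqrt t0 \<le> sqrt a / sqrt (real p)" using that by (simp flip: real_sqrt_divide)
    hence a: "sqrt t0 * sqrt (real p) \<le> sqrt a" using rp by (simp add: pos_le_divide_eq)
    have "sqrt (real p) * (1 - sqrt t0) = sqrt (real p) - sqrt t0 * sqrt (real p)" by (simp add: algebra_simps)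
    hence "sqrt b - sqrt a \<le> sqrt (real p) * (1 - sqrt t0)" using a b by linarith
    hence "sqrt (real k) / sqrt (real p) * (2 * (sqrt b - sqrt a))
        \<le> sqrt (real k) / sqrt (real p) * (2 * (sqrt (real p) * (1 - sqrt t0)))"
      by (intro mult_left_mono) auto
    also have "\<dots> = 2 * sqrt (real k) * (1 - sqrt t0)" using rp by simp
    finally show ?thesis .
  qed
  have conv: "sqrt (real k * (y / real p)) / (y / real p) / real p = sqrt (real k) / sqrt (real p) * (1 / sqrt y)"
    if "0 < y" for y
  proof -
    have "sqrt (real k * (y / real p)) = sqrt (real k) * sqrt y / sqrt (real p)"
      by (simp add: real_sqrt_mult real_sqrt_divide)
    hence "sqrt (real k * (y / real p)) / (y / real p) / real p = sqrt (real k) / sqrt (real p) * (sqrt y / y)"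
      using rp that by simp
    also have "sqrt y / y = 1 / sqrt y" using that by (simp add: real_div_sqrt frac_eq_eq)
    finally show ?thesis .
  qed
  have E: "expected_excess \<le> e"
  proof -
    have "expected_excess = (\<Sum>l\<in>{K0 - 1..<p}. 31 / 10 * (1 / \<mu> ^ 4 / real p + 1 / \<mu> ^ 3 * (sqrt (real k) / sqrt (real p) * (1 / sqrt (real l)))))"
      unfolding expected_excess_def
    proof (rule sum.cong[OF refl])
      fix l assume "l \<in> {K0 - 1..<p}"
      hence l: "0 < real l" using K03 by auto
      have "psi l / real p = 31 / 10 * (1 / \<mu> ^ 4 / real p + 1 / \<mu> ^ 3 * (sqrt (real k * (real l / real p)) / (real l / real p) / real p))"
        unfolding psi_def using rp by (simp add: add_divide_distrib mult_ac)
      thus "psi l / real p = 31 / 10 * (1 / \<mu> ^ 4 / real p + 1 / \<mu> ^ 3 * (sqrt (real k) / sqrt (real p) * (1 / sqrt (real l))))"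
        unfolding conv[OF l] .
    qed
    also have "\<dots> = 31 / 10 * ((\<Sum>l\<in>{K0 - 1..<p}. 1 / \<mu> ^ 4 / real p)
      + 1 / \<mu> ^ 3 * (sqrt (real k) / sqrt (real p) * (\<Sum>l\<in>{K0 - 1..<p}. 1 / sqrt (real l))))"
      by (simp only: sum_distrib_left sum.distrib distrib_left)
    also have "\<dots> \<le> 31 / 10 * (1 / \<mu> ^ 4 + 1 / \<mu> ^ 3 * (2 * sqrt (real k) * (1 - sqrt t0)))"
    proof (intro mult_left_mono add_mono)
      have "real (p - (K0 - 1)) * (1 / \<mu> ^ 4 / real p) \<le> real p * (1 / \<mu> ^ 4 / real p)"
        using rp by (intro mult_right_mono) auto
      thus "(\<Sum>l\<in>{K0 - 1..<p}. 1 / \<mu> ^ 4 / real p) \<le> 1 / \<mu> ^ 4" using rp by simp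
      have "(\<Sum>l\<in>{K0 - 1..<p}. 1 / sqrt (real l)) = (\<Sum>l\<in>{K0 - 2..<p - 1}. 1 / sqrt (real (Suc l)))"
        by (rule sum.reindex_bij_witness[of _ Suc "\<lambda>l. l - 1"]) (use K03 in auto)
      also have "\<dots> \<le> 2 * (sqrt (real (p - 1)) - sqrt (real (K0 - 2)))"
        using K0 by (intro sum_inverse_sqrt_le) auto
      finally have "sqrt (real k) / sqrt (real p) * (\<Sum>l\<in>{K0 - 1..<p}. 1 / sqrt (real l))
          \<le> sqrt (real k) / sqrt (real p) * (2 * (sqrt (real (p - 1)) - sqrt (real (K0 - 2))))"
        by (intro mult_left_mono) auto
      also have "\<dots> \<le> 2 * sqrt (real k) * (1 - sqrt t0)" using K2 by (intro sq) auto
      finally show "sqrt (real k) / sqrt (real p) * (\<Sum>l\<in>{K0 - 1..<p}. 1 / sqrt (real l)) \<le> 2 * sqrt (real k) * (1 - sqrt t0)" .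
    qed (use mu(1) in auto)
    also have "\<dots> = e" by (simp add: e_def)
    finally show ?thesis .
  qed
  have A1: "real K0 / real p \<le> t0 + 3 / real p" using t0(4) rp by (simp add: field_simps)
  have A2: "(\<Sum>g\<in>{1..k}. \<Sum>l\<in>{K0..<p}. miss g l / real p)
    \<le> real k * ((\<mu> + 177 / 100) * (2 * (1 - sqrt t0) / sqrt (real k)) + (2 * \<Lambda> + 1) / real k)"
  proof -
    have "(\<Sum>g\<in>{1..k}. \<Sum>l\<in>{K0..<p}. miss g l / real p) = (\<Sum>l\<in>{K0..<p}. (\<Sum>g\<in>{1..k}. miss g l) / real p)"
      by (subst sum.swap) (simp add: sum_divide_distrib)
    also have "\<dots> \<le> (\<Sum>l\<in>{K0..<p}. (\<mu> + 177 / 100) * (sqrt (real k) / sqrt (real p) * (1 / sqrt (real (Suc l))))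
        + (2 * (1 / real (Suc l)) + 1 / real p))"
    proof (rule sum_mono)
      fix l assume l: "l \<in> {K0..<p}"
      define t where "t = real (Suc l) / real p"
      have "(\<Sum>g\<in>{1..k}. miss g l) / real p \<le> ((\<mu> + 177 / 100) * (sqrt (real k * t) / t) + 2 / t + 1) / real p"
        unfolding t_def by (intro divide_right_mono sum_miss_le l) simp
      also have "\<dots> = (\<mu> + 177 / 100) * (sqrt (real k * t) / t / real p) + (2 / t / real p + 1 / real p)"
        by (simp add: add_divide_distrib)
      also have "sqrt (real k * t) / t / real p = sqrt (real k) / sqrt (real p) * (1 / sqrt (real (Suc l)))"
        unfolding t_def by (rule conv) simp
      also have "2 / t / real p = 2 * (1 / real (Suc l))" using rp by (simp add: t_def)
      finally show "(\<Sum>g\<in>{1..k}. miss g l) / real p \<le> (\<mu> + 177 / 100) * (sqrt (real k) / sqrt (real p) * (1 / sqrt (real (Suc l))))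
        + (2 * (1 / real (Suc l)) + 1 / real p)" .
    qed
    also have "\<dots> = (\<mu> + 177 / 100) * (sqrt (real k) / sqrt (real p) * (\<Sum>l\<in>{K0..<p}. 1 / sqrt (real (Suc l))))
        + (2 * (\<Sum>l\<in>{K0..<p}. 1 / real (Suc l)) + (\<Sum>l\<in>{K0..<p}. 1 / real p))"
      by (simp only: sum_distrib_left sum.distrib)
    also have "\<dots> \<le> (\<mu> + 177 / 100) * (2 * sqrt (real k) * (1 - sqrt t0)) + (2 * \<Lambda> + 1)"
    proof (intro add_mono mult_left_mono)
      have "(\<Sum>l\<in>{K0..<p}. 1 / sqrt (real (Suc l))) \<le> 2 * (sqrt (real p) - sqrt (real K0))"
        by (rule sum_inverse_sqrt_le) (rule K0(2))
      hence "sqrt (real k) / sqrt (real p) * (\<Sum>l\<in>{K0..<p}. 1 / sqrt (real (Suc l)))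
          \<le> sqrt (real k) / sqrt (real p) * (2 * (sqrt (real p) - sqrt (real K0)))"
        by (intro mult_left_mono) auto
      also have "\<dots> \<le> 2 * sqrt (real k) * (1 - sqrt t0)" using K1 by (intro sq) auto
      finally show "sqrt (real k) / sqrt (real p) * (\<Sum>l\<in>{K0..<p}. 1 / sqrt (real (Suc l))) \<le> 2 * sqrt (real k) * (1 - sqrt t0)" .
      have "(\<Sum>l\<in>{K0..<p}. 1 / real (Suc l)) \<le> ln (real p / real K0)"
        using K0 by (intro sum_inverse_le_ln) auto
      also have "\<dots> \<le> \<Lambda>" using rp K0 by (intro lnL) auto
      finally show "(\<Sum>l\<in>{K0..<p}. 1 / real (Suc l)) \<le> \<Lambda>" .
      show "(\<Sum>l\<in>{K0..<p}. 1 / real p) \<le> 1" using rp by simp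
    qed (use mu(1) in auto)
    also have "2 * sqrt (real k) * (1 - sqrt t0) = real k * (2 * (1 - sqrt t0) / sqrt (real k))"
    proof -
      have "real k * (2 * (1 - sqrt t0) / sqrt (real k)) = real k / sqrt (real k) * (2 * (1 - sqrt t0))"
        by (simp only: times_divide_eq_left times_divide_eq_right)
      also have "real k / sqrt (real k) = sqrt (real k)" by (simp add: real_div_sqrt)
      finally show ?thesis by (simp only: mult_ac)
    qed
    also have "2 * \<Lambda> + 1 = real k * ((2 * \<Lambda> + 1) / real k)" using rk by simp
    finally show ?thesis by (simp only: distrib_left mult.left_commute)
  qed
  have A3: "(\<Sum>l\<in>{K0..<p}. (4 + 2 * expected_excess) / off_mean l / real p) \<le> (4 + 2 * e) * \<Lambda> / (real k - 1)"
  proof -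
    have E0: "0 \<le> expected_excess" unfolding expected_excess_def psi_def
      using mu(1) by (intro sum_nonneg divide_nonneg_nonneg mult_nonneg_nonneg add_nonneg_nonneg) auto
    have "(\<Sum>l\<in>{K0..<p}. (4 + 2 * expected_excess) / off_mean l / real p)
        = (\<Sum>l\<in>{K0..<p}. (4 + 2 * expected_excess) / (real k - 1) * (1 / real (K0 - 1 + (p - 1 - l))))"
      using rp k(1) by (intro sum.cong refl) (simp add: off_mean_def of_nat_diff)
    also have "\<dots> = (4 + 2 * expected_excess) / (real k - 1) * (\<Sum>l\<in>{K0..<p}. 1 / real (K0 - 1 + (p - 1 - l)))"
      by (simp only: sum_distrib_left)
    finally have eq: "(\<Sum>l\<in>{K0..<p}. (4 + 2 * expected_excess) / off_mean l / real p)
        = (4 + 2 * expected_excess) / (real k - 1) * (\<Sum>l\<in>{K0..<p}. 1 / real (K0 - 1 + (p - 1 - l)))" .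
    \<comment> \<open>Reversal of the sum: as l decreases from p - 1 to K0, the number of keys
      outside the window grows from K0 - 1 to p - 2.\<close>
    have "(\<Sum>l\<in>{K0..<p}. 1 / real (K0 - 1 + (p - 1 - l))) = (\<Sum>j\<in>{K0 - 2..<p - 2}. 1 / real (Suc j))"
      by (rule sum.reindex_bij_witness[of _ "\<lambda>j. K0 + p - 3 - j" "\<lambda>l. K0 + p - 3 - l"])
        (use K03 in \<open>auto intro!: arg_cong[where f = real]\<close>)
    also have "\<dots> \<le> ln (real (p - 2) / real (K0 - 2))"
      using K03 K0(2) by (intro sum_inverse_le_ln) auto
    also have "\<dots> \<le> \<Lambda>" using K03 p(2) by (intro lnL) auto
    finally have "(4 + 2 * expected_excess) / (real k - 1) * (\<Sum>l\<in>{K0..<p}. 1 / real (K0 - 1 + (p - 1 - l)))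
        \<le> (4 + 2 * e) / (real k - 1) * \<Lambda>"
      using E E0 rk by (intro mult_mono divide_right_mono) (auto intro!: sum_nonneg divide_nonneg_nonneg)
    thus ?thesis unfolding eq by simp
  qed
  have "(\<Sum>g\<in>{1..k}. reject_bound g) = real k * (real K0 / real p + 1 / (8 * real k))
     + (\<Sum>g\<in>{1..k}. \<Sum>l\<in>{K0..<p}. miss g l / real p)
     + real k * (\<Sum>l\<in>{K0..<p}. (4 + 2 * expected_excess) / off_mean l / real p)"
    unfolding reject_bound_def by (simp only: sum.distrib sum_constant card_atLeastAtMost) (simp add: distrib_left)
  also have "\<dots> \<le> real k * (t0 + 3 / real p + 1 / (8 * real k))
     + real k * ((\<mu> + 177 / 100) * (2 * (1 - sqrt t0) / sqrt (real k)) + (2 * \<Lambda> + 1) / real k)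
     + real k * ((4 + 2 * e) * \<Lambda> / (real k - 1))"
    using A1 by (intro add_mono mult_left_mono A2 A3) auto
  finally show ?thesis by (simp add: distrib_left)
qed

lemma miss_antimono:
  assumes "g \<le> g'"
  shows "miss g' l \<le> miss g l"
proof -
  define t where "t = real (Suc l) / real p"
  define c where "c = \<mu> * sqrt (real k * t)"
  define d d' where "d = real g * t - c - 2" and "d' = real g' * t - c - 2"
  have t: "0 \<le> t" by (simp add: t_def)
  have dd: "d \<le> d'" unfolding d_def d'_def using assms t by (simp add: mult_right_mono)
  have m: "miss g l = (if 0 < d then min 1 (31 / 10 * (real k * t) ^ 2 / d ^ 4) else 1)"
    "miss g' l = (if 0 < d' then min 1 (31 / 10 * (real k * t) ^ 2 / d' ^ 4) else 1)"
    by (simp_all add: miss_def Let_def d_def d'_def c_def t_def)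
  show ?thesis
  proof (cases "0 < d")
    case True
    hence "31 / 10 * (real k * t) ^ 2 / d' ^ 4 \<le> 31 / 10 * (real k * t) ^ 2 / d ^ 4"
      using dd by (intro divide_left_mono power_mono mult_pos_pos zero_less_power) auto
    thus ?thesis unfolding m using True dd by auto
  next
    case False
    thus ?thesis unfolding m by auto
  qed
qed

lemma reject_bound_antimono: "g \<le> g' \<Longrightarrow> reject_bound g' \<le> reject_bound g"
proof -
  assume "g \<le> g'"
  hence "(\<Sum>l\<in>{K0..<p}. miss g' l / real p) \<le> (\<Sum>l\<in>{K0..<p}. miss g l / real p)"
    by (intro sum_mono divide_right_mono miss_antimono) auto
  thus ?thesis unfolding reject_bound_def by simp
qed

text \<open>Larger values are rejected with smaller probability, so by Chebyshev's sum inequality the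
  average rejection probability over the ranks bounds the lost fraction of the optimum.\<close>

theorem expected_loss:
  assumes v: "\<And>x. x \<in> {1..n} \<Longrightarrow> 0 \<le> v x" and avg: "(\<Sum>g\<in>{1..k}. reject_bound g) \<le> real k * b"
  shows "(\<Sum>x\<in>best k. v x * pr (\<lambda>a. x \<notin> accepted_set a)) \<le> b * (\<Sum>x\<in>best k. v x)"
proof -
  have bij: "bij_betw rk (best k) {..<k}"
  proof -
    have B: "bij_betw rk {1..n} {..<n}" by (rule bij_betw_rank_of)
    have inj: "inj_on rk (best k)"
      by (rule inj_on_subset[OF bij_betw_imp_inj_on[OF B]]) (auto simp: top_set_def)
    moreover have "rk ` best k \<subseteq> {..<k}" by (auto simp: top_set_def)
    moreover have "card (rk ` best k) = card {..<k}" using inj k_le by (simp add: card_image card_top)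
    ultimately have "rk ` best k = {..<k}" by (intro card_subset_eq) auto
    with inj show ?thesis by (simp add: bij_betw_def)
  qed
  define w where "w = the_inv_into (best k) rk"
  have w: "bij_betw w {..<k} (best k)" unfolding w_def by (rule bij_betw_the_inv_into[OF bij])
  have rkw: "rk (w i) = i" if "i < k" for i
    unfolding w_def using bij that by (intro f_the_inv_into_f_bij_betw) auto
  have win: "w i \<in> best k" if "i < k" for i using w that by (auto simp: bij_betw_def)
  have vw: "v (w i) \<ge> v (w j)" if "i \<le> j" "j < k" for i j
  proof (cases "i = j")
    case False
    have "w i \<in> {1..n}" "w j \<in> {1..n}" using win that by (auto simp: top_set_def)
    hence "beats v (w i) (w j)" using rank_of_less_iff[of "w i" n "w j" v] rkw that False by simp
    thus ?thesis by (auto simp: exceeds_def)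
  qed simp
  have "(\<Sum>x\<in>best k. v x * pr (\<lambda>a. x \<notin> accepted_set a)) \<le> (\<Sum>x\<in>best k. v x * reject_bound (k - rk x))"
    using v by (intro sum_mono mult_left_mono pr_rejected) (auto simp: top_set_def)
  also have "\<dots> = (\<Sum>i<k. v (w i) * reject_bound (k - i))"
    using rkw by (subst sum.reindex_bij_betw[OF w, symmetric]) simp
  finally have 1: "(\<Sum>x\<in>best k. v x * pr (\<lambda>a. x \<notin> accepted_set a)) \<le> (\<Sum>i<k. v (w i) * reject_bound (k - i))" .
  have "real k * (\<Sum>i = 0..<k. reject_bound (k - i) * v (w i))
      \<le> (\<Sum>i = 0..<k. reject_bound (k - i)) * (\<Sum>i = 0..<k. v (w i))"
    by (rule Chebyshev_sum_upper) (auto intro: vw reject_bound_antimono)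
  hence "real k * (\<Sum>i = 0..<k. v (w i) * reject_bound (k - i))
      \<le> (\<Sum>i = 0..<k. v (w i)) * (\<Sum>i = 0..<k. reject_bound (k - i))" by (simp only: mult.commute)
  also have "(\<Sum>i = 0..<k. reject_bound (k - i)) = (\<Sum>g\<in>{1..k}. reject_bound g)"
    by (rule sum.reindex_bij_witness[of _ "\<lambda>g. k - g" "\<lambda>i. k - i"]) auto
  also have "(\<Sum>i = 0..<k. v (w i)) * (\<Sum>g\<in>{1..k}. reject_bound g) \<le> (\<Sum>i = 0..<k. v (w i)) * (real k * b)"
    using v win by (intro mult_left_mono avg sum_nonneg) (auto simp: top_set_def)
  finally have "real k * (\<Sum>i<k. v (w i) * reject_bound (k - i)) \<le> real k * (b * (\<Sum>i<k. v (w i)))"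
    by (simp add: atLeast0LessThan mult_ac)
  hence "(\<Sum>i<k. v (w i) * reject_bound (k - i)) \<le> b * (\<Sum>i<k. v (w i))" using k(1) by simp
  also have "(\<Sum>i<k. v (w i)) = (\<Sum>x\<in>best k. v x)" by (rule sum.reindex_bij_betw[OF w])
  finally show ?thesis using 1 by linarith
qed

end

section \<open>Orders computed by a program\<close>

text \<open>Total correctness with a time bound in the style of weakest preconditions: a
  postcondition may itself be a \<open>halts\<close> statement, which is how
  \<open>halts_seq\<close> chains programs.\<close>

definition halts :: "com \<Rightarrow> nat \<Rightarrow> (memory \<Rightarrow> nat list \<Rightarrow> bool) \<Rightarrow> memory \<Rightarrow> nat list \<Rightarrow> bool" where
  "halts c B Q m out \<longleftrightarrow> (\<exists>T m' out'. exec c (m, out) T (m', out') \<and> T \<le> B \<and> Q m' out')"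

lemma halts_mono:
  "halts c B Q m out \<Longrightarrow> B \<le> B' \<Longrightarrow> (\<And>m' out'. Q m' out' \<Longrightarrow> Q' m' out') \<Longrightarrow> halts c B' Q' m out"
  unfolding halts_def by (meson order.trans)

lemma halts_assign: "Q (m(a := (m a)(aval i m := aval x m))) out \<Longrightarrow> halts (Assign a i x) 1 Q m out"
  unfolding halts_def by (blast intro: exec.Assign)

lemma halts_write: "Q m (out @ [aval x m]) \<Longrightarrow> halts (Write x) 1 Q m out"
  unfolding halts_def by (blast intro: exec.Write)

lemma halts_seq: "halts c1 B1 (halts c2 B2 Q) m out \<Longrightarrow> halts (Seq c1 c2) (B1 + B2) Q m out"
  unfolding halts_def by (meson exec.Seq add_mono)

lemma halts_cond:
  assumes "aval b m \<noteq> 0 \<Longrightarrow> halts c1 B Q m out" "aval b m = 0 \<Longrightarrow> halts c2 B Q m out"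
  shows "halts (Cond b c1 c2) (Suc B) Q m out"
proof (cases "aval b m = 0")
  case True
  from assms(2)[OF this] obtain T m' out' where "exec c2 (m, out) T (m', out')" "T \<le> B" "Q m' out'"
    unfolding halts_def by blast
  moreover from this(1) True have "exec (Cond b c1 c2) (m, out) (Suc T) (m', out')"
    by (intro exec.CondFalse) simp_all
  ultimately show ?thesis unfolding halts_def by (meson Suc_le_mono)
next
  case False
  from assms(1)[OF this] obtain T m' out' where "exec c1 (m, out) T (m', out')" "T \<le> B" "Q m' out'"
    unfolding halts_def by blast
  moreover from this(1) False have "exec (Cond b c1 c2) (m, out) (Suc T) (m', out')"
    by (intro exec.CondTrue) simp_all
  ultimately show ?thesis unfolding halts_def by (meson Suc_le_mono)
qed

text \<open>The invariant is indexed by the number of completed rounds, and the total number N of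
  rounds is given in advance, so termination and running time come together.\<close>

lemma halts_loop:
  assumes step: "\<And>j m out. j < N \<Longrightarrow> Inv j m out \<Longrightarrow> aval b m \<noteq> 0 \<and> halts c B (Inv (Suc j)) m out"
    and stop: "\<And>m out. Inv N m out \<Longrightarrow> aval b m = 0 \<and> Q m out"
    and init: "Inv 0 m out"
  shows "halts (Loop b c) (N * Suc B + 1) Q m out"
proof -
  have "Inv (N - r) m out \<Longrightarrow> r \<le> N \<Longrightarrow> halts (Loop b c) (r * Suc B + 1) Q m out" for r m out
  proof (induction r arbitrary: m out)
    case 0
    hence "aval b m = 0" "Q m out" using stop[of m out] by simp_all
    moreover from this(1) have "exec (Loop b c) (m, out) 1 (m, out)" by (intro exec.LoopFalse) simp
    ultimately show ?case unfolding halts_def by auto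
  next
    case (Suc r)
    have j: "N - Suc r < N" "Suc (N - Suc r) = N - r" using Suc.prems(2) by auto
    from step[OF j(1) Suc.prems(1)] obtain T m1 out1
      where 1: "aval b m \<noteq> 0" "exec c (m, out) T (m1, out1)" "T \<le> B" "Inv (N - r) m1 out1"
      unfolding halts_def j(2) by blast
    from Suc.IH[OF 1(4)] Suc.prems(2) obtain T' m2 out2
      where 2: "exec (Loop b c) (m1, out1) T' (m2, out2)" "T' \<le> r * Suc B + 1" "Q m2 out2"
      unfolding halts_def by auto
    have "exec (Loop b c) (m, out) (Suc (T + T')) (m2, out2)"
      using 1(1) by (intro exec.LoopTrue[OF _ 1(2) 2(1)]) simp
    moreover have "Suc (T + T') \<le> Suc r * Suc B + 1" using 1(3) 2(2) by simp
    ultimately show ?case unfolding halts_def using 2(3) by blast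
  qed
  from this[of N m out] init show ?thesis by simp
qed

abbreviation var :: "nat \<Rightarrow> aexp" where "var a \<equiv> Cell a (Num 0)"

text \<open>The counter may be any cell with a constant index, so that the seed cells of array 12
  can themselves be loop counters. Truncated subtraction makes the test fail exactly when the
  counter has reached the bound.\<close>

definition For :: "nat \<Rightarrow> nat \<Rightarrow> aexp \<Rightarrow> com \<Rightarrow> com" where
  "For a i bnd c = Seq (Assign a (Num i) (Num 0))
     (Loop (Minus bnd (Cell a (Num i))) (Seq c (Assign a (Num i) (Plus (Cell a (Num i)) (Num 1)))))"

lemma halts_For:
  assumes step: "\<And>j m out. j < N \<Longrightarrow> Inv j m out \<Longrightarrow> m a i = j \<Longrightarrow>
      halts c B (\<lambda>m' out'. m' a i = j \<and> Inv (Suc j) (m'(a := (m' a)(i := Suc j))) out') m out"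
    and bnd: "\<And>j m out. Inv j m out \<Longrightarrow> aval bnd m = N"
    and stop: "\<And>m out. Inv N m out \<Longrightarrow> m a i = N \<Longrightarrow> Q m out"
    and init: "Inv 0 (m(a := (m a)(i := 0))) out"
  shows "halts (For a i bnd c) (N * (B + 2) + 2) Q m out"
proof -
  have "halts (Loop (Minus bnd (Cell a (Num i))) (Seq c (Assign a (Num i) (Plus (Cell a (Num i)) (Num 1)))))
      (N * Suc (B + 1) + 1) Q (m(a := (m a)(i := 0))) out"
  proof (rule halts_loop[where Inv = "\<lambda>j m out. Inv j m out \<and> m a i = j"])
    fix j m out assume j: "j < N" "Inv j m out \<and> m a i = j"
    have "halts c B (halts (Assign a (Num i) (Plus (Cell a (Num i)) (Num 1))) 1
        (\<lambda>m out. Inv (Suc j) m out \<and> m a i = Suc j)) m out"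
    proof (rule halts_mono[OF step order.refl])
      fix m' out' assume "m' a i = j \<and> Inv (Suc j) (m'(a := (m' a)(i := Suc j))) out'"
      thus "halts (Assign a (Num i) (Plus (Cell a (Num i)) (Num 1))) 1
        (\<lambda>m out. Inv (Suc j) m out \<and> m a i = Suc j) m' out'"
        by (intro halts_assign) simp
    qed (use j in auto)
    hence "halts (Seq c (Assign a (Num i) (Plus (Cell a (Num i)) (Num 1)))) (B + 1)
        (\<lambda>m out. Inv (Suc j) m out \<and> m a i = Suc j) m out"
      by (rule halts_seq)
    thus "aval (Minus bnd (Cell a (Num i))) m \<noteq> 0 \<and>
        halts (Seq c (Assign a (Num i) (Plus (Cell a (Num i)) (Num 1)))) (B + 1) (\<lambda>m out. Inv (Suc j) m out \<and> m a i = Suc j) m out"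
      using j bnd[of j m out] by simp
  next
    fix m out assume "Inv N m out \<and> m a i = N"
    thus "aval (Minus bnd (Cell a (Num i))) m = 0 \<and> Q m out" using bnd[of N m out] stop by simp
  qed (use init in simp)
  hence "halts (For a i bnd c) (1 + (N * Suc (B + 1) + 1)) Q m out"
    unfolding For_def by (intro halts_seq halts_assign) simp
  thus ?thesis by (rule halts_mono) auto
qed

definition frame :: "nat set \<Rightarrow> memory \<Rightarrow> memory \<Rightarrow> bool" where
  "frame S m m' \<longleftrightarrow> (\<forall>b. b \<notin> S \<longrightarrow> m' b = m b)"

lemma frame_refl: "frame S m m"
  by (simp add: frame_def)

lemma frame_trans:
  assumes "frame S m m'" "frame S' m' m''" "S \<subseteq> U" "S' \<subseteq> U"
  shows "frame U m m''"
  unfolding frame_def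
proof (intro allI impI)
  fix b assume "b \<notin> U"
  hence "b \<notin> S" "b \<notin> S'" using assms by blast+
  thus "m'' b = m b" using assms by (simp add: frame_def)
qed

lemma frame_upd: "frame S m m' \<Longrightarrow> a \<in> S \<Longrightarrow> frame S m (m'(a := f))"
  by (auto simp: frame_def)

lemma frameD: "frame S m m' \<Longrightarrow> b \<notin> S \<Longrightarrow> m' b = m b"
  by (simp add: frame_def)

text \<open>
  Memory layout: array 0 is the input, arrays 1 to 7 and 13 to 16 are scalar variables (1 is the prime
  \<open>p\<close>, 6 an accumulator, 15 a dummy), array 8 holds the hash values, array 9 the bucket sizes modulo
  \<open>p\<close>, array 11 the keys and array 12 the seed, that is the coefficients of the polynomial in cells
  \<open>0\<close> to \<open>5\<close> and the point of evaluation of the hash function in cell \<open>6\<close>.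
\<close>

definition Skip :: com where "Skip = Assign 15 (Num 0) (Num 0)"

lemma halts_Skip: "Q (m(15 := (m 15)(0 := 0))) out \<Longrightarrow> halts Skip 1 Q m out"
  unfolding Skip_def by (rule halts_assign) simp

text \<open>The accumulator is below p and the summand at most p, so a single conditional
  subtraction reduces the sum.\<close>

definition add_mod :: "aexp \<Rightarrow> com" where
  "add_mod x = Seq (Assign 6 (Num 0) (Plus (var 6) x))
     (Cond (Minus (var 1) (var 6)) Skip (Assign 6 (Num 0) (Minus (var 6) (var 1))))"

lemma halts_add_mod:
  assumes m: "m 1 0 = p" "m 6 0 = r" "aval x m = b" and r: "r < p" "b \<le> p"
    and Q: "\<And>m'. frame {6, 15} m m' \<Longrightarrow> m' 6 0 = (r + b) mod p \<Longrightarrow> Q m' out"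
  shows "halts (add_mod x) 3 Q m out"
proof -
  have "halts (add_mod x) (1 + Suc 1) Q m out"
    unfolding add_mod_def
  proof (intro halts_seq halts_assign halts_cond, goal_cases)
    case 1
    hence "r + b < p" using m by simp
    thus ?case using m by (intro halts_Skip Q) (auto intro!: frame_upd frame_refl)
  next
    case 2
    hence "p \<le> r + b" using m by simp
    hence "(r + b) mod p = r + b - p" using r by (simp add: le_mod_geq)
    thus ?case using m by (intro Q) (auto intro!: frame_upd frame_refl)
  qed
  thus ?thesis by (simp add: numeral_3_eq_3)
qed

text \<open>Repeated addition, as the machine cannot multiply. It is affordable because the factors
  are below p, which is polylogarithmic in n.\<close>

definition mul_mod :: "aexp \<Rightarrow> aexp \<Rightarrow> com" where
  "mul_mod x y = Seq (Assign 6 (Num 0) (Num 0)) (For 7 0 x (add_mod y))"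

lemma halts_mul_mod:
  assumes m: "m 1 0 = p" and b: "b < p"
    and xy: "\<And>m'. frame {6, 7, 15} m m' \<Longrightarrow> aval x m' = a \<and> aval y m' = b"
    and Q: "\<And>m'. frame {6, 7, 15} m m' \<Longrightarrow> m' 6 0 = (a * b) mod p \<Longrightarrow> Q m' out"
    and T: "1 + (a * 5 + 2) \<le> T"
  shows "halts (mul_mod x y) T Q m out"
proof -
  have "halts (mul_mod x y) (1 + (a * (3 + 2) + 2)) Q m out"
    unfolding mul_mod_def
  proof (intro halts_seq halts_assign, rule halts_For[where Inv = "\<lambda>j m' out'. frame {6, 7, 15} m m' \<and> m' 6 0 = (j * b) mod p \<and> out' = out"], goal_cases)
    case (1 j m1 out1)
    have "m1 1 0 = p" using 1 m by (auto simp: frameD)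
    thus ?case
    proof (rule halts_add_mod[OF _ refl])
      show "aval y m1 = b" using xy 1 by blast
      fix m2 assume m2: "frame {6, 15} m1 m2" "m2 6 0 = (m1 6 0 + b) mod p"
      have "(j * b mod p + b) mod p = Suc j * b mod p" by (simp add: mod_simps add.commute)
      moreover have "frame {6, 7, 15} m m2" using 1 m2 by (auto intro: frame_trans)
      ultimately show "m2 7 0 = j \<and> frame {6, 7, 15} m (m2(7 := (m2 7)(0 := Suc j)))
          \<and> (m2(7 := (m2 7)(0 := Suc j))) 6 0 = Suc j * b mod p \<and> out1 = out"
        using 1 m2 by (auto simp: frameD intro: frame_upd)
    qed (use 1 b in auto)
  qed (use xy Q in \<open>auto intro!: frame_upd frame_refl\<close>)
  thus ?thesis by (rule halts_mono) (use T in auto)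
qed

text \<open>The loop is unrolled for a fixed w, with the coefficients addressed by constants. Cell
  16 saves the accumulator, which \<open>mul_mod\<close> clears at its start.\<close>

definition horner :: "nat \<Rightarrow> aexp \<Rightarrow> com" where
  "horner w u = rec_nat Skip (\<lambda>j c. Seq (Assign 16 (Num 0) (var 6))
     (Seq (mul_mod (var 16) u) (Seq (add_mod (Cell 12 (Num j))) c))) w"

lemma horner_simps:
  "horner 0 u = Skip"
  "horner (Suc j) u = Seq (Assign 16 (Num 0) (var 6))
     (Seq (mul_mod (var 16) u) (Seq (add_mod (Cell 12 (Num j))) (horner j u)))"
  by (simp_all add: horner_def)

lemma halts_horner:
  assumes "m 1 0 = p" "m 6 0 = r" "r < p" "b < p" "\<And>i. i < w \<Longrightarrow> m 12 i < p"
    and "\<And>m'. frame {6, 7, 15, 16} m m' \<Longrightarrow> aval u m' = b"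
    and "\<And>m'. frame {6, 7, 15, 16} m m' \<Longrightarrow> m' 6 0 = (r * b ^ w + peval w (m 12) b) mod p \<Longrightarrow> Q m' out"
  shows "halts (horner w u) (w * (5 * p + 7) + 1) Q m out"
  using assms
proof (induction w arbitrary: m r)
  case 0
  have "halts Skip 1 Q m out"
  proof (rule halts_Skip, rule 0(7))
    show "frame {6, 7, 15, 16} m (m(15 := (m 15)(0 := 0)))" by (intro frame_upd frame_refl) simp
  qed (use 0 in \<open>simp add: peval_def\<close>)
  thus ?case unfolding horner_simps by simp
next
  case (Suc w)
  have p0: "0 < p" using Suc.prems by simp
  have *: "halts (horner w u) (w * (5 * p + 7) + 1) Q m3 out"
    if m3: "frame {6, 7, 15, 16} m m3" "m3 6 0 = (r * b mod p + m 12 w) mod p" for m3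
  proof (rule Suc.IH[of m3 "(r * b mod p + m 12 w) mod p"])
    show "m3 1 0 = p" using m3 Suc.prems(1) by (auto simp: frameD)
    show "aval u m' = b" if "frame {6, 7, 15, 16} m3 m'" for m'
      using Suc.prems(6) frame_trans[OF m3(1) that] by blast
    fix m' assume m': "frame {6, 7, 15, 16} m3 m'"
      "m' 6 0 = ((r * b mod p + m 12 w) mod p * b ^ w + peval w (m3 12) b) mod p"
    have 12: "m3 12 = m 12" using m3 by (auto simp: frameD)
    have "((r * b mod p + m 12 w) mod p * b ^ w + peval w (m 12) b) mod p
      = ((r * b + m 12 w) * b ^ w + peval w (m 12) b) mod p"
      by (metis (no_types, lifting) mod_add_left_eq mod_mult_left_eq)
    also have "(r * b + m 12 w) * b ^ w + peval w (m 12) b = r * b ^ Suc w + peval (Suc w) (m 12) b"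
      by (simp add: peval_def algebra_simps)
    finally show "Q m' out" using m' frame_trans[OF m3(1) m'(1)] unfolding 12
      by (intro Suc.prems(7)) auto
  qed (use m3 Suc.prems p0 in \<open>auto simp: frameD\<close>)
  have "halts (horner (Suc w) u) (1 + ((5 * p + 3) + (3 + (w * (5 * p + 7) + 1)))) Q m out"
    unfolding horner_simps
  proof (intro halts_seq halts_assign, goal_cases)
    case 1
    let ?m = "m(16 := (m 16)(aval (Num 0) m := aval (var 6) m))"
    have fr: "frame {6, 7, 15, 16} m ?m" by (auto intro!: frame_upd frame_refl)
    show ?case
    proof (rule halts_mul_mod[where a = r and b = b and p = p])
      show "aval (var 16) m' = r \<and> aval u m' = b" if "frame {6, 7, 15} ?m m'" for m'
      proof -
        have "frame {6, 7, 15, 16} m m'" using frame_trans[OF fr that] by auto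
        thus ?thesis using Suc.prems that by (auto simp: frameD)
      qed
      fix m2 assume m2: "frame {6, 7, 15} ?m m2" "m2 6 0 = r * b mod p"
      have fr2: "frame {6, 7, 15, 16} m m2" using frame_trans[OF fr m2(1)] by auto
      show "halts (Seq (add_mod (Cell 12 (Num w))) (horner w u)) (3 + (w * (5 * p + 7) + 1)) Q m2 out"
      proof (rule halts_seq, rule halts_add_mod[where p = p and r = "r * b mod p" and b = "m 12 w"])
        fix m3 assume m3: "frame {6, 15} m2 m3" "m3 6 0 = (r * b mod p + m 12 w) mod p"
        show "halts (horner w u) (w * (5 * p + 7) + 1) Q m3 out"
          using frame_trans[OF fr2 m3(1), of "{6, 7, 15, 16}"] m3(2) by (intro *) auto
      qed (use m2 fr2 Suc.prems p0 in \<open>auto simp: frameD less_imp_le\<close>)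
    qed (use Suc.prems in auto)
  qed
  thus ?case by (rule halts_mono) auto
qed

text \<open>Round j computes the cells 2j and 2j + 1 from cell j, so labels never have to be
  halved.\<close>

definition hash_table :: com where
  "hash_table = Seq (Assign 8 (Num 0) (Num 0)) (For 13 0 (Plus (var 0) (Num 1))
     (Seq (mul_mod (Cell 8 (var 13)) (Cell 12 (Num 6)))
     (Seq (Assign 8 (Plus (var 13) (var 13)) (var 6))
     (Seq (add_mod (Num 1))
          (Assign 8 (Plus (Plus (var 13) (var 13)) (Num 1)) (var 6))))))"

lemma bit_hash_double:
  "0 < j \<Longrightarrow> bit_hash p c (2 * j) = bit_hash p c j * c mod p"
  "bit_hash p c (2 * j + 1) = (bit_hash p c j * c mod p + 1) mod p"
proof -
  show "bit_hash p c (2 * j) = bit_hash p c j * c mod p" if "0 < j"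
    using that bit_hash.simps[of p c "2 * j"] by (simp add: mult.commute)
  have "bit_hash p c (2 * j + 1) = (c * bit_hash p c j + 1) mod p"
    using bit_hash.simps[of p c "2 * j + 1"] by simp
  also have "\<dots> = (bit_hash p c j * c mod p + 1) mod p"
    by (intro mod_add_cong) (simp_all add: mult.commute)
  finally show "bit_hash p c (2 * j + 1) = (bit_hash p c j * c mod p + 1) mod p" .
qed

lemma halts_hash_table:
  assumes m: "m 0 0 = n" "m 1 0 = p" "m 12 6 = c" and p: "1 < p" "c < p"
    and Q: "\<And>m'. frame {6, 7, 8, 13, 15} m m' \<Longrightarrow> (\<And>y. y \<le> n \<Longrightarrow> m' 8 y = bit_hash p c y) \<Longrightarrow> Q m' out"
  shows "halts hash_table ((n + 1) * (5 * p + 10) + 3) Q m out"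
proof -
  \<comment> \<open>Round j reads cell j, which is known because j < 2j, except when j = 0; the
    disjunct \<open>y = 0\<close> covers this first round.\<close>
  let ?Inv = "\<lambda>j m' out'. frame {6, 7, 8, 13, 15} m m' \<and> (\<forall>y. y < 2 * j \<or> y = 0 \<longrightarrow> m' 8 y = bit_hash p c y) \<and> out' = out"
  have "halts hash_table (1 + ((n + 1) * ((5 * p + 8) + 2) + 2)) Q m out"
    unfolding hash_table_def
  proof (intro halts_seq halts_assign, rule halts_For[where Inv = ?Inv], goal_cases)
    case (1 j m1 out1)
    have bj: "bit_hash p c j < p" using p by (intro bit_hash_less) simp
    have hj: "m1 8 j = bit_hash p c j" using 1 by (cases "j = 0") auto
    have fr1: "frame {6, 7, 8, 13, 15} m m1" using 1 by blast
    hence m1: "m1 1 0 = p" "m1 12 6 = c" using m by (auto simp: frameD)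
    have "halts (Seq (mul_mod (Cell 8 (var 13)) (Cell 12 (Num 6)))
     (Seq (Assign 8 (Plus (var 13) (var 13)) (var 6))
     (Seq (add_mod (Num 1))
          (Assign 8 (Plus (Plus (var 13) (var 13)) (Num 1)) (var 6))))) ((5 * p + 3) + (1 + (3 + 1)))
     (\<lambda>m' out'. m' 13 0 = j \<and> ?Inv (Suc j) (m'(13 := (m' 13)(0 := Suc j))) out') m1 out1"
    proof (rule halts_seq, rule halts_mul_mod[where a = "bit_hash p c j" and b = c and p = p])
      show "aval (Cell 8 (var 13)) m' = bit_hash p c j \<and> aval (Cell 12 (Num 6)) m' = c"
        if "frame {6, 7, 15} m1 m'" for m' using that 1 hj m1 by (auto simp: frameD)
      fix m2 assume m2: "frame {6, 7, 15} m1 m2" "m2 6 0 = bit_hash p c j * c mod p"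
      define m3 where "m3 = m2(8 := (m2 8)(aval (Plus (var 13) (var 13)) m2 := aval (var 6) m2))"
      have x: "m2 13 0 = j" using m2 1 by (auto simp: frameD)
      have m3: "m3 8 = (m1 8)(2 * j := bit_hash p c j * c mod p)" "m3 6 0 = bit_hash p c j * c mod p" "m3 13 0 = j" "m3 1 0 = p"
        using m2 x m1 by (auto simp: m3_def frameD mult_2)
      have fr3: "frame {6, 7, 8, 13, 15} m m3"
        unfolding m3_def using 1 m2 by (intro frame_upd frame_trans[of "{6, 7, 8, 13, 15}" m m1 "{6, 7, 15}" m2]) auto
      show "halts (Seq (Assign 8 (Plus (var 13) (var 13)) (var 6))
          (Seq (add_mod (Num 1)) (Assign 8 (Plus (Plus (var 13) (var 13)) (Num 1)) (var 6)))) (1 + (3 + 1))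
          (\<lambda>m' out'. m' 13 0 = j \<and> ?Inv (Suc j) (m'(13 := (m' 13)(0 := Suc j))) out') m2 out1"
      proof (rule halts_seq, rule halts_assign, rule halts_seq, fold m3_def,
          rule halts_add_mod[where p = p and r = "bit_hash p c j * c mod p" and b = 1], goal_cases)
        case (6 m4)
        have x4: "m4 13 0 = j" using 6 m3 by (auto simp: frameD)
        have fr4: "frame {6, 7, 8, 13, 15} m m4" using frame_trans[OF fr3 6(1)] by auto
        have 8: "m4 8 = (m1 8)(2 * j := bit_hash p c j * c mod p)" using 6 m3 by (auto simp: frameD)
        show ?case
        proof (rule halts_assign, intro conjI allI impI)
          fix y assume y: "y < 2 * Suc j \<or> y = 0"
          have b: "bit_hash p c 0 = 0" by (simp add: bit_hash.simps)
          consider "y = 2 * j + 1" | "y = 2 * j" "0 < j" | "y = 0" "j = 0" | "y < 2 * j"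
            by atomize_elim (use y in arith)
          thus "((m4(8 := (m4 8)(aval (Plus (Plus (var 13) (var 13)) (Num 1)) m4 := aval (var 6) m4)))
            (13 := ((m4(8 := (m4 8)(aval (Plus (Plus (var 13) (var 13)) (Num 1)) m4 := aval (var 6) m4))) 13)(0 := Suc j))) 8 y
            = bit_hash p c y"
          proof cases
            case 1
            thus ?thesis using x4 6 bit_hash_double(2)[of p c j] by (simp add: mult_2)
          next
            case 2
            thus ?thesis using x4 8 bit_hash_double(1)[of j p c] by (simp add: mult_2)
          next
            case 3
            thus ?thesis using x4 8 b by simp
          next
            case 4
            thus ?thesis using x4 8 1 by (simp add: mult_2)
          qed
        qed (use x4 fr4 1 in \<open>auto intro!: frame_upd\<close>)
      qed (use m3 p in auto)
    qed (use 1 m p bj in \<open>auto simp: frameD\<close>)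
    thus ?case by (rule halts_mono) auto
  next
    case (2 j m1 out1)
    thus ?case using m by (auto simp: frameD)
  next
    case (3 m1 out1)
    thus ?case by (auto intro!: Q)
  qed (auto intro!: frame_upd frame_refl simp: bit_hash.simps)
  thus ?thesis by (rule halts_mono) auto
qed

definition clear_counters :: com where
  "clear_counters = For 13 0 (var 1) (Assign 9 (var 13) (Num 0))"

lemma halts_clear_counters:
  assumes m: "m 1 0 = p"
    and Q: "\<And>m'. frame {9, 13} m m' \<Longrightarrow> (\<And>y. y < p \<Longrightarrow> m' 9 y = 0) \<Longrightarrow> Q m' out"
  shows "halts clear_counters (p * 3 + 2) Q m out"
proof -
  have "halts clear_counters (p * (1 + 2) + 2) Q m out"
    unfolding clear_counters_def
  proof (rule halts_For[where Inv = "\<lambda>j m' out'. frame {9, 13} m m' \<and> (\<forall>y<j. m' 9 y = 0) \<and> out' = out"], goal_cases)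
    case (1 j m1 out1)
    thus ?case by (intro halts_assign) (auto intro!: frame_upd simp: less_Suc_eq)
  qed (use m Q in \<open>auto intro!: frame_upd frame_refl simp: frameD\<close>)
  thus ?thesis by (rule halts_mono) auto
qed

text \<open>The bucket counter is added before it is incremented, so it counts smaller labels only.
  Resetting it at p keeps it a residue, as \<open>add_mod\<close> requires.\<close>

definition compute_keys :: com where
  "compute_keys = (let x = Plus (var 13) (Num 1); u = Cell 8 x in
     For 13 0 (var 0) (Seq (Assign 6 (Num 0) (Num 0)) (Seq (horner 6 u) (Seq (add_mod (Cell 9 u))
       (Seq (Assign 11 x (var 6)) (Seq (Assign 9 u (Plus (Cell 9 u) (Num 1)))
         (Cond (Minus (var 1) (Cell 9 u)) Skip (Assign 9 u (Num 0)))))))))"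

lemma halts_compute_keys:
  assumes m: "m 0 0 = n" "m 1 0 = p" and p: "1 < p" and a: "\<And>i. i < 6 \<Longrightarrow> m 12 i < p"
    and h: "\<And>y. y \<in> {1..n} \<Longrightarrow> m 8 y = h y" "\<And>y. h y < p" and cnt: "\<And>u. u < p \<Longrightarrow> m 9 u = 0"
    and Q: "\<And>m'. frame {6, 7, 9, 11, 13, 15, 16} m m' \<Longrightarrow>
      (\<And>y. y \<in> {1..n} \<Longrightarrow> m' 11 y = spread_key p (peval 6 (m 12)) h y) \<Longrightarrow> Q m' out"
  shows "halts compute_keys (n * (30 * p + 53) + 2) Q m out"
proof -
  let ?S = "{6, 7, 9, 11, 13, 15, 16} :: nat set"
  let ?T = "spread_key p (peval 6 (m 12)) h"
  let ?Inv = "\<lambda>j m' out'. frame ?S m m' \<and> (\<forall>y\<in>{1..j}. m' 11 y = ?T y)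
    \<and> (\<forall>u<p. m' 9 u = card {y \<in> {1..<Suc j}. h y = u} mod p) \<and> out' = out"
  have "halts compute_keys (n * ((30 * p + 51) + 2) + 2) Q m out"
    unfolding compute_keys_def Let_def
  proof (rule halts_For[where Inv = ?Inv], goal_cases)
    case (1 j m1 out1)
    let ?x = "Plus (var 13) (Num 1)"
    let ?u = "Cell 8 ?x"
    let ?hx = "h (Suc j)"
    let ?post = "\<lambda>m' out'. m' 13 0 = j \<and> ?Inv (Suc j) (m'(13 := (m' 13)(0 := Suc j))) out'"
    have u: "aval ?u m' = ?hx" if "m' 8 = m 8" "m' 13 0 = j" for m'
      using that h(1)[of "Suc j"] 1 by simp
    have hp: "?hx < p" by (rule h(2))
    have fr1: "frame ?S m m1" using 1 by simp
    have m1: "m1 1 0 = p" "m1 12 = m 12" "m1 8 = m 8" using fr1 m by (auto simp: frameD)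
    have tail: "halts (Seq (Assign 11 ?x (var 6)) (Seq (Assign 9 ?u (Plus (Cell 9 ?u) (Num 1)))
         (Cond (Minus (var 1) (Cell 9 ?u)) Skip (Assign 9 ?u (Num 0))))) (1 + (1 + Suc 1)) ?post m2 out"
      if m2: "frame {6, 7, 15, 16} m1 m2" "m2 6 0 = ?T (Suc j)" for m2
    proof -
      have fr2: "frame ?S m m2" using frame_trans[OF fr1 m2(1)] by auto
      have m2': "m2 1 0 = p" "m2 8 = m 8" "m2 13 0 = j" "m2 9 = m1 9" "m2 11 = m1 11"
        using m2 m1 1 by (auto simp: frameD)
      have cnt_eq: "m2 9 w = card {y \<in> {1..<Suc j}. h y = w} mod p" if "w < p" for w
        using 1 m2' that by simp
      have step: "card {y \<in> {1..<Suc (Suc j)}. h y = w} = card {y \<in> {1..<Suc j}. h y = w} + (if w = ?hx then 1 else 0)" for w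
      proof -
        have "{y \<in> {1..<Suc (Suc j)}. h y = w} = (if w = ?hx then insert (Suc j) {y \<in> {1..<Suc j}. h y = w} else {y \<in> {1..<Suc j}. h y = w})"
          by (auto simp: less_Suc_eq)
        thus ?thesis by simp
      qed
      define m3 where "m3 = m2(11 := (m2 11)(Suc j := ?T (Suc j)))"
      define m4 where "m4 = m3(9 := (m3 9)(?hx := m2 9 ?hx + 1))"
      have fr4: "frame ?S m m4" unfolding m4_def m3_def using fr2 by (intro frame_upd) auto
      have e3: "m2(11 := (m2 11)(aval ?x m2 := aval (var 6) m2)) = m3" using m2' m2 by (simp add: m3_def)
      have u3: "aval ?u m3 = ?hx" using m2' by (intro u) (simp_all add: m3_def)
      have e4: "m3(9 := (m3 9)(aval ?u m3 := aval (Plus (Cell 9 ?u) (Num 1)) m3)) = m4"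
        unfolding m4_def using u3 by (simp add: m3_def)
      have u4: "aval ?u m4 = ?hx" using m2' by (intro u) (simp_all add: m3_def m4_def)
      have c4: "aval (Minus (var 1) (Cell 9 ?u)) m4 = p - (m2 9 ?hx + 1)"
        using u4 m2' by (simp add: m4_def m3_def)
      have x4: "m4 13 0 = j" using m2' by (simp add: m4_def m3_def)
      have keys: "m4 11 y = ?T y" if "y \<in> {1..Suc j}" for y
        using that 1 m2' by (auto simp: m4_def m3_def)
      show ?thesis
      proof (rule halts_seq, rule halts_assign, unfold e3, rule halts_seq, rule halts_assign, unfold e4, rule halts_cond)
        assume "aval (Minus (var 1) (Cell 9 ?u)) m4 \<noteq> 0"
        hence less: "m2 9 ?hx + 1 < p" unfolding c4 by simp
        show "halts Skip 1 ?post m4 out"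
        proof (rule halts_Skip, intro conjI ballI allI impI)
          fix w assume w: "w < p"
          have "card {y \<in> {1..<Suc j}. h y = ?hx} mod p + 1 < p" using less cnt_eq[OF hp] by simp
          hence "(card {y \<in> {1..<Suc j}. h y = ?hx} + 1) mod p = card {y \<in> {1..<Suc j}. h y = ?hx} mod p + 1"
            by (metis mod_add_left_eq mod_less)
          hence "m4 9 w = card {y \<in> {1..<Suc (Suc j)}. h y = w} mod p"
            unfolding step using cnt_eq[OF w] cnt_eq[OF hp] by (simp add: m4_def m3_def)
          thus "((m4(15 := (m4 15)(0 := 0)))(13 := ((m4(15 := (m4 15)(0 := 0))) 13)(0 := Suc j))) 9 w
            = card {y \<in> {1..<Suc (Suc j)}. h y = w} mod p" by simp
        qed (use x4 keys in \<open>auto intro!: frame_upd fr4\<close>)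
      next
        assume "aval (Minus (var 1) (Cell 9 ?u)) m4 = 0"
        hence ge: "p \<le> m2 9 ?hx + 1" unfolding c4 by simp
        show "halts (Assign 9 ?u (Num 0)) 1 ?post m4 out"
        proof (rule halts_assign, unfold u4, intro conjI ballI allI impI)
          fix w assume w: "w < p"
          have "card {y \<in> {1..<Suc j}. h y = ?hx} mod p < p" using p by simp
          hence "card {y \<in> {1..<Suc j}. h y = ?hx} mod p + 1 = p"
            using ge cnt_eq[OF hp] by linarith
          hence "(card {y \<in> {1..<Suc j}. h y = ?hx} + 1) mod p = 0"
            by (metis mod_add_left_eq mod_self)
          hence "((m4 9)(?hx := 0)) w = card {y \<in> {1..<Suc (Suc j)}. h y = w} mod p"
            unfolding step using cnt_eq[OF w] by (simp add: m4_def m3_def)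
          thus "((m4(9 := (m4 9)(?hx := aval (Num 0) m4)))(13 := ((m4(9 := (m4 9)(?hx := aval (Num 0) m4))) 13)(0 := Suc j))) 9 w
            = card {y \<in> {1..<Suc (Suc j)}. h y = w} mod p" by simp
        qed (use x4 keys in \<open>auto intro!: frame_upd fr4\<close>)
      qed
    qed
    have "halts (Seq (Assign 6 (Num 0) (Num 0)) (Seq (horner 6 ?u) (Seq (add_mod (Cell 9 ?u))
       (Seq (Assign 11 ?x (var 6)) (Seq (Assign 9 ?u (Plus (Cell 9 ?u) (Num 1)))
         (Cond (Minus (var 1) (Cell 9 ?u)) Skip (Assign 9 ?u (Num 0))))))))
       (1 + ((6 * (5 * p + 7) + 1) + (3 + (1 + (1 + Suc 1))))) ?post m1 out"
    proof (rule halts_seq, rule halts_assign, rule halts_seq)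
      let ?m = "m1(6 := (m1 6)(aval (Num 0) m1 := aval (Num 0) m1))"
      have fr: "frame {6, 7, 15, 16} m1 ?m" by (auto intro!: frame_upd frame_refl)
      show "halts (horner 6 ?u) (6 * (5 * p + 7) + 1) (halts (Seq (add_mod (Cell 9 ?u))
       (Seq (Assign 11 ?x (var 6)) (Seq (Assign 9 ?u (Plus (Cell 9 ?u) (Num 1)))
         (Cond (Minus (var 1) (Cell 9 ?u)) Skip (Assign 9 ?u (Num 0)))))) (3 + (1 + (1 + Suc 1))) ?post) ?m out"
      proof (rule halts_horner[where r = 0 and b = ?hx])
        show "aval ?u m' = ?hx" if "frame {6, 7, 15, 16} ?m m'" for m'
          using that m1 1 by (intro u) (auto simp: frameD)
        fix m2 assume m2: "frame {6, 7, 15, 16} ?m m2" "m2 6 0 = (0 * ?hx ^ 6 + peval 6 (?m 12) ?hx) mod p"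
        have fr2: "frame {6, 7, 15, 16} m1 m2" using frame_trans[OF fr m2(1)] by auto
        have hx: "?hx < p" by (rule hp)
        have r: "m2 6 0 = peval 6 (m 12) ?hx mod p" using m2 m1 by simp
        have c: "m2 9 ?hx = card {y \<in> {1..<Suc j}. h y = ?hx} mod p" using fr2 1 hp by (auto simp: frameD)
        show "halts (Seq (add_mod (Cell 9 ?u)) (Seq (Assign 11 ?x (var 6)) (Seq (Assign 9 ?u (Plus (Cell 9 ?u) (Num 1)))
         (Cond (Minus (var 1) (Cell 9 ?u)) Skip (Assign 9 ?u (Num 0)))))) (3 + (1 + (1 + Suc 1))) ?post m2 out"
        proof (rule halts_seq, rule halts_add_mod[where p = p and r = "peval 6 (m 12) ?hx mod p" and b = "m2 9 ?hx"])
          have "aval ?u m2 = ?hx" using fr2 m1 1 by (intro u) (auto simp: frameD)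
          thus "aval (Cell 9 ?u) m2 = m2 9 ?hx" by simp
          show "m2 9 ?hx \<le> p" using c p by (simp add: less_imp_le)
          fix m3 assume m3: "frame {6, 15} m2 m3" "m3 6 0 = (peval 6 (m 12) ?hx mod p + m2 9 ?hx) mod p"
          show "halts (Seq (Assign 11 ?x (var 6)) (Seq (Assign 9 ?u (Plus (Cell 9 ?u) (Num 1)))
            (Cond (Minus (var 1) (Cell 9 ?u)) Skip (Assign 9 ?u (Num 0))))) (1 + (1 + Suc 1)) ?post m3 out"
          proof (rule tail)
            show "frame {6, 7, 15, 16} m1 m3" using frame_trans[OF fr2 m3(1)] by auto
            show "m3 6 0 = ?T (Suc j)" using m3(2) unfolding c spread_key_def by (simp add: mod_add_eq)
          qed
        qed (use r p fr2 m1 in \<open>auto simp: frameD\<close>)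
      qed (use m1 p hp a in auto)
    qed
    moreover have "out1 = out" using 1 by simp
    ultimately show ?case by - (rule halts_mono, auto)
  next
    case (2 j m1 out1)
    thus ?case using m by (auto simp: frameD)
  next
    case (3 m1 out1)
    thus ?case by (auto intro!: Q)
  next
    case 4
    thus ?case using cnt by (auto intro!: frame_upd frame_refl)
  qed
  thus ?thesis by (rule halts_mono) auto
qed

text \<open>Equality of key and loop counter is tested by adding the two truncated differences,
  which is zero only if both numbers agree.\<close>

definition write_order :: com where
  "write_order = (let x = Plus (var 13) (Num 1); y = Cell 11 x in
     For 14 0 (var 1) (For 13 0 (var 0)
       (Cond (Plus (Minus y (var 14)) (Minus (var 14) y)) Skip (Write x))))"

lemma halts_write_order:
  assumes m: "m 0 0 = n" "m 1 0 = p" "\<And>y. y \<in> {1..n} \<Longrightarrow> m 11 y = T y"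
    and Q: "\<And>m'. frame {13, 14, 15} m m' \<Longrightarrow> Q m' (out @ key_order p n T)"
  shows "halts write_order (p * (n * 4 + 4) + 2) Q m out"
proof -
  let ?x = "Plus (var 13) (Num 1)"
  let ?y = "Cell 11 ?x"
  let ?c = "Cond (Plus (Minus ?y (var 14)) (Minus (var 14) ?y)) Skip (Write ?x)"
  let ?f = "\<lambda>t. filter (\<lambda>x. T x = t)"
  let ?Inv = "\<lambda>t m' out'. frame {13, 14, 15} m m' \<and> out' = out @ concat (map (\<lambda>t. ?f t [1..<n + 1]) [0..<t])"
  have inner: "halts (For 13 0 (var 0) ?c) (n * (2 + 2) + 2)
      (\<lambda>m' out'. m' 14 0 = t \<and> frame {13, 15} m1 m' \<and> out' = out1 @ ?f t [1..<n + 1]) m1 out1"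
    if m1: "m1 0 0 = n" "m1 14 0 = t" "m1 11 = m 11" for m1 out1 t
  proof (rule halts_For[where Inv = "\<lambda>j m' out'. frame {13, 15} m1 m' \<and> out' = out1 @ ?f t [1..<j + 1]"], goal_cases)
    case (1 j m2 out2)
    have y: "aval ?y m2 = T (Suc j)" "m2 14 0 = t" using 1 m1 m(3) by (auto simp: frameD)
    have up: "[1..<Suc j + 1] = [1..<j + 1] @ [Suc j]" by simp
    have "halts ?c (Suc 1) (\<lambda>m' out'. m' 13 0 = j \<and> frame {13, 15} m1 (m'(13 := (m' 13)(0 := Suc j)))
      \<and> out' = out1 @ ?f t [1..<Suc j + 1]) m2 out2"
    proof (rule halts_cond)
      assume "aval (Plus (Minus ?y (var 14)) (Minus (var 14) ?y)) m2 \<noteq> 0"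
      hence "T (Suc j) \<noteq> t" using y by (intro notI) simp
      thus "halts Skip 1 (\<lambda>m' out'. m' 13 0 = j \<and> frame {13, 15} m1 (m'(13 := (m' 13)(0 := Suc j)))
        \<and> out' = out1 @ ?f t [1..<Suc j + 1]) m2 out2"
        unfolding up by (intro halts_Skip) (use 1 in \<open>auto intro!: frame_upd\<close>)
    next
      assume "aval (Plus (Minus ?y (var 14)) (Minus (var 14) ?y)) m2 = 0"
      hence "T (Suc j) = t" using y by simp
      thus "halts (Write ?x) 1 (\<lambda>m' out'. m' 13 0 = j \<and> frame {13, 15} m1 (m'(13 := (m' 13)(0 := Suc j)))
        \<and> out' = out1 @ ?f t [1..<Suc j + 1]) m2 out2"
        unfolding up by (intro halts_write) (use 1 in \<open>auto intro!: frame_upd\<close>)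
    qed
    thus ?case by (simp only: numeral_2_eq_2 One_nat_def)
  qed (use m1 in \<open>auto intro!: frame_upd frame_refl simp: frameD\<close>)
  have "halts write_order (p * ((n * (2 + 2) + 2) + 2) + 2) Q m out"
    unfolding write_order_def Let_def
  proof (rule halts_For[where Inv = ?Inv], goal_cases)
    case (1 t m1 out1)
    have m1: "m1 0 0 = n" "m1 11 = m 11" using 1 m by (auto simp: frameD)
    show ?case
    proof (rule halts_mono[OF inner[OF m1(1) 1(3) m1(2), of out1] order.refl])
      fix m2 out2 assume m2: "m2 14 0 = t \<and> frame {13, 15} m1 m2 \<and> out2 = out1 @ ?f t [1..<n + 1]"
      have "frame {13, 14, 15} m m2" using 1 m2 by (auto intro: frame_trans)
      thus "m2 14 0 = t \<and> ?Inv (Suc t) (m2(14 := (m2 14)(0 := Suc t))) out2"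
        using 1 m2 by (auto intro!: frame_upd)
    qed
  next
    case (2 t m1 out1)
    thus ?case using m by (auto simp: frameD)
  next
    case (3 m1 out1)
    thus ?case using Q by (auto simp: key_order_def)
  qed (auto intro!: frame_upd frame_refl)
  thus ?thesis by (rule halts_mono) (auto simp: algebra_simps)
qed

definition seed_order :: "nat \<Rightarrow> nat \<Rightarrow> (nat \<Rightarrow> nat) \<Rightarrow> nat list" where
  "seed_order p n a = key_order p n (spread_key p (peval 6 a) (bit_hash p (a 6)))"

definition order_prog :: com where
  "order_prog = Seq hash_table (Seq clear_counters (Seq compute_keys write_order))"

lemma halts_order_prog:
  assumes m: "m 0 0 = n" "m 1 0 = p" "\<And>i. i < 7 \<Longrightarrow> m 12 i < p" and p: "1 < p"
    and Q: "\<And>m'. frame {6, 7, 8, 9, 11, 13, 14, 15, 16} m m' \<Longrightarrow> Q m' (out @ seed_order p n (m 12))"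
  shows "halts order_prog ((n + 1) * (5 * p + 10) + 3 + (p * 3 + 2 + (n * (30 * p + 53) + 2 + (p * (n * 4 + 4) + 2)))) Q m out"
  unfolding order_prog_def
proof (rule halts_seq, rule halts_hash_table[where m = m and c = "m 12 6", OF m(1,2) refl p])
  let ?U = "{6, 7, 8, 9, 11, 13, 14, 15, 16} :: nat set"
  show "m 12 6 < p" using m(3) by simp
  fix m1 assume m1: "frame {6, 7, 8, 13, 15} m m1" "\<And>y. y \<le> n \<Longrightarrow> m1 8 y = bit_hash p (m 12 6) y"
  have e1: "m1 0 0 = n" "m1 1 0 = p" "m1 12 = m 12" using m1(1) m by (auto simp: frameD)
  show "halts (Seq clear_counters (Seq compute_keys write_order))
      (p * 3 + 2 + (n * (30 * p + 53) + 2 + (p * (n * 4 + 4) + 2))) Q m1 out"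
  proof (rule halts_seq, rule halts_clear_counters[where m = m1 and p = p, OF e1(2)])
    fix m2 assume m2: "frame {9, 13} m1 m2" "\<And>y. y < p \<Longrightarrow> m2 9 y = 0"
    have e2: "m2 0 0 = n" "m2 1 0 = p" "m2 12 = m 12" "m2 8 = m1 8" using m2(1) e1 by (auto simp: frameD)
    have fr2: "frame ?U m m2" by (rule frame_trans[OF m1(1) m2(1)]) auto
    show "halts (Seq compute_keys write_order) (n * (30 * p + 53) + 2 + (p * (n * 4 + 4) + 2)) Q m2 out"
    proof (rule halts_seq, rule halts_compute_keys[where m = m2 and p = p and h = "bit_hash p (m 12 6)", OF e2(1,2) p])
      show "m2 12 i < p" if "i < 6" for i using that m(3)[of i] e2 by simp
      show "m2 8 y = bit_hash p (m 12 6) y" if "y \<in> {1..n}" for y using that m1(2) e2 by simp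
      show "bit_hash p (m 12 6) y < p" for y using p by (intro bit_hash_less) simp
      show "m2 9 u = 0" if "u < p" for u by (rule m2(2)[OF that])
      fix m3 assume m3: "frame {6, 7, 9, 11, 13, 15, 16} m2 m3"
        "\<And>y. y \<in> {1..n} \<Longrightarrow> m3 11 y = spread_key p (peval 6 (m2 12)) (bit_hash p (m 12 6)) y"
      have e3: "m3 0 0 = n" "m3 1 0 = p" using m3(1) e2 by (auto simp: frameD)
      have fr3: "frame ?U m m3" by (rule frame_trans[OF fr2 m3(1)]) auto
      show "halts write_order (p * (n * 4 + 4) + 2) Q m3 out"
      proof (rule halts_write_order[where m = m3 and T = "spread_key p (peval 6 (m 12)) (bit_hash p (m 12 6))", OF e3])
        show "m3 11 y = spread_key p (peval 6 (m 12)) (bit_hash p (m 12 6)) y" if "y \<in> {1..n}" for y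
          using m3(2)[OF that] e2 by simp
        fix m4 assume m4: "frame {13, 14, 15} m3 m4"
        have "frame ?U m m4" by (rule frame_trans[OF fr3 m4]) auto
        from Q[OF this] show "Q m4 (out @ key_order p n (spread_key p (peval 6 (m 12)) (bit_hash p (m 12 6))))"
          by (simp add: seed_order_def)
      qed
    qed
  qed
qed

section \<open>Enumeration of all seeds by nested loops\<close>

definition nest :: "nat \<Rightarrow> com \<Rightarrow> com" where
  "nest w c = rec_nat c (\<lambda>j d. For 12 j (var 1) d) w"

text \<open>The seeds in the order in which \<open>nest\<close> visits them: the coordinates below j
  are overwritten, and those from j on come from the outer loops.\<close>

primrec seeds :: "nat \<Rightarrow> nat \<Rightarrow> (nat \<Rightarrow> nat) \<Rightarrow> (nat \<Rightarrow> nat) list" where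
  "seeds p 0 a = [a]"
| "seeds p (Suc j) a = concat (map (\<lambda>s. seeds p j (a(j := s))) [0..<p])"

primrec nest_time :: "nat \<Rightarrow> nat \<Rightarrow> nat \<Rightarrow> nat" where
  "nest_time p B 0 = B"
| "nest_time p B (Suc j) = p * (nest_time p B j + 2) + 2"

lemma seeds_cong: "(\<And>i. j \<le> i \<Longrightarrow> a i = b i) \<Longrightarrow> seeds p j a = seeds p j b"
proof (induction j arbitrary: a b)
  case 0
  hence "a = b" by auto
  thus ?case by simp
next
  case (Suc j)
  have "seeds p j (a(j := s)) = seeds p j (b(j := s))" for s
  proof (rule Suc.IH)
    fix i assume "j \<le> i"
    thus "(a(j := s)) i = (b(j := s)) i" using Suc.prems[of i] by (cases "i = j") auto
  qed
  thus ?case by simp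
qed

text \<open>The body is specified for all postconditions, so that it fits the invariants of all
  surrounding loops. Besides the frame, the cells of array 12 from j on must survive, since they are
  the counters of the outer loops.\<close>

lemma halts_nest:
  assumes body: "\<And>m out Q. m 0 0 = n \<Longrightarrow> m 1 0 = p \<Longrightarrow> (\<And>i. i < W \<Longrightarrow> m 12 i < p) \<Longrightarrow>
      (\<And>m'. frame S m m' \<Longrightarrow> Q m' (out @ f (m 12))) \<Longrightarrow> halts c B Q m out"
    and S: "0 \<notin> S" "1 \<notin> S" "12 \<notin> S"
  shows "j \<le> W \<Longrightarrow> m 0 0 = n \<Longrightarrow> m 1 0 = p \<Longrightarrow> (\<And>i. j \<le> i \<Longrightarrow> i < W \<Longrightarrow> m 12 i < p) \<Longrightarrow>
    (\<And>m'. frame (insert 12 S) m m' \<Longrightarrow> (\<And>i. j \<le> i \<Longrightarrow> m' 12 i = m 12 i) \<Longrightarrow>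
      Q m' (out @ concat (map f (seeds p j (m 12))))) \<Longrightarrow> halts (nest j c) (nest_time p B j) Q m out"
proof (induction j arbitrary: m out Q)
  case 0
  have "halts c B Q m out"
  proof (rule body)
    fix m' assume m': "frame S m m'"
    have "frame (insert 12 S) m m'" by (rule frame_trans[OF m' frame_refl[of S]]) auto
    moreover have "m' 12 = m 12" using m' S by (auto simp: frameD)
    ultimately show "Q m' (out @ f (m 12))" using 0(5)[of m'] by simp
  qed (use 0 in auto)
  thus ?case by (simp add: nest_def)
next
  case (Suc j)
  let ?Inv = "\<lambda>s m' out'. frame (insert 12 S) m m' \<and> (\<forall>i\<ge>Suc j. m' 12 i = m 12 i)
    \<and> out' = out @ concat (map f (concat (map (\<lambda>s. seeds p j ((m 12)(j := s))) [0..<s])))"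
  have "halts (For 12 j (var 1) (nest j c)) (p * (nest_time p B j + 2) + 2) Q m out"
  proof (rule halts_For[where Inv = ?Inv], goal_cases)
    case (1 s m1 out1)
    hence fr1: "frame (insert 12 S) m m1" and up: "\<And>i. Suc j \<le> i \<Longrightarrow> m1 12 i = m 12 i"
      and o1: "out1 = out @ concat (map f (concat (map (\<lambda>s. seeds p j ((m 12)(j := s))) [0..<s])))" by auto
    have e1: "m1 0 0 = n" "m1 1 0 = p" using fr1 S Suc.prems(2,3) by (auto simp: frame_def)
    show ?case
    proof (rule Suc.IH[where m = m1, OF _ e1])
      show "j \<le> W" using Suc.prems(1) by simp
      show "m1 12 i < p" if "j \<le> i" "i < W" for i
        using that 1 up[of i] Suc.prems(4)[of i] by (cases "i = j") auto
      fix m2 assume m2: "frame (insert 12 S) m1 m2" "\<And>i. j \<le> i \<Longrightarrow> m2 12 i = m1 12 i"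
      have "seeds p j (m1 12) = seeds p j ((m 12)(j := s))"
      proof (rule seeds_cong)
        fix i assume "j \<le> i"
        thus "m1 12 i = ((m 12)(j := s)) i" using up[of i] 1 by (cases "i = j") auto
      qed
      moreover have "frame (insert 12 S) m (m2(12 := (m2 12)(j := Suc s)))"
        by (intro frame_upd frame_trans[OF fr1 m2(1)]) auto
      ultimately show "m2 12 j = s \<and> ?Inv (Suc s) (m2(12 := (m2 12)(j := Suc s))) (out1 @ concat (map f (seeds p j (m1 12))))"
        using m2(2) up 1(3) by (simp add: o1)
    qed
  next
    case (2 s m1 out1)
    hence "frame (insert 12 S) m m1" by blast
    thus ?case using S Suc.prems(3) by (auto simp: frame_def)
  next
    case (3 m1 out1)
    thus ?case using Suc.prems(5)[of m1] by simp
  next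
    case 4
    show ?case by (simp, intro frame_upd frame_refl) simp
  qed
  thus ?case by (simp add: nest_def)
qed

lemma set_seeds: "set (seeds p w a) = {b. (\<forall>i<w. b i < p) \<and> (\<forall>i\<ge>w. b i = a i)}"
proof (induction w arbitrary: a)
  case 0
  show ?case by auto
next
  case (Suc w)
  have "set (seeds p (Suc w) a) = (\<Union>s<p. {b. (\<forall>i<w. b i < p) \<and> (\<forall>i\<ge>w. b i = (a(w := s)) i)})"
    by (simp add: Suc.IH atLeast0LessThan)
  also have "\<dots> = {b. (\<forall>i<Suc w. b i < p) \<and> (\<forall>i\<ge>Suc w. b i = a i)}"
  proof (intro equalityI subsetI)
    fix b assume "b \<in> (\<Union>s<p. {b. (\<forall>i<w. b i < p) \<and> (\<forall>i\<ge>w. b i = (a(w := s)) i)})"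
    then obtain s where s: "s < p" "\<forall>i<w. b i < p" "\<And>i. w \<le> i \<Longrightarrow> b i = (a(w := s)) i" by blast
    have "b w = s" using s(3)[of w] by simp
    moreover have "b i = a i" if "Suc w \<le> i" for i using s(3)[of i] that by simp
    ultimately show "b \<in> {b. (\<forall>i<Suc w. b i < p) \<and> (\<forall>i\<ge>Suc w. b i = a i)}"
      using s by (simp add: less_Suc_eq)
  next
    fix b assume b: "b \<in> {b. (\<forall>i<Suc w. b i < p) \<and> (\<forall>i\<ge>Suc w. b i = a i)}"
    have "\<forall>i\<ge>w. b i = (a(w := b w)) i"
    proof (intro allI impI)
      fix i assume "w \<le> i"
      thus "b i = (a(w := b w)) i" using b by (cases "i = w") auto
    qed
    moreover have "\<forall>i<w. b i < p" using b by simp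
    ultimately have "b \<in> {b'. (\<forall>i<w. b' i < p) \<and> (\<forall>i\<ge>w. b' i = (a(w := b w)) i)}" by blast
    moreover have "b w \<in> {..<p}" using b by simp
    ultimately show "b \<in> (\<Union>s<p. {b. (\<forall>i<w. b i < p) \<and> (\<forall>i\<ge>w. b i = (a(w := s)) i)})" by (rule UN_I[rotated])
  qed
  finally show ?case .
qed

lemma length_seeds: "length (seeds p w a) = p ^ w"
proof (induction w arbitrary: a)
  case (Suc w)
  have "length (concat (map (\<lambda>s. seeds p w (a(w := s))) xs)) = length xs * p ^ w" for xs
    by (induction xs) (simp_all add: Suc.IH)
  from this[of "[0..<p]"] show ?case by (simp only: seeds.simps length_upt diff_zero power_Suc)
qed simp

lemma set_seeds_zero: "set (seeds p w (\<lambda>_. 0)) = coefs p w"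
  unfolding set_seeds PiE_dflt_def by (auto simp: not_less)

lemma distinct_seeds: "distinct (seeds p w (\<lambda>_. 0))"
  by (rule card_distinct) (simp add: set_seeds_zero length_seeds card_coefs)

section \<open>Computing the bit length and, by trial division, the prime\<close>

definition bit_length :: "nat \<Rightarrow> nat" where
  "bit_length n = (LEAST l. n < 2 ^ l)"

lemma bit_length: "n < 2 ^ bit_length n"
  unfolding bit_length_def by (rule LeastI[of _ n]) simp

lemma less_bit_length: "j < bit_length n \<Longrightarrow> 2 ^ j \<le> n"
  unfolding bit_length_def by (drule not_less_Least) simp

lemma bit_length_le: "bit_length n \<le> n"
  unfolding bit_length_def by (rule Least_le) simp

definition bit_length_prog :: com where
  "bit_length_prog = Seq (Assign 2 (Num 0) (Num 1)) (Seq (Assign 3 (Num 0) (Num 0))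
     (Loop (Minus (Plus (var 0) (Num 1)) (var 2))
       (Seq (Assign 2 (Num 0) (Plus (var 2) (var 2))) (Assign 3 (Num 0) (Plus (var 3) (Num 1))))))"

lemma halts_bit_length_prog:
  assumes m: "m 0 0 = n" and Q: "\<And>m'. frame {2, 3} m m' \<Longrightarrow> m' 3 0 = bit_length n \<Longrightarrow> Q m' out"
  shows "halts bit_length_prog (bit_length n * 3 + 3) Q m out"
proof -
  let ?Inv = "\<lambda>j m' out'. frame {2, 3} m m' \<and> m' 2 0 = 2 ^ j \<and> m' 3 0 = j \<and> out' = out"
  have n: "m1 0 0 = n" if "frame {2, 3} m m1" for m1 using that m by (auto simp: frameD)
  have "halts bit_length_prog (1 + (1 + (bit_length n * Suc (1 + 1) + 1))) Q m out"
    unfolding bit_length_prog_def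
  proof (intro halts_seq halts_assign, rule halts_loop[where Inv = ?Inv], goal_cases)
    case (1 j m1 out1)
    have fr: "frame {2, 3} m m1" using 1 by blast
    have "2 ^ j \<le> n" by (rule less_bit_length[OF 1(1)])
    hence "aval (Minus (Plus (var 0) (Num 1)) (var 2)) m1 \<noteq> 0" using 1 n[OF fr] by simp
    moreover have "halts (Seq (Assign 2 (Num 0) (Plus (var 2) (var 2))) (Assign 3 (Num 0) (Plus (var 3) (Num 1)))) (1 + 1) (?Inv (Suc j)) m1 out1"
      by (intro halts_seq halts_assign conjI frame_upd fr) (use 1 in auto)
    ultimately show ?case by blast
  next
    case (2 m1 out1)
    have fr: "frame {2, 3} m m1" using 2 by blast
    show ?case using 2 n[OF fr] bit_length[of n] Q[OF fr] by simp
  next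
    case 3
    show ?case by (simp, intro frame_upd frame_refl) simp_all
  qed
  thus ?thesis by (rule halts_mono) auto
qed

definition square_prog :: com where
  "square_prog = Seq (Assign 6 (Num 0) (Num 0)) (Seq (For 7 0 (var 2) (Assign 6 (Num 0) (Plus (var 6) (var 2))))
     (Assign 2 (Num 0) (var 6)))"

lemma halts_square_prog:
  assumes m: "m 2 0 = y" and Q: "\<And>m'. frame {2, 6, 7} m m' \<Longrightarrow> m' 2 0 = y ^ 2 \<Longrightarrow> Q m' out"
  shows "halts square_prog (y * 3 + 4) Q m out"
proof -
  let ?Inv = "\<lambda>j m' out'. frame {6, 7} m m' \<and> m' 6 0 = j * y \<and> out' = out"
  have y: "m1 2 0 = y" if "frame {6, 7} m m1" for m1 using that m by (auto simp: frameD)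
  have "halts square_prog (1 + ((y * (1 + 2) + 2) + 1)) Q m out"
    unfolding square_prog_def
  proof (intro halts_seq, rule halts_assign, intro halts_seq, rule halts_For[where Inv = ?Inv], goal_cases)
    case (1 j m1 out1)
    have fr: "frame {6, 7} m m1" using 1 by blast
    show ?case
      by (intro halts_assign conjI frame_upd fr) (use 1 y[OF fr] in auto)
  next
    case (2 j m1 out1)
    thus ?case using y by simp
  next
    case (3 m1 out1)
    have fr: "frame {6, 7} m m1" using 3 by blast
    have fr2: "frame {2, 6, 7} m m1" by (rule frame_trans[OF fr frame_refl[of "{}"]]) auto
    have "Q (m1(2 := (m1 2)(0 := m1 6 0))) out"
      by (intro Q frame_upd fr2) (use 3 in \<open>simp_all add: power2_eq_square\<close>)
    thus ?case using 3 by (intro halts_assign) simp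
  next
    case 4
    show ?case by (simp, intro frame_upd frame_refl) simp_all
  qed
  thus ?thesis by (rule halts_mono) auto
qed

definition next_prime :: "nat \<Rightarrow> nat" where
  "next_prime N = (LEAST p. prime p \<and> N < p)"

lemma next_prime:
  shows "prime (next_prime N)" "N < next_prime N"
proof -
  obtain p :: nat where "prime p \<and> N < p" using bigger_prime by blast
  hence "prime (next_prime N) \<and> N < next_prime N" unfolding next_prime_def by (rule LeastI)
  thus "prime (next_prime N)" "N < next_prime N" by auto
qed

lemma not_prime_before_next: "N < q \<Longrightarrow> q < next_prime N \<Longrightarrow> \<not> prime q"
  unfolding next_prime_def using not_less_Least by blast

lemma next_prime_le_square: "7 \<le> N \<Longrightarrow> next_prime N \<le> N ^ 2"
  using prime_between_square[of N] unfolding next_prime_def by (metis (mono_tags, lifting) Least_le order.trans)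

text \<open>The remainder is found by repeated subtraction; adding 1 in the loop test makes it
  succeed also when the accumulator equals the divisor. The flag in array 4 is only ever set, so it
  collects the outcome over all divisors tried.\<close>

definition divisor_test :: com where
  "divisor_test = Seq (Assign 6 (Num 0) (var 1)) (Seq (Loop (Minus (Plus (var 6) (Num 1)) (var 5)) (Assign 6 (Num 0) (Minus (var 6) (var 5))))
     (Seq (Cond (var 6) Skip (Assign 4 (Num 0) (Num 1))) (Assign 5 (Num 0) (Plus (var 5) (Num 1)))))"

lemma halts_divisor_test:
  assumes m: "m 1 0 = q" "m 5 0 = d" "0 < d"
    and Q: "\<And>m'. frame {4, 5, 6, 15} m m' \<Longrightarrow> m' 5 0 = Suc d \<Longrightarrow> m' 4 0 = (if d dvd q then 1 else m 4 0) \<Longrightarrow> Q m' out"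
  shows "halts divisor_test (2 * q + 5) Q m out"
proof -
  let ?m = "m(6 := (m 6)(0 := q))"
  let ?Inv = "\<lambda>j m' out'. frame {6} m m' \<and> m' 6 0 = q - j * d \<and> out' = out"
  have d: "m1 5 0 = d" if "frame {6} m m1" for m1 using that m by (auto simp: frameD)
  have rest: "halts (Seq (Cond (var 6) Skip (Assign 4 (Num 0) (Num 1))) (Assign 5 (Num 0) (Plus (var 5) (Num 1)))) (Suc 1 + 1) Q m1 out"
    if m1: "frame {6} m m1" "m1 6 0 = q mod d" for m1
  proof (intro halts_seq halts_cond)
    have fr: "frame {4, 5, 6, 15} m m1" by (rule frame_trans[OF m1(1) frame_refl[of "{}"]]) auto
    have e: "m1 5 0 = d" "m1 4 = m 4" using m1 m by (auto simp: frameD)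
    { assume "aval (var 6) m1 \<noteq> 0"
      hence nd: "\<not> d dvd q" using m1 by (simp add: dvd_eq_mod_eq_0)
      have "Q ((m1(15 := (m1 15)(0 := 0)))(5 := ((m1(15 := (m1 15)(0 := 0))) 5)(0 := Suc d))) out"
        by (intro Q frame_upd fr) (use nd e in simp_all)
      thus "halts Skip 1 (halts (Assign 5 (Num 0) (Plus (var 5) (Num 1))) 1 Q) m1 out"
        using e by (intro halts_Skip halts_assign) simp }
    { assume "aval (var 6) m1 = 0"
      hence dd: "d dvd q" using m1 by (simp add: dvd_eq_mod_eq_0)
      have "Q ((m1(4 := (m1 4)(0 := 1)))(5 := ((m1(4 := (m1 4)(0 := 1))) 5)(0 := Suc d))) out"
        by (intro Q frame_upd fr) (use dd e in simp_all)
      thus "halts (Assign 4 (Num 0) (Num 1)) 1 (halts (Assign 5 (Num 0) (Plus (var 5) (Num 1))) 1 Q) m1 out"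
        using e by (intro halts_assign) simp }
  qed
  have "halts divisor_test (1 + ((q div d * Suc 1 + 1) + (Suc 1 + 1))) Q m out"
    unfolding divisor_test_def
  proof (rule halts_seq, rule halts_assign, rule halts_seq, rule halts_loop[where Inv = ?Inv], goal_cases)
    case (1 j m1 out1)
    have fr: "frame {6} m m1" using 1 by blast
    have "Suc j * d \<le> q div d * d" using 1(1) by (intro mult_le_mono1) simp
    also have "\<dots> \<le> q" by simp
    finally have le: "Suc j * d \<le> q" .
    have "halts (Assign 6 (Num 0) (Minus (var 6) (var 5))) 1 (?Inv (Suc j)) m1 out1"
      by (intro halts_assign conjI frame_upd fr) (use 1 d[OF fr] in auto)
    moreover have "aval (Minus (Plus (var 6) (Num 1)) (var 5)) m1 \<noteq> 0" using 1 d[OF fr] le by simp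
    ultimately show ?case by blast
  next
    case (2 m1 out1)
    have fr: "frame {6} m m1" using 2 by blast
    have r: "m1 6 0 = q mod d" using 2 by (simp add: minus_div_mult_eq_mod)
    moreover have "q mod d < d" using m(3) by simp
    ultimately have "aval (Minus (Plus (var 6) (Num 1)) (var 5)) m1 = 0" using d[OF fr] by simp
    moreover have "out1 = out" using 2 by blast
    ultimately show ?case using rest[OF fr r] by simp
  next
    case 3
    show ?case using m by (simp, intro frame_upd frame_refl) simp_all
  qed
  thus ?thesis 
    by (rule halts_mono) (use div_le_dividend[of q d] in \<open>linarith | simp\<close>)+
qed

definition prime_test :: com where
  "prime_test = Seq (Assign 1 (Num 0) (Plus (var 1) (Num 1))) (Seq (Assign 4 (Num 0) (Num 0)) (Seq (Assign 5 (Num 0) (Num 2))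
     (Loop (Minus (var 1) (var 5)) divisor_test)))"

lemma halts_prime_test:
  assumes m: "Suc (m 1 0) = q" "2 \<le> q"
    and Q: "\<And>m'. frame {1, 4, 5, 6, 15} m m' \<Longrightarrow> m' 1 0 = q \<Longrightarrow> m' 4 0 = (if prime q then 0 else 1) \<Longrightarrow> Q m' out"
  shows "halts prime_test (q * (2 * q + 6) + 4) Q m out"
proof -
  let ?Inv = "\<lambda>j m' out'. frame {1, 4, 5, 6, 15} m m' \<and> m' 1 0 = q \<and> m' 5 0 = 2 + j
    \<and> m' 4 0 = (if \<exists>d\<in>{2..<2 + j}. d dvd q then 1 else 0) \<and> out' = out"
  have "halts prime_test (1 + (1 + (1 + ((q - 2) * Suc (2 * q + 5) + 1)))) Q m out"
    unfolding prime_test_def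
  proof (intro halts_seq, rule halts_assign, intro halts_seq, rule halts_assign, intro halts_seq, rule halts_assign,
      rule halts_loop[where Inv = ?Inv], goal_cases)
    case (1 j m1 out1)
    have fr: "frame {1, 4, 5, 6, 15} m m1" and e: "m1 1 0 = q" "m1 5 0 = 2 + j"
      "m1 4 0 = (if \<exists>d\<in>{2..<2 + j}. d dvd q then 1 else 0)" "out1 = out" using 1 by blast+
    have "halts divisor_test (2 * q + 5) (?Inv (Suc j)) m1 out1"
    proof (rule halts_divisor_test[where m = m1, OF e(1,2)])
      fix m2 assume m2: "frame {4, 5, 6, 15} m1 m2" "m2 5 0 = Suc (2 + j)" "m2 4 0 = (if 2 + j dvd q then 1 else m1 4 0)"
      have "frame {1, 4, 5, 6, 15} m m2" by (rule frame_trans[OF fr m2(1)]) auto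
      moreover have "m2 1 0 = q" using m2(1) e by (auto simp: frameD)
      moreover have "(\<exists>d\<in>{2..<2 + Suc j}. d dvd q) \<longleftrightarrow> (\<exists>d\<in>{2..<2 + j}. d dvd q) \<or> 2 + j dvd q"
        by (auto simp: less_Suc_eq)
      ultimately show "?Inv (Suc j) m2 out1" using m2 e by simp
    qed simp
    moreover have "aval (Minus (var 1) (var 5)) m1 \<noteq> 0" using e 1(1) by simp
    ultimately show ?case by blast
  next
    case (2 m1 out1)
    have fr: "frame {1, 4, 5, 6, 15} m m1" and e: "m1 1 0 = q" "m1 5 0 = 2 + (q - 2)"
      "m1 4 0 = (if \<exists>d\<in>{2..<2 + (q - 2)}. d dvd q then 1 else 0)" "out1 = out" using 2 by blast+
    have "prime q \<longleftrightarrow> \<not> (\<exists>d\<in>{2..<2 + (q - 2)}. d dvd q)" using m(2) by (auto simp: prime_nat_iff')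
    hence "m1 4 0 = (if prime q then 0 else 1)" using e(3) by simp
    thus ?case using e m(2) Q[OF fr] by simp
  next
    case 3
    show ?case using m by (simp, intro frame_upd frame_refl) simp_all
  qed
  moreover have "1 + (1 + (1 + ((q - 2) * Suc (2 * q + 5) + 1))) \<le> q * (2 * q + 6) + 4"
    using mult_le_mono[of "q - 2" q "Suc (2 * q + 5)" "2 * q + 6"] by simp
  ultimately show ?thesis by (rule halts_mono)
qed

definition find_prime :: com where
  "find_prime = Seq (Assign 4 (Num 0) (Num 1)) (Loop (var 4) prime_test)"

lemma halts_find_prime:
  assumes m: "m 1 0 = N" "1 \<le> N"
    and Q: "\<And>m'. frame {1, 4, 5, 6, 15} m m' \<Longrightarrow> m' 1 0 = next_prime N \<Longrightarrow> Q m' out"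
  defines "p \<equiv> next_prime N"
  shows "halts find_prime (p * (p * (2 * p + 6) + 5) + 2) Q m out"
proof -
  let ?Inv = "\<lambda>j m' out'. frame {1, 4, 5, 6, 15} m m' \<and> m' 1 0 = N + j \<and> (m' 4 0 = 0 \<longleftrightarrow> j = p - N) \<and> j \<le> p - N \<and> out' = out"
  have Np: "N < p" unfolding p_def by (rule next_prime)
  have "halts find_prime (1 + ((p - N) * Suc (p * (2 * p + 6) + 4) + 1)) Q m out"
    unfolding find_prime_def
  proof (rule halts_seq, rule halts_assign, rule halts_loop[where Inv = ?Inv], goal_cases)
    case (1 j m1 out1)
    have fr: "frame {1, 4, 5, 6, 15} m m1" and e: "m1 1 0 = N + j" "m1 4 0 = 0 \<longleftrightarrow> j = p - N" "out1 = out" using 1 by blast+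
    let ?q = "N + Suc j"
    have q: "?q \<le> p" using 1(1) by simp
    have "halts prime_test (?q * (2 * ?q + 6) + 4) (?Inv (Suc j)) m1 out1"
    proof (rule halts_prime_test)
      fix m2 assume m2: "frame {1, 4, 5, 6, 15} m1 m2" "m2 1 0 = ?q" "m2 4 0 = (if prime ?q then 0 else 1)"
      have "frame {1, 4, 5, 6, 15} m m2" by (rule frame_trans[OF fr m2(1)]) auto
      moreover have "prime ?q \<longleftrightarrow> Suc j = p - N"
      proof
        assume "prime ?q"
        hence "\<not> ?q < p" using not_prime_before_next[of N ?q] by (auto simp: p_def)
        thus "Suc j = p - N" using q by simp
      next
        assume "Suc j = p - N"
        hence "?q = p" using Np by simp
        thus "prime ?q" using next_prime(1) by (simp add: p_def)
      qed
      ultimately show "?Inv (Suc j) m2 out1" using m2 e 1(1) by simp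
    qed (use e m(2) in simp_all)
    hence "halts prime_test (p * (2 * p + 6) + 4) (?Inv (Suc j)) m1 out1"
    proof (rule halts_mono)
      have "?q * (2 * ?q + 6) \<le> p * (2 * p + 6)"
        by (rule mult_le_mono[OF q], rule add_right_mono, rule mult_le_mono2[OF q])
      thus "?q * (2 * ?q + 6) + 4 \<le> p * (2 * p + 6) + 4" by (rule add_right_mono)
    qed
    thus ?case using e 1(1) by simp
  next
    case (2 m1 out1)
    have fr: "frame {1, 4, 5, 6, 15} m m1" using 2 by blast
    show ?case using 2 Q[OF fr] Np by (simp add: p_def)
  next
    case 3
    show ?case using m Np by (simp, intro frame_upd frame_refl) simp_all
  qed
  moreover have "1 + ((p - N) * Suc (p * (2 * p + 6) + 4) + 1) \<le> p * (p * (2 * p + 6) + 5) + 2"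
    using mult_le_mono[of "p - N" p "Suc (p * (2 * p + 6) + 4)" "p * (2 * p + 6) + 5"] by simp
  ultimately show ?thesis by (rule halts_mono)
qed

text \<open>The exponent 8 is reached by three squarings and is large enough: at most k^4 l hash
  points are bad, and with k <= l this has to be less than p/(8k), which amounts to p exceeding a
  constant times l^6.\<close>

definition field_size :: "nat \<Rightarrow> nat" where
  "field_size n = next_prime (bit_length n ^ 8)"

definition secretary_prog :: com where
  "secretary_prog = Seq bit_length_prog (Seq (Assign 2 (Num 0) (var 3)) (Seq square_prog (Seq square_prog (Seq square_prog
     (Seq (Assign 1 (Num 0) (var 2)) (Seq find_prime (nest 7 order_prog)))))))"

definition order_time :: "nat \<Rightarrow> nat \<Rightarrow> nat" where
  "order_time n p = (n + 1) * (5 * p + 10) + 3 + (p * 3 + 2 + (n * (30 * p + 53) + 2 + (p * (n * 4 + 4) + 2)))"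

lemma halts_secretary_prog:
  assumes m: "m 0 0 = n" "m 12 = (\<lambda>_. 0)" and n: "1 \<le> n"
  defines "l \<equiv> bit_length n" and "p \<equiv> field_size n"
  shows "halts secretary_prog ((l * 3 + 3) + (1 + ((l * 3 + 4) + ((l ^ 2 * 3 + 4) + ((l ^ 4 * 3 + 4) + (1 + ((p * (p * (2 * p + 6) + 5) + 2)
      + nest_time p (order_time n p) 7)))))))
    (\<lambda>m' out'. out' = concat (map (seed_order p n) (seeds p 7 (\<lambda>_. 0)))) m []"
proof -
  let ?S = "{1, 2, 3, 4, 5, 6, 7, 15} :: nat set"
  let ?Q = "\<lambda>m' out'. out' = concat (map (seed_order p n) (seeds p 7 (\<lambda>_. 0)))"
  have l1: "1 \<le> l"
  proof (rule ccontr)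
    assume "\<not> 1 \<le> l"
    hence "bit_length n = 0" by (simp add: l_def)
    thus False using bit_length[of n] n by simp
  qed
  have np: "next_prime (l ^ 8) = p" by (simp add: p_def l_def field_size_def)
  have p: "prime p" "l ^ 8 < p" unfolding p_def field_size_def l_def by (rule next_prime)+
  have p1: "1 < p" using prime_gt_1_nat[OF p(1)] .
  show ?thesis
    unfolding secretary_prog_def
  proof (rule halts_seq, rule halts_bit_length_prog[where m = m and n = n, OF m(1), folded l_def])
    fix m1 assume m1: "frame {2, 3} m m1" "m1 3 0 = l"
    have fr1: "frame ?S m (m1(2 := (m1 2)(0 := l)))"
      by (intro frame_upd frame_trans[OF m1(1) frame_refl[of "{}"]]) auto
    have a1: "m1(2 := (m1 2)(aval (Num 0) m1 := aval (var 3) m1)) = m1(2 := (m1 2)(0 := l))" using m1 by simp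
    show "halts (Seq (Assign 2 (Num 0) (var 3)) (Seq square_prog (Seq square_prog (Seq square_prog
        (Seq (Assign 1 (Num 0) (var 2)) (Seq find_prime (nest 7 order_prog))))))) (1 + ((l * 3 + 4) + ((l ^ 2 * 3 + 4) + ((l ^ 4 * 3 + 4) + (1 + ((p * (p * (2 * p + 6) + 5) + 2)
      + nest_time p (order_time n p) 7)))))) ?Q m1 []"
    proof (rule halts_seq, rule halts_assign, unfold a1, rule halts_seq, rule halts_square_prog[where y = l])
      fix m2 assume m2: "frame {2, 6, 7} (m1(2 := (m1 2)(0 := l))) m2" "m2 2 0 = l ^ 2"
      have fr2: "frame ?S m m2" by (rule frame_trans[OF fr1 m2(1)]) auto
      show "halts (Seq square_prog (Seq square_prog
        (Seq (Assign 1 (Num 0) (var 2)) (Seq find_prime (nest 7 order_prog))))) ((l ^ 2 * 3 + 4) + ((l ^ 4 * 3 + 4) + (1 + ((p * (p * (2 * p + 6) + 5) + 2)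
      + nest_time p (order_time n p) 7)))) ?Q m2 []"
      proof (rule halts_seq, rule halts_square_prog[where m = m2, OF m2(2)])
        fix m3 assume m3: "frame {2, 6, 7} m2 m3" "m3 2 0 = (l ^ 2) ^ 2"
        have fr3: "frame ?S m m3" by (rule frame_trans[OF fr2 m3(1)]) auto
        have m3': "m3 2 0 = l ^ 4" using m3(2) by simp
        show "halts (Seq square_prog
          (Seq (Assign 1 (Num 0) (var 2)) (Seq find_prime (nest 7 order_prog)))) ((l ^ 4 * 3 + 4) + (1 + ((p * (p * (2 * p + 6) + 5) + 2)
          + nest_time p (order_time n p) 7))) ?Q m3 []"
        proof (rule halts_seq, rule halts_square_prog[where m = m3, OF m3'])
          fix m4 assume m4: "frame {2, 6, 7} m3 m4" "m4 2 0 = (l ^ 4) ^ 2"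
          have fr4: "frame ?S m (m4(1 := (m4 1)(0 := l ^ 8)))"
            by (intro frame_upd frame_trans[OF fr3 m4(1)]) auto
          have a4: "m4(1 := (m4 1)(aval (Num 0) m4 := aval (var 2) m4)) = m4(1 := (m4 1)(0 := l ^ 8))"
            using m4(2) by simp
          show "halts (Seq (Assign 1 (Num 0) (var 2)) (Seq find_prime (nest 7 order_prog))) (1 + ((p * (p * (2 * p + 6) + 5) + 2)
            + nest_time p (order_time n p) 7)) ?Q m4 []"
          proof (rule halts_seq, rule halts_assign, unfold a4, rule halts_seq,
              rule halts_find_prime[where N = "l ^ 8", unfolded np])
            fix m5 assume m5: "frame {1, 4, 5, 6, 15} (m4(1 := (m4 1)(0 := l ^ 8))) m5" "m5 1 0 = p"
            have fr5: "frame ?S m m5" by (rule frame_trans[OF fr4 m5(1)]) auto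
            have e5: "m5 0 0 = n" "m5 12 = (\<lambda>_. 0)" using fr5 m by (auto simp: frameD)
            show "halts (nest 7 order_prog) (nest_time p (order_time n p) 7) ?Q m5 []"
            proof (rule halts_nest[where n = n and p = p and W = 7 and f = "seed_order p n" and S = "{6, 7, 8, 9, 11, 13, 14, 15, 16}"])
              fix m out Q
              assume "m 0 0 = n" "m 1 0 = p" "\<And>i. i < 7 \<Longrightarrow> m 12 i < p"
                "\<And>m'. frame {6, 7, 8, 9, 11, 13, 14, 15, 16} m m' \<Longrightarrow> Q m' (out @ seed_order p n (m 12))"
              thus "halts order_prog (order_time n p) Q m out"
                unfolding order_time_def by (intro halts_order_prog p1)
            qed (use e5 m5 in auto)
          qed (use l1 in simp_all)
        qed
      qed
    qed simp
  qed
qed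

lemma nest_time_le:
  assumes "1 \<le> B" "1 \<le> p"
  shows "nest_time p B j \<le> (5 * p) ^ j * B \<and> 1 \<le> nest_time p B j"
proof (induction j)
  case (Suc j)
  define x where "x = nest_time p B j"
  have x: "1 \<le> x" "x \<le> (5 * p) ^ j * B" using Suc by (auto simp: x_def)
  have "p * 1 \<le> p * x" using x(1) by (rule mult_le_mono2)
  moreover have "p * (x + 2) + 2 = p * x + 2 * p + 2" by (simp add: distrib_left)
  ultimately have "p * (x + 2) + 2 \<le> 5 * (p * x)" using assms(2) by linarith
  also have "\<dots> \<le> 5 * (p * ((5 * p) ^ j * B))" using x(2) by (intro mult_le_mono2)
  finally show ?case by (simp add: x_def mult_ac)
qed (use assms in simp)

lemma time_le:
  fixes l n p :: nat
  assumes "1 \<le> n" "1 \<le> p" "l \<le> p" "l ^ 2 \<le> p" "l ^ 4 \<le> p"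
  shows "(l * 3 + 3) + (1 + ((l * 3 + 4) + ((l ^ 2 * 3 + 4) + ((l ^ 4 * 3 + 4) + (1 + ((p * (p * (2 * p + 6) + 5) + 2)
      + nest_time p (order_time n p) 7)))))) \<le> 20000000 * (n * p ^ 8)"
proof -
  define y where "y = n * p"
  have y: "1 \<le> y" "n \<le> y" "p \<le> y" using assms by (auto simp: y_def)
  have ot: "order_time n p \<le> 150 * y"
  proof -
    have "order_time n p = 39 * y + 63 * n + 12 * p + 19"
      by (simp add: order_time_def y_def algebra_simps)
    thus ?thesis using y by linarith
  qed
  have ot1: "1 \<le> order_time n p" by (simp add: order_time_def)
  have "nest_time p (order_time n p) 7 \<le> (5 * p) ^ 7 * order_time n p" using nest_time_le[OF ot1 assms(2)] by blast
  also have "\<dots> \<le> (5 * p) ^ 7 * (150 * y)" using ot by (rule mult_le_mono2)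
  also have "\<dots> = 11718750 * (n * p ^ 8)"
  proof -
    have "(5 * p) ^ 7 = 78125 * p ^ 7" by (simp add: power_mult_distrib)
    moreover have "p ^ 8 = p ^ 7 * p" using power_Suc2[of p 7] by simp
    ultimately show ?thesis unfolding y_def by (simp only:) simp
  qed
  finally have nt: "nest_time p (order_time n p) 7 \<le> 11718750 * (n * p ^ 8)" .
  have A: "p ^ i \<le> n * p ^ 8" if "i \<le> 8" for i
  proof -
    have "p ^ i \<le> p ^ 8" by (rule power_increasing[OF that assms(2)])
    also have "p ^ 8 \<le> n * p ^ 8" using mult_le_mono1[OF assms(1), of "p ^ 8"] by simp
    finally show ?thesis .
  qed
  have pp: "p \<le> n * p ^ 8" "p ^ 2 \<le> n * p ^ 8" "p ^ 3 \<le> n * p ^ 8" "1 \<le> n * p ^ 8"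
    using A[of 1] A[of 2] A[of 3] A[of 0] by simp_all
  have "p * (p * (2 * p + 6) + 5) = 2 * p ^ 3 + 6 * p ^ 2 + 5 * p"
    by (simp add: algebra_simps power2_eq_square power3_eq_cube)
  thus ?thesis using nt pp assms by linarith
qed

theorem secretary_prog_computes:
  assumes n: "3 \<le> n"
  shows "computes_within secretary_prog [n, k] (concat (map (seed_order (field_size n) n) (seeds (field_size n) 7 (\<lambda>_. 0))))
    (20000000 * n ^ 129)"
proof -
  define l where "l = bit_length n"
  define p where "p = field_size n"
  have l2: "2 \<le> l"
  proof (rule ccontr)
    assume "\<not> 2 \<le> l"
    hence "(2::nat) ^ l \<le> 2 ^ 1" by (intro power_increasing) auto
    thus False using bit_length[of n] n by (simp add: l_def)
  qed
  have pl: "l ^ 8 < p" "p \<le> (l ^ 8) ^ 2"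
  proof -
    show "l ^ 8 < p" unfolding p_def field_size_def l_def by (rule next_prime)
    have "2 ^ 8 \<le> l ^ 8" using l2 by (rule power_mono) simp
    thus "p \<le> (l ^ 8) ^ 2" unfolding p_def field_size_def l_def by (intro next_prime_le_square) simp
  qed
  have powl: "l ^ i \<le> p" if "i \<le> 8" for i
  proof -
    have "l ^ i \<le> l ^ 8" by (rule power_increasing[OF that]) (use l2 in simp)
    thus ?thesis using pl(1) by linarith
  qed
  define B where "B = (l * 3 + 3) + (1 + ((l * 3 + 4) + ((l ^ 2 * 3 + 4) + ((l ^ 4 * 3 + 4) + (1 + ((p * (p * (2 * p + 6) + 5) + 2)
      + nest_time p (order_time n p) 7))))))"
  have "B \<le> 20000000 * (n * p ^ 8)"
    unfolding B_def using powl[of 1] powl[of 2] powl[of 4] n pl by (intro time_le) auto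
  \<comment> \<open>The crude bound p <= n^16 is enough for polynomial time; it yields the degree
    129 = 1 + 16 times 8.\<close>
  also have "\<dots> \<le> 20000000 * (n * (n ^ 16) ^ 8)"
  proof (intro mult_le_mono2 power_mono)
    have "(l ^ 8) ^ 2 = l ^ 16" by simp
    also have "\<dots> \<le> n ^ 16" using bit_length_le[of n] by (intro power_mono) (auto simp: l_def)
    finally have "(l ^ 8) ^ 2 \<le> n ^ 16" .
    with pl(2) show "p \<le> n ^ 16" by (rule order.trans)
  qed simp
  also have "n * (n ^ 16) ^ 8 = n ^ 129"
  proof -
    have "(129 :: nat) = Suc (16 * 8)" by simp
    thus ?thesis by (simp only: power_Suc power_mult)
  qed
  finally have B: "B \<le> 20000000 * n ^ 129" .
  have "halts secretary_prog B (\<lambda>m' out'. out' = concat (map (seed_order p n) (seeds p 7 (\<lambda>_. 0)))) (input_memory [n, k]) []"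
    unfolding B_def l_def p_def using n
    by (intro halts_secretary_prog) (auto simp: input_memory_def fun_eq_iff)
  then obtain T m' out' where "exec secretary_prog (input_memory [n, k], []) T (m', out')" "T \<le> B"
    "out' = concat (map (seed_order p n) (seeds p 7 (\<lambda>_. 0)))" unfolding halts_def by blast
  thus ?thesis unfolding computes_within_def p_def using B by (meson order.trans)
qed

section \<open>Entropy and competitive ratio\<close>

text \<open>Every order that occurs has probability at least 1/size, so each -log p(x) is at most
  the logarithm of the size.\<close>

lemma order_entropy_le:
  assumes L: "L \<noteq> {#}"
  shows "order_entropy n (pmf_of_multiset L) \<le> log 2 (real (size L))"
proof -
  let ?S = "permutations_of_set {1..n}"
  let ?p = "pmf (pmf_of_multiset L)"
  let ?b = "log 2 (real (size L))"
  have size: "1 \<le> size L" using L by (simp add: Suc_leI nonempty_has_size)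
  hence b: "0 \<le> ?b" by simp
  have pmf: "?p x = real (count L x) / real (size L)" for x using L by simp
  have summand: "- (?p x * log 2 (?p x)) \<le> ?p x * ?b" for x
  proof (cases "count L x = 0")
    case True
    thus ?thesis by (simp add: pmf)
  next
    case False
    hence "1 / real (size L) \<le> ?p x" unfolding pmf by (intro divide_right_mono) auto
    hence "log 2 (1 / real (size L)) \<le> log 2 (?p x)" using size False by (subst log_le_cancel_iff) (auto simp: pmf)
    hence "- log 2 (?p x) \<le> ?b" using size L by (simp add: log_divide)
    thus ?thesis using mult_left_mono[of "- log 2 (?p x)" ?b "?p x"] by simp
  qed
  have "order_entropy n (pmf_of_multiset L) = (\<Sum>x\<in>?S. - (?p x * log 2 (?p x)))"
    by (simp add: order_entropy_def sum_negf)
  also have "\<dots> \<le> (\<Sum>x\<in>?S. ?p x * ?b)" by (intro sum_mono summand)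
  also have "\<dots> = (\<Sum>x\<in>?S. ?p x) * ?b" by (simp add: sum_distrib_right)
  also have "(\<Sum>x\<in>?S. ?p x) = measure_pmf.prob (pmf_of_multiset L) ?S" by (simp add: measure_measure_pmf_finite)
  also have "\<dots> * ?b \<le> 1 * ?b" using b by (intro mult_right_mono measure_pmf.prob_le_1)
  finally show ?thesis by simp
qed

definition seed_orders :: "nat \<Rightarrow> nat list multiset" where
  "seed_orders n = mset (map (seed_order (field_size n) n) (seeds (field_size n) 7 (\<lambda>_. 0)))"

lemma field_size: "prime (field_size n)" "bit_length n ^ 8 < field_size n"
  unfolding field_size_def by (rule next_prime)+

lemma field_size_le: "3 \<le> n \<Longrightarrow> field_size n \<le> bit_length n ^ 16"
proof -
  assume n: "3 \<le> n"
  have "2 \<le> bit_length n"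
  proof (rule ccontr)
    assume "\<not> 2 \<le> bit_length n"
    hence "(2::nat) ^ bit_length n \<le> 2 ^ 1" by (intro power_increasing) auto
    thus False using bit_length[of n] n by simp
  qed
  hence "2 ^ 8 \<le> bit_length n ^ 8" by (rule power_mono) simp
  hence "field_size n \<le> (bit_length n ^ 8) ^ 2" unfolding field_size_def by (intro next_prime_le_square) simp
  thus ?thesis by simp
qed

lemma seed_order_in_permutations: "seed_order (field_size n) n a \<in> permutations_of_set {1..n}"
  unfolding seed_order_def using prime_gt_0_nat[OF field_size(1)[of n]]
  by (intro key_order_in_permutations) (simp add: spread_key_def)

lemma size_seed_orders: "size (seed_orders n) = field_size n ^ 7"
  by (simp add: seed_orders_def length_seeds)

lemma seed_orders_nonempty: "seed_orders n \<noteq> {#}"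
proof
  assume "seed_orders n = {#}"
  hence "field_size n ^ 7 = 0" using size_seed_orders[of n] by simp
  thus False using prime_gt_0_nat[OF field_size(1)[of n]] by simp
qed

lemma coefs_nonempty: "0 < p \<Longrightarrow> coefs p w \<noteq> {}"
proof -
  assume "0 < p"
  hence "(\<lambda>_. 0) \<in> coefs p w" by (simp add: PiE_dflt_def)
  thus ?thesis by blast
qed

lemma pmf_seed_orders:
  "pmf_of_multiset (seed_orders n) = map_pmf (seed_order (field_size n) n) (pmf_of_set (coefs (field_size n) 7))"
proof -
  let ?p = "field_size n"
  have "coefs ?p 7 \<noteq> {}" by (rule coefs_nonempty[OF prime_gt_0_nat[OF field_size(1)]])
  moreover have "mset (seeds ?p 7 (\<lambda>_. 0)) = mset_set (coefs ?p 7)"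
    using mset_set_set[OF distinct_seeds[of ?p 7]] by (simp add: set_seeds_zero)
  ultimately show ?thesis by (simp add: seed_orders_def map_pmf_of_set finite_coefs)
qed

lemma sum_coefs_Suc:
  "(\<Sum>b\<in>coefs p (Suc w). F b) = (\<Sum>c<p. \<Sum>a\<in>coefs p w. F (a(w := c)))" for F :: "(nat \<Rightarrow> nat) \<Rightarrow> real"
proof -
  have "(\<Sum>c<p. \<Sum>a\<in>coefs p w. F (a(w := c))) = (\<Sum>(c, a)\<in>{..<p} \<times> coefs p w. F (a(w := c)))"
    by (simp add: sum.cartesian_product)
  also have "\<dots> = (\<Sum>b\<in>coefs p (Suc w). F b)"
  proof (rule sum.reindex_bij_witness[of _ "\<lambda>b. (b w, b(w := 0))" "\<lambda>(c, a). a(w := c)"])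
    fix x assume "x \<in> {..<p} \<times> coefs p w"
    then obtain c a where x: "x = (c, a)" "c < p" "a \<in> coefs p w" by auto
    have "a w = 0" using x(3) by (simp add: PiE_dflt_def)
    hence "(a(w := c))(w := 0) = a" by auto
    thus "(\<lambda>b. (b w, b(w := 0))) (case x of (c, a) \<Rightarrow> a(w := c)) = x" using x by simp
    show "(case x of (c, a) \<Rightarrow> a(w := c)) \<in> coefs p (Suc w)" using x by (auto simp: PiE_dflt_def)
  next
    fix b assume b: "b \<in> coefs p (Suc w)"
    show "(case (b w, b(w := 0)) of (c, a) \<Rightarrow> a(w := c)) = b" by simp
    show "(b w, b(w := 0)) \<in> {..<p} \<times> coefs p w" using b by (auto simp: PiE_dflt_def)
  qed auto
  finally show ?thesis by simp
qed

text \<open>Coordinate 6 of the seed is the hash point and the others form the polynomial. The two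
  averages are separated because whether a hash point is good depends on v alone, and the analysis
  for a good one averages over polynomials only.\<close>

lemma expectation_seed_orders:
  fixes F :: "nat list \<Rightarrow> real" and n :: nat
  defines "p \<equiv> field_size n"
  shows "measure_pmf.expectation (pmf_of_multiset (seed_orders n)) F
    = (\<Sum>c<p. \<Sum>a\<in>coefs p 6. F (key_order p n (spread_key p (peval 6 a) (bit_hash p c)))) / real p ^ 7"
proof -
  have p0: "0 < p" unfolding p_def by (rule prime_gt_0_nat[OF field_size(1)])
  have ne: "coefs p 7 \<noteq> {}" by (rule coefs_nonempty[OF p0])
  have "measure_pmf.expectation (pmf_of_multiset (seed_orders n)) F
    = (\<Sum>b\<in>coefs p 7. F (seed_order p n b)) / real (card (coefs p 7))"
    unfolding pmf_seed_orders integral_map_pmf p_def[symmetric] using ne by (intro integral_pmf_of_set finite_coefs)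
  also have "(\<Sum>b\<in>coefs p 7. F (seed_order p n b)) = (\<Sum>b\<in>coefs p (Suc 6). F (seed_order p n b))" by simp
  also have "\<dots> = (\<Sum>c<p. \<Sum>a\<in>coefs p 6. F (seed_order p n (a(6 := c))))" by (rule sum_coefs_Suc)
  also have "\<dots> = (\<Sum>c<p. \<Sum>a\<in>coefs p 6. F (key_order p n (spread_key p (peval 6 a) (bit_hash p c))))"
  proof -
    have "peval 6 (a(6 := c)) = peval 6 a" for a c by (auto simp: peval_def fun_eq_iff intro!: sum.cong)
    thus ?thesis by (simp add: seed_order_def)
  qed
  finally show ?thesis by (simp add: card_coefs)
qed

section \<open>Small k, collisions, and the size of n\<close>

lemma pow_le_pow_16:
  assumes "2 ^ b \<le> a ^ 16" "a \<le> k" "k \<le> (b::nat)"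
  shows "2 ^ k \<le> k ^ (16::nat)"
proof -
  have "(2::nat) ^ k \<le> 2 ^ b" using assms(3) by (rule power_increasing) simp
  also have "\<dots> \<le> a ^ 16" by (rule assms(1))
  also have "\<dots> \<le> k ^ 16" using assms(2) by (rule power_mono) simp
  finally show ?thesis .
qed

text \<open>The ratio is at most 0 when k <= 16 log k, that is 2^k <= k^16. On an interval from a to
  b it suffices that 2^b <= a^16; the intervals shrink towards 108, where the inequality nearly
  fails.\<close>

lemma ratio_nonpos:
  assumes "2 \<le> k" "k \<le> 108"
  shows "1 - 4 * sqrt (log 2 (real k) / real k) \<le> 0"
proof -
  consider "2 \<le> k" "k \<le> 16" | "16 \<le> k" "k \<le> 64" | "64 \<le> k" "k \<le> 96" | "96 \<le> k" "k \<le> 105"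
    | "105 \<le> k" "k \<le> 107" | "108 \<le> k" "k \<le> 108"
    using assms by linarith
  hence "2 ^ k \<le> k ^ (16::nat)"
    by cases (rule pow_le_pow_16[rotated], assumption, assumption, simp)+
  hence "real (2 ^ k) \<le> real (k ^ 16)" by (rule of_nat_mono)
  hence "(2::real) ^ k \<le> real k ^ 16" by simp
  hence "ln ((2::real) ^ k) \<le> ln (real k ^ 16)" using assms by (subst ln_le_cancel_iff) auto
  hence "real k * ln 2 \<le> 16 * ln (real k)" by (simp add: ln_realpow)
  hence "real k \<le> 16 * log 2 (real k)" by (simp add: log_def field_simps)
  hence "1 / 16 \<le> log 2 (real k) / real k" using assms by (simp add: field_simps)
  hence "sqrt (1 / 16) \<le> sqrt (log 2 (real k) / real k)" by (simp only: real_sqrt_le_iff)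
  moreover have "sqrt (1 / 16) = (1 / 4 :: real)" by (rule real_sqrt_unique) (simp_all add: power_divide)
  ultimately show ?thesis by simp
qed

lemma sum_k_largest_nonneg:
  assumes "\<And>x. x \<in> {1..n} \<Longrightarrow> 0 \<le> v x"
  shows "0 \<le> sum_k_largest n k v"
  unfolding sum_k_largest_eq using assms by (intro sum_nonneg) auto

lemma card_bad_points:
  assumes p: "prime p" and n: "n < 2 ^ L" and A: "A \<subseteq> {1..n}"
  shows "card {c \<in> {..<p}. \<not> inj_on (bit_hash p c) A} \<le> card A ^ 2 * L"
proof -
  let ?bad = "\<lambda>(x, y). {c \<in> {..<p}. x \<noteq> y \<and> bit_hash p c x = bit_hash p c y}"
  have finA: "finite A" using A by (rule finite_subset) simp
  have "{c \<in> {..<p}. \<not> inj_on (bit_hash p c) A} \<subseteq> (\<Union>xy\<in>A \<times> A. ?bad xy)" by (auto simp: inj_on_def)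
  hence "card {c \<in> {..<p}. \<not> inj_on (bit_hash p c) A} \<le> card (\<Union>xy\<in>A \<times> A. ?bad xy)"
    using finA by (intro card_mono) auto
  also have "\<dots> \<le> (\<Sum>xy\<in>A \<times> A. card (?bad xy))" using finA by (intro card_UN_le) auto
  also have "\<dots> \<le> (\<Sum>xy\<in>A \<times> A. L)"
  proof (rule sum_mono)
    fix xy assume "xy \<in> A \<times> A"
    then obtain x y where xy: "xy = (x, y)" "x \<in> A" "y \<in> A" by auto
    show "card (?bad xy) \<le> L"
    proof (cases "x = y")
      case False
      have "x < 2 ^ L" "y < 2 ^ L" using xy A n by auto
      from card_bit_hash_collisions[OF p this False] show ?thesis using False xy by simp
    qed (simp add: xy)
  qed
  also have "\<dots> = card A ^ 2 * L" using finA by (simp add: card_cartesian_product power2_eq_square)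
  finally show ?thesis .
qed

text \<open>Used for 2 p^3 < n, through p <= l^16 and 2^(l-1) <= n. The number 982 is the bit length
  that \<open>size_facts\<close> guarantees, and the induction step rests on (983/982)^48 <=
  2.\<close>

lemma pow_48_le: "982 \<le> l \<Longrightarrow> 2 * l ^ 48 < 2 ^ (l - 1)"
proof (induction l rule: dec_induct)
  case base
  show ?case by simp
next
  case (step l)
  have "982 * Suc l \<le> 983 * l" using step(1) by simp
  hence "(982 * Suc l) ^ 48 \<le> (983 * l) ^ 48" by (rule power_mono) simp
  hence "982 ^ 48 * Suc l ^ 48 \<le> 983 ^ 48 * l ^ 48" by (simp only: power_mult_distrib)
  also have "\<dots> \<le> (2 * 982 ^ 48) * l ^ 48" by (rule mult_le_mono1) simp
  finally have "982 ^ 48 * Suc l ^ 48 \<le> 982 ^ 48 * (2 * l ^ 48)" by (simp only: mult_ac)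
  hence "Suc l ^ 48 \<le> 2 * l ^ 48" by (subst (asm) mult_le_cancel1) simp
  also have "\<dots> < 2 ^ (l - 1)" by (rule step.IH)
  finally have "2 * Suc l ^ 48 < 2 * 2 ^ (l - 1)" by simp
  also have "\<dots> = 2 ^ (Suc l - 1)" using step(1) by (cases l) auto
  finally show ?case .
qed

lemma log_log_facts:
  assumes n: "0 < n" and k: "2 \<le> k" and kn: "real k < log 2 (real n) / log 2 (log 2 (real n))"
  shows "3 \<le> n" and "1 / 2 \<le> log 2 (log 2 (real n))" and "real k * log 2 (log 2 (real n)) < log 2 (real n)"
proof -
  show n3: "3 \<le> n"
  proof (rule ccontr)
    assume "\<not> 3 \<le> n"
    \<comment> \<open>In both cases log log n evaluates to 0, for n = 1 because
      \<open>log 2 0 = 0\<close>. Division by zero then makes the right side of the hypothesis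
      0.\<close>
    hence "n = 1 \<or> n = 2" using n by auto
    thus False using kn k by auto
  qed
  have "log 2 ((2::real) powr (3 / 2)) \<le> log 2 (real n)"
  proof (subst log_le_cancel_iff)
    have "((2::real) powr (3 / 2)) ^ 2 = 2 powr 3" by (simp add: powr_powr flip: powr_realpow)
    hence "((2::real) powr (3 / 2)) ^ 2 \<le> 3 ^ 2" by simp
    hence "(2::real) powr (3 / 2) \<le> 3" by (rule power2_le_imp_le) simp
    thus "(2::real) powr (3 / 2) \<le> real n" using n3 by linarith
  qed (use n3 in auto)
  hence l: "3 / 2 \<le> log 2 (real n)" by simp
  have "log 2 ((2::real) powr (1 / 2)) \<le> log 2 (log 2 (real n))"
  proof (subst log_le_cancel_iff)
    have "((2::real) powr (1 / 2)) ^ 2 = 2 powr 1" by (simp add: powr_powr flip: powr_realpow)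
    hence "((2::real) powr (1 / 2)) ^ 2 \<le> (3 / 2) ^ 2" by (simp add: power_divide)
    hence "(2::real) powr (1 / 2) \<le> 3 / 2" by (rule power2_le_imp_le) simp
    thus "(2::real) powr (1 / 2) \<le> log 2 (real n)" using l by linarith
  qed (use l in auto)
  thus ll: "1 / 2 \<le> log 2 (log 2 (real n))" by simp
  thus "real k * log 2 (log 2 (real n)) < log 2 (real n)"
    using kn by (simp add: pos_less_divide_eq)
qed

lemma log_less_bit_length: "0 < n \<Longrightarrow> log 2 (real n) < real (bit_length n)"
proof -
  assume "0 < n"
  hence "log 2 (real n) < log 2 (2 ^ bit_length n)"
    using bit_length[of n] by (subst log_less_cancel_iff) (auto simp flip: of_nat_less_iff)
  thus ?thesis by (simp add: log_nat_power)
qed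

lemma bit_length_le_log: "0 < n \<Longrightarrow> real (bit_length n) \<le> log 2 (real n) + 1"
proof (cases "bit_length n")
  case (Suc j)
  assume n: "0 < n"
  have "2 ^ j \<le> n" using less_bit_length[of j n] Suc by simp
  hence "real (2 ^ j) \<le> real n" by (rule of_nat_mono)
  hence "log 2 (2 ^ j) \<le> log 2 (real n)" using n by (subst log_le_cancel_iff) auto
  thus ?thesis using Suc by (simp add: log_nat_power)
qed simp

text \<open>There are p^7 seeds, and p <= l^16 <= (log n)^48 for the bit length l, whence 336 = 7
  times 48. The estimate l <= log n + 1 <= (log n)^3 uses log n >= sqrt 2.\<close>

lemma entropy_seed_orders:
  assumes n: "3 \<le> n" and ll: "1 / 2 \<le> log 2 (log 2 (real n))"
  shows "order_entropy n (pmf_of_multiset (seed_orders n)) \<le> 336 * log 2 (log 2 (real n))"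
proof -
  define y where "y = log 2 (real n)"
  have p0: "0 < field_size n" by (rule prime_gt_0_nat[OF field_size(1)])
  have y0: "1 \<le> y"
  proof -
    have "log 2 2 \<le> log 2 (real n)" using n by (subst log_le_cancel_iff) auto
    thus ?thesis by (simp add: y_def)
  qed
  have y2: "sqrt 2 \<le> y"
  proof -
    have "2 powr (1 / 2) \<le> y" using ll y0 by (subst (asm) le_log_iff) (auto simp: y_def)
    thus ?thesis by (simp add: powr_half_sqrt)
  qed
  have yy: "2 \<le> y ^ 2" using power_mono[OF y2, of 2] by simp
  have "y + 1 \<le> y ^ 3"
  proof -
    have "2 * y \<le> y ^ 2 * y" using yy y0 by (intro mult_right_mono) auto
    moreover have "y ^ 2 * y = y ^ 3" by (simp add: power2_eq_square power3_eq_cube)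
    ultimately show ?thesis using y0 by linarith
  qed
  hence bl: "real (bit_length n) \<le> y ^ 3" using bit_length_le_log[of n] n by (simp add: y_def)
  have "order_entropy n (pmf_of_multiset (seed_orders n)) \<le> log 2 (real (size (seed_orders n)))"
    by (rule order_entropy_le[OF seed_orders_nonempty])
  also have "\<dots> = 7 * log 2 (real (field_size n))"
    using p0 by (simp add: size_seed_orders log_nat_power)
  also have "log 2 (real (field_size n)) \<le> log 2 (y ^ 48)"
  proof (subst log_le_cancel_iff)
    have "real (field_size n) \<le> real (bit_length n ^ 16)" using field_size_le[OF n] by (rule of_nat_mono)
    also have "\<dots> = real (bit_length n) ^ 16" by simp
    also have "\<dots> \<le> (y ^ 3) ^ 16" using bl by (intro power_mono) auto
    finally show "real (field_size n) \<le> y ^ 48" by simp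
  qed (use y0 p0 in auto)
  also have "log 2 (y ^ 48) = 48 * log 2 y" using y0 by (simp add: log_nat_power)
  finally show ?thesis by (simp add: y_def)
qed

section \<open>From one hash point to the whole multiset of orders\<close>

context secretary_params
begin

lemma expected_value:
  assumes v: "\<And>x. x \<in> {1..n} \<Longrightarrow> 0 \<le> v x" and avg: "(\<Sum>g\<in>{1..k}. reject_bound g) \<le> real k * b"
  shows "real p ^ 6 * ((1 - b) * sum_k_largest n k v)
    \<le> (\<Sum>a\<in>coefs p 6. accepted_value n k (threshold_run.C n c0) (rank_threshold Q) v (ord a))"
proof -
  have S: "sum_k_largest n k v = (\<Sum>x\<in>best k. v x)"
    unfolding sum_k_largest_eq top_set_def ..
  have rp: "0 < real p ^ 6" using p0 by simp
  have acc: "(\<Sum>a\<in>coefs p 6. if x \<in> accepted_set a then v x else 0) = v x * (real p ^ 6 * (1 - pr (\<lambda>a. x \<notin> accepted_set a)))" for x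
  proof -
    have "card ({a \<in> coefs p 6. x \<in> accepted_set a} \<union> {a \<in> coefs p 6. x \<notin> accepted_set a})
      = card {a \<in> coefs p 6. x \<in> accepted_set a} + card {a \<in> coefs p 6. x \<notin> accepted_set a}"
      by (intro card_Un_disjoint) (auto simp: finite_coefs)
    also have "{a \<in> coefs p 6. x \<in> accepted_set a} \<union> {a \<in> coefs p 6. x \<notin> accepted_set a} = coefs p 6" by auto
    finally have "real (p ^ 6) = real (card {a \<in> coefs p 6. x \<in> accepted_set a} + card {a \<in> coefs p 6. x \<notin> accepted_set a})"
      by (simp only: card_coefs)
    hence "real (card {a \<in> coefs p 6. x \<in> accepted_set a}) = real p ^ 6 * (1 - pr (\<lambda>a. x \<notin> accepted_set a))"
      using rp unfolding pr_def by (simp add: right_diff_distrib)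
    moreover have "(\<Sum>a\<in>coefs p 6. if x \<in> accepted_set a then v x else 0) = v x * real (card {a \<in> coefs p 6. x \<in> accepted_set a})"
      by (simp add: sum.If_cases Int_def finite_coefs mult.commute)
    ultimately show ?thesis by simp
  qed
  have "real p ^ 6 * ((1 - b) * sum_k_largest n k v) = real p ^ 6 * ((\<Sum>x\<in>best k. v x) - b * (\<Sum>x\<in>best k. v x))"
    unfolding S by (simp add: algebra_simps)
  also have "\<dots> \<le> real p ^ 6 * ((\<Sum>x\<in>best k. v x) - (\<Sum>x\<in>best k. v x * pr (\<lambda>a. x \<notin> accepted_set a)))"
    using expected_loss[OF v avg] by (intro mult_left_mono diff_left_mono) auto
  also have "\<dots> = (\<Sum>x\<in>best k. \<Sum>a\<in>coefs p 6. if x \<in> accepted_set a then v x else 0)"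
    unfolding acc by (simp add: sum_distrib_left sum_distrib_right right_diff_distrib sum_subtractf mult_ac)
  also have "\<dots> = (\<Sum>a\<in>coefs p 6. \<Sum>x\<in>best k. if x \<in> accepted_set a then v x else 0)" by (rule sum.swap)
  also have "\<dots> \<le> (\<Sum>a\<in>coefs p 6. accepted_value n k (threshold_run.C n c0) (rank_threshold Q) v (ord a))"
    unfolding accepted_set_def using v
    by (intro sum_mono threshold_run.accepted_value_ge[OF threshold_run]) (auto simp: top_set_def)
  finally show ?thesis .
qed

lemma phase_ends_C: "phase_ends n (threshold_run.C n c0)"
proof -
  interpret threshold_run n k c0 Q v "ord undefined" by (rule threshold_run)
  show ?thesis using c0 n by (auto simp: phase_ends_def C_def)
qed

end

lemma size_facts:
  assumes n: "0 < n" and k: "109 \<le> k" and kn: "real k < log 2 (real n) / log 2 (log 2 (real n))"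
  defines "l \<equiv> bit_length n" and "p \<equiv> field_size n"
  shows "k \<le> l" "982 \<le> l" "2 * p ^ 3 < n" "l ^ 8 < p" "k ^ 2 \<le> n" "k ^ 2 \<le> p"
proof -
  define y where "y = log 2 (real n)"
  have "2 \<le> k" using k by simp
  note facts = log_log_facts[OF n this kn, folded y_def]
  \<comment> \<open>As y > 109 log y, a lower bound on y improves itself: log y >= 1/2 gives log y
    >= 5, this gives log y >= 9, and finally y > 981.\<close>
  have k_mult: "109 * c < y" if "c \<le> log 2 y" "0 \<le> c" for c
  proof -
    have "109 * c \<le> real k * log 2 y" using that k by (intro mult_mono) auto
    thus ?thesis using facts(3) by linarith
  qed
  have "109 * (1 / 2) < y" using facts(2) by (intro k_mult) auto
  hence "5 \<le> log 2 y" by (subst le_log_iff) auto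
  hence "109 * 5 < y" by (intro k_mult) auto
  hence "9 \<le> log 2 y" by (subst le_log_iff) auto
  hence y: "981 < y" "9 \<le> log 2 y" using k_mult[of 9] by auto
  have yl: "y < real l" unfolding y_def l_def by (rule log_less_bit_length[OF n])
  thus l: "982 \<le> l" using y by linarith
  have "real k * 9 \<le> real k * log 2 y" using y by (intro mult_left_mono) auto
  hence "real k \<le> real l" using facts(3) yl by linarith
  thus kl: "k \<le> l" by simp
  have p_le: "p \<le> l ^ 16" unfolding p_def l_def by (rule field_size_le[OF facts(1)])
  have "2 ^ (l - 1) \<le> n" using less_bit_length[of "l - 1" n] l by (simp add: l_def)
  moreover have "p ^ 3 \<le> (l ^ 16) ^ 3" using p_le by (rule power_mono) simp
  moreover have "(l ^ 16) ^ 3 = l ^ 48" by (simp flip: power_mult)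
  ultimately show pn: "2 * p ^ 3 < n" using pow_48_le[OF l] by linarith
  show lp: "l ^ 8 < p" unfolding p_def l_def by (rule field_size)
  have "k ^ 2 \<le> l ^ 2" using kl by (rule power_mono) simp
  also have "l ^ 2 \<le> l ^ 8" using l by (intro power_increasing) auto
  finally show kp: "k ^ 2 \<le> p" using lp by linarith
  have "p ^ 1 \<le> p ^ 3" using lp by (intro power_increasing) auto
  thus "k ^ 2 \<le> n" using kp pn by simp
qed

theorem seed_orders_ratio:
  assumes n: "0 < n" and k: "109 \<le> k" and kn: "real k < log 2 (real n) / log 2 (log 2 (real n))"
  shows "\<exists>C thr. phase_ends n C \<and> expected_ratio_at_least n k C thr (pmf_of_multiset (seed_orders n))
    (1 - 4 * sqrt (log 2 (real k) / real k))"
proof -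
  define p where "p = field_size n"
  define l where "l = bit_length n"
  define \<mu> where "\<mu> = sqrt (log 2 (real k))"
  define t0 where "t0 = 9 / 4 * log 2 (real k) / real k"
  \<comment> \<open>The 2 ensures t0 p <= K0 - 2, as \<open>average_reject_bound\<close> requires;
    with the rounding, \<open>K0\<close> exceeds t0 p by at most 3, the source of 3/p in the
    loss.\<close>
  define K0 where "K0 = nat \<lceil>t0 * real p\<rceil> + 2"
  note sz = size_facts[OF n k kn, folded p_def l_def]
  have p: "prime p" unfolding p_def by (rule field_size)
  have lp: "real l ^ 8 \<le> real p" using sz(4) by (metis less_imp_le of_nat_le_iff of_nat_power)
  have lk: "169 / 25 \<le> log 2 (real k)" and t0_le: "t0 \<le> 9 / 20"
    using total_loss_le(2,3)[OF k] by (auto simp: t0_def)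
  have k0: "0 < real k" using k by simp
  have "0 < log 2 (real k)" using lk by linarith
  hence t0: "0 < t0" unfolding t0_def using k0 by (intro divide_pos_pos mult_pos_pos) simp_all
  have "982 ^ 8 \<le> l ^ 8" using sz(2) by (rule power_mono) simp
  hence p_big: "982 ^ 8 < p" using sz(4) by linarith
  hence rp: "0 < real p" "100 \<le> real p" by auto
  have tp: "0 < t0 * real p" using t0 rp by simp
  have cK: "t0 * real p \<le> real (nat \<lceil>t0 * real p\<rceil>)" "real (nat \<lceil>t0 * real p\<rceil>) \<le> t0 * real p + 1"
    using tp of_int_ceiling_le_add_one[of "t0 * real p"] by (simp_all add: le_of_int_ceiling)
  have K0_ge: "t0 * real p \<le> real (K0 - 2)" "real K0 \<le> t0 * real p + 3" "3 \<le> K0"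
  proof -
    have "0 < nat \<lceil>t0 * real p\<rceil>" using tp by simp
    thus "3 \<le> K0" unfolding K0_def by linarith
  qed (use cK in \<open>simp_all add: K0_def del: of_nat_nat of_nat_ceiling real_nat_ceiling_ge\<close>)
  have "t0 * real p \<le> 9 / 20 * real p" using t0_le rp by (intro mult_right_mono) auto
  hence K0_le: "K0 \<le> p" using K0_ge(2) rp by linarith
  have mu2: "\<mu> ^ 2 = log 2 (real k)" using lk by (simp add: \<mu>_def)
  have params: "secretary_params p n k K0 \<mu> v h" if "\<And>x. h x < p" "inj_on h (top_set n v (k ^ 2))" for v h
  proof
    show "2 \<le> \<mu>" unfolding \<mu>_def using lk by (intro real_le_rsqrt) simp
    show "2 * k \<le> p"
    proof -
      have "2 * k \<le> k ^ 2" using k by (simp add: power2_eq_square)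
      thus ?thesis using sz(6) by linarith
    qed
    show "9 / 4 * \<mu> ^ 2 \<le> real k * real (K0 - 1) / real p"
    proof -
      have "9 / 4 * \<mu> ^ 2 = real k * (t0 * real p) / real p" using rp k0 by (simp add: mu2 t0_def)
      also have "\<dots> \<le> real k * real (K0 - 1) / real p"
        using K0_ge(1) by (intro divide_right_mono mult_left_mono) (auto intro: order.trans)
      finally show ?thesis .
    qed
  qed (use that p p_big sz k K0_ge K0_le lk mu2 in auto)
  define \<delta> where "\<delta> = 4 * sqrt (log 2 (real k) / real k)"
  \<comment> \<open>The loss at a collision-free hash point: the total \<delta> without the spare
    1/(8k), plus the rounding error 3/p. The fraction of bad hash points may thus be as large as
    1/(8k) - 3/p.\<close>
  define b where "b = \<delta> - 1 / (8 * real k) + 3 / real p"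
  define \<Lambda> where "\<Lambda> = ln (1 / t0)"
  define e where "e = 31 / 10 * (1 / \<mu> ^ 4 + 2 * sqrt (real k) * (1 - sqrt t0) / \<mu> ^ 3)"
  have loss: "t0 + 1 / (4 * real k) + (\<mu> + 177 / 100) * (2 * (1 - sqrt t0) / sqrt (real k))
    + (2 * \<Lambda> + 1) / real k + (4 + 2 * e) * \<Lambda> / (real k - 1) \<le> \<delta>"
    unfolding e_def \<Lambda>_def \<delta>_def t0_def \<mu>_def by (rule total_loss_le(1)[OF k])
  have avg: "(\<Sum>g\<in>{1..k}. secretary_params.reject_bound p k K0 \<mu> g) \<le> real k * b"
    if "secretary_params p n k K0 \<mu> v h" for v h
  proof -
    interpret secretary_params p n k K0 \<mu> v h by (rule that)
    have "(\<Sum>g\<in>{1..k}. reject_bound g) \<le> real k * (t0 + 3 / real p + 1 / (8 * real k)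
      + (\<mu> + 177 / 100) * (2 * (1 - sqrt t0) / sqrt (real k)) + (2 * \<Lambda> + 1) / real k
      + (4 + 2 * e) * \<Lambda> / (real k - 1))"
      unfolding e_def \<Lambda>_def using t0 t0_le K0_ge by (intro average_reject_bound) auto
    also have "\<dots> \<le> real k * b"
    proof (intro mult_left_mono)
      have "1 / (4 * real k) = 1 / (8 * real k) + 1 / (8 * real k)" using k0 by (simp add: field_simps)
      thus "t0 + 3 / real p + 1 / (8 * real k)
        + (\<mu> + 177 / 100) * (2 * (1 - sqrt t0) / sqrt (real k)) + (2 * \<Lambda> + 1) / real k
        + (4 + 2 * e) * \<Lambda> / (real k - 1) \<le> b" unfolding b_def using loss by linarith
    qed simp
    finally show ?thesis .
  qed
  have b0: "0 \<le> b"
  proof -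
    have "1 / (8 * real k) \<le> \<delta>"
    proof -
      have "(1 / real k) ^ 2 \<le> log 2 (real k) / real k"
      proof -
        have "1 / real k * (1 / real k) \<le> log 2 (real k) * (1 / real k)"
        proof (intro mult_right_mono)
          have "1 / real k \<le> 1" using k by simp
          thus "1 / real k \<le> log 2 (real k)" using lk by linarith
        qed simp
        thus ?thesis by (simp add: power2_eq_square)
      qed
      hence "1 / real k \<le> sqrt (log 2 (real k) / real k)" by (rule real_le_rsqrt)
      moreover have "1 / (8 * real k) \<le> 4 * (1 / real k)" using k0 by (simp add: field_simps)
      ultimately show ?thesis unfolding \<delta>_def by linarith
    qed
    thus ?thesis using rp by (simp add: b_def)
  qed
  let ?C = "threshold_run.C n (secretary_params.c0 p n K0)"
  let ?thr = "rank_threshold (secretary_params.Q p n k \<mu>)"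
  \<comment> \<open>The checkpoints involve neither v nor h, so any instance of the locale will do.
    Here the values are constant and the hash is the rank modulo p, which is injective on the
    relevant set because k^2 <= p.\<close>
  have C: "phase_ends n ?C"
  proof -
    define h where "h x = rank_of n (\<lambda>_. 0) x mod p" for x
    have "inj_on h (top_set n (\<lambda>_. 0) (k ^ 2))"
    proof (rule inj_onI)
      fix x y assume xy: "x \<in> top_set n (\<lambda>_. 0) (k ^ 2)" "y \<in> top_set n (\<lambda>_. 0) (k ^ 2)" "h x = h y"
      hence "rank_of n (\<lambda>_. 0) x = rank_of n (\<lambda>_. 0) y" using sz(6) by (auto simp: h_def top_set_def)
      thus "x = y" by (rule inj_onD[OF bij_betw_imp_inj_on[OF bij_betw_rank_of]]) (use xy in \<open>auto simp: top_set_def\<close>)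
    qed
    hence "secretary_params p n k K0 \<mu> (\<lambda>_. 0) h" using p_big by (intro params) (auto simp: h_def)
    thus ?thesis by (rule secretary_params.phase_ends_C)
  qed
  have "expected_ratio_at_least n k ?C ?thr (pmf_of_multiset (seed_orders n)) (1 - \<delta>)"
    unfolding expected_ratio_at_least_def
  proof (intro allI impI)
    fix v :: "nat \<Rightarrow> real" assume "\<forall>x\<in>{1..n}. 0 \<le> v x"
    hence v: "0 \<le> v x" if "x \<in> {1..n}" for x using that by blast
    define S where "S = sum_k_largest n k v"
    have S0: "0 \<le> S" unfolding S_def using v by (rule sum_k_largest_nonneg)
    define A where "A = top_set n v (k ^ 2)"
    define bad where "bad = {c \<in> {..<p}. \<not> inj_on (bit_hash p c) A}"
    define val where "val c = (\<Sum>a\<in>coefs p 6. accepted_value n k ?C ?thr v (key_order p n (spread_key p (peval 6 a) (bit_hash p c))))" for c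
    have hp: "bit_hash p c x < p" for c x using p_big by (intro bit_hash_less) simp
    have "card bad \<le> card A ^ 2 * l"
      unfolding bad_def l_def using p bit_length[of n] by (intro card_bad_points) (auto simp: A_def top_set_def)
    also have "card A = k ^ 2" unfolding A_def top_set_def using sz(5) by (rule card_rank_of_less)
    finally have "real (card bad) \<le> real ((k ^ 2) ^ 2 * l)" by (rule of_nat_mono)
    hence cbad: "real (card bad) \<le> real k ^ 4 * real l" by simp
    have val0: "0 \<le> val c" for c
      unfolding val_def
    proof (rule sum_nonneg)
      fix a
      let ?T = "spread_key p (peval 6 a) (bit_hash p c)"
      have T: "?T x < p" for x using p_big by (simp add: spread_key_def)
      have "set (key_order p n ?T) = {1..n}" by (rule set_key_order) (rule T)
      moreover from this have "length (key_order p n ?T) = n" using distinct_card[OF distinct_key_order[of p n ?T]] by simp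
      ultimately show "0 \<le> accepted_value n k ?C ?thr v (key_order p n ?T)" using v by (rule accepted_value_nonneg)
    qed
    have val_good: "real p ^ 6 * ((1 - b) * S) \<le> val c" if "c \<in> {..<p} - bad" for c
    proof -
      have "inj_on (bit_hash p c) (top_set n v (k ^ 2))" using that by (auto simp: bad_def A_def)
      hence sp: "secretary_params p n k K0 \<mu> v (bit_hash p c)" by (intro params hp)
      show ?thesis unfolding S_def val_def
        by (rule secretary_params.expected_value[OF sp v avg[OF sp]])
    qed
    \<comment> \<open>A bad hash point is charged a full loss of 1: the left side is then at most 0,
      as b >= 0, and accepted values are non-negative.\<close>
    have bound: "real p ^ 6 * ((1 - b - (if c \<in> bad then 1 else 0)) * S) \<le> val c" if "c \<in> {..<p}" for c
    proof (cases "c \<in> bad")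
      case True
      have "real p ^ 6 * ((1 - b - 1) * S) \<le> 0" using b0 S0 by (intro mult_nonneg_nonpos mult_nonpos_nonneg) auto
      thus ?thesis using True val0[of c] by simp
    qed (use that val_good in auto)
    have split: "(\<Sum>c<p. 1 - b - (if c \<in> bad then 1 else 0)) = real p * (1 - b) - real (card bad)"
    proof -
      have "bad \<subseteq> {..<p}" by (auto simp: bad_def)
      hence "(\<Sum>c<p. (if c \<in> bad then 1 else 0 :: real)) = real (card bad)"
        by (simp add: sum.If_cases Int_absorb1 Int_absorb2)
      thus ?thesis by (simp add: sum_subtractf)
    qed
    have "real p ^ 6 * ((real p * (1 - b) - real (card bad)) * S)
      = (\<Sum>c<p. real p ^ 6 * ((1 - b - (if c \<in> bad then 1 else 0)) * S))"
      unfolding split[symmetric] by (simp only: sum_distrib_left sum_distrib_right)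
    also have "\<dots> \<le> (\<Sum>c<p. val c)" by (intro sum_mono bound)
    finally have total: "real p ^ 6 * ((real p * (1 - b) - real (card bad)) * S) \<le> (\<Sum>c<p. val c)" .
    have "real (card bad) + 3 \<le> real p / (8 * real k)"
    proof -
      have kl: "real k \<le> real l" "982 \<le> real l" using sz(1,2) by auto
      have "8 * real k * (real (card bad) + 3) \<le> 8 * real l * (real l ^ 4 * real l + 3)"
      proof (intro mult_mono add_mono)
        show "real (card bad) \<le> real l ^ 4 * real l"
          using cbad mult_right_mono[OF power_mono[OF kl(1), of 4], of "real l"] by simp
      qed (use kl in auto)
      also have "\<dots> = 8 * real l ^ 6 + 24 * real l" by (simp add: algebra_simps power_numeral_reduce)
      also have "24 * real l \<le> 24 * real l ^ 6"
        using power_increasing[of 1 6 "real l"] kl by simp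
      also have "8 * real l ^ 6 + 24 * real l ^ 6 \<le> real l ^ 2 * real l ^ 6"
      proof -
        have "32 \<le> real l ^ 2" using power_mono[OF kl(2), of 2] by simp
        hence "32 * real l ^ 6 \<le> real l ^ 2 * real l ^ 6" by (intro mult_right_mono) auto
        thus ?thesis by simp
      qed
      also have "\<dots> = real l ^ 8" by (simp flip: power_add)
      also note lp
      finally show ?thesis using k0 by (simp add: pos_le_divide_eq mult.commute)
    qed
    hence "real p * (1 - \<delta>) \<le> real p * (1 - b) - real (card bad)"
      using rp unfolding b_def by (simp add: algebra_simps)
    hence "real p ^ 6 * ((real p * (1 - \<delta>)) * S) \<le> real p ^ 6 * ((real p * (1 - b) - real (card bad)) * S)"
      using S0 by (intro mult_left_mono mult_right_mono) auto
    hence "real p ^ 6 * ((real p * (1 - \<delta>)) * S) \<le> (\<Sum>c<p. val c)" using total by linarith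
    moreover have "real p ^ 6 * ((real p * (1 - \<delta>)) * S) = ((1 - \<delta>) * S) * real p ^ 7"
      using power_Suc[of "real p" 6] by (simp add: mult_ac)
    ultimately have "(1 - \<delta>) * S \<le> (\<Sum>c<p. val c) / real p ^ 7"
      using rp by (simp add: pos_le_divide_eq)
    thus "(1 - \<delta>) * sum_k_largest n k v
      \<le> measure_pmf.expectation (pmf_of_multiset (seed_orders n)) (accepted_value n k ?C ?thr v)"
      unfolding expectation_seed_orders p_def[symmetric] val_def S_def .
  qed
  thus ?thesis using C unfolding \<delta>_def by blast
qed

lemma expected_ratio_trivial:
  assumes "\<alpha> \<le> 0"
  shows "expected_ratio_at_least n k C thr (pmf_of_multiset (seed_orders n)) \<alpha>"
  unfolding expected_ratio_at_least_def
proof (intro allI impI)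
  fix v :: "nat \<Rightarrow> real" assume "\<forall>x\<in>{1..n}. 0 \<le> v x"
  hence v: "0 \<le> v x" if "x \<in> {1..n}" for x using that by blast
  define p where "p = field_size n"
  have p0: "0 < p" unfolding p_def by (rule prime_gt_0_nat[OF field_size(1)])
  have "0 \<le> measure_pmf.expectation (pmf_of_multiset (seed_orders n)) (accepted_value n k C thr v)"
    unfolding expectation_seed_orders p_def[symmetric]
  proof (intro divide_nonneg_nonneg sum_nonneg)
    fix c a
    let ?T = "spread_key p (peval 6 a) (bit_hash p c)"
    have T: "?T x < p" for x using p0 by (simp add: spread_key_def)
    have "set (key_order p n ?T) = {1..n}" by (rule set_key_order) (rule T)
    moreover from this have "length (key_order p n ?T) = n" using distinct_card[OF distinct_key_order[of p n ?T]] by simp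
    ultimately show "0 \<le> accepted_value n k C thr v (key_order p n ?T)" using v by (rule accepted_value_nonneg)
  qed simp
  moreover have "\<alpha> * sum_k_largest n k v \<le> 0"
    using assms sum_k_largest_nonneg[of n v k] v by (intro mult_nonpos_nonneg) auto
  ultimately show "\<alpha> * sum_k_largest n k v
    \<le> measure_pmf.expectation (pmf_of_multiset (seed_orders n)) (accepted_value n k C thr v)" by linarith
qed

theorem theorem1:
  "\<exists>(prog :: com) (a :: nat) (d :: nat) (B :: real).
     \<forall>(n :: nat) (k :: nat).
       0 < n \<longrightarrow> 2 \<le> k \<longrightarrow> real k < log 2 (real n) / log 2 (log 2 (real n)) \<longrightarrow>
       (\<exists>(L :: nat list multiset) (C :: nat set) (thr :: threshold_rule).
          L \<noteq> {#} \<and> set_mset L \<subseteq> permutations_of_set {1..n} \<and>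
          phase_ends n C \<and>
          expected_ratio_at_least n k C thr (pmf_of_multiset L)
            (1 - 4 * sqrt (log 2 (real k) / real k)) \<and>
          computes_orders_within prog [n, k] L (a * n ^ d) \<and>
          order_entropy n (pmf_of_multiset L) \<le> B * log 2 (log 2 (real n)))"
proof (rule exI[of _ secretary_prog], rule exI[of _ 20000000], rule exI[of _ 129], rule exI[of _ 336], intro allI impI)
  fix n k :: nat
  assume n: "0 < n" and k: "2 \<le> k" and kn: "real k < log 2 (real n) / log 2 (log 2 (real n))"
  note facts = log_log_facts[OF n k kn]
  have "\<exists>C thr. phase_ends n C \<and> expected_ratio_at_least n k C thr (pmf_of_multiset (seed_orders n))
    (1 - 4 * sqrt (log 2 (real k) / real k))"
  proof (cases "k \<le> 108")
    case True
    have "phase_ends n {n}" using n by (simp add: phase_ends_def)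
    thus ?thesis using expected_ratio_trivial[OF ratio_nonpos[OF k True]] by blast
  next
    case False
    thus ?thesis using n kn by (intro seed_orders_ratio) auto
  qed
  then obtain C thr where C: "phase_ends n C" "expected_ratio_at_least n k C thr (pmf_of_multiset (seed_orders n))
    (1 - 4 * sqrt (log 2 (real k) / real k))" by blast
  have "computes_orders_within secretary_prog [n, k] (seed_orders n) (20000000 * n ^ 129)"
    unfolding computes_orders_within_def seed_orders_def using secretary_prog_computes[OF facts(1)] by blast
  moreover have "set_mset (seed_orders n) \<subseteq> permutations_of_set {1..n}"
    using seed_order_in_permutations by (auto simp: seed_orders_def)
  ultimately show "\<exists>L C thr. L \<noteq> {#} \<and> set_mset L \<subseteq> permutations_of_set {1..n} \<and> phase_ends n C \<and>
      expected_ratio_at_least n k C thr (pmf_of_multiset L) (1 - 4 * sqrt (log 2 (real k) / real k)) \<and>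
      computes_orders_within secretary_prog [n, k] L (20000000 * n ^ 129) \<and>
      order_entropy n (pmf_of_multiset L) \<le> 336 * log 2 (log 2 (real n))"
    using C seed_orders_nonempty entropy_seed_orders[OF facts(1,2)] by blast
qed

end
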